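(* Let $\alpha\in(0,2)$, let $Z$ be the standard isotropic $\alpha$-stable process in $\mathbb{C}$ with $Z_0=1$, let $\theta$ be its winding process around $0$, and let $\rho_u=\theta_{A(u)}$, $u\ge 0$, be the time-changed winding process. Then, as $t\to 0^+$, $$\left(t^{-1/\alpha}\rho_{ts},\ s\ge 0\right)\Longrightarrow\left(\zeta_s,\ s\ge 0\right)$$ in distribution on $D([0,\infty),\mathbb{R})$ endowed with the Skorohod topology, where $(\zeta_s,s\ge 0)$ is a symmetric one-dimensional $\alpha$-stable process.
   Context: $Z=(Z_t,t\ge0)$ is the standard isotropic stable process of index $\alpha\in(0,2)$ in $\mathbb{C}\cong\mathbb{R}^2$ starting from $1$: it has stationary independent increments, cadlag paths, and $E[\exp(i\langle\lambda,Z_t-Z_0\rangle)]=\exp(-t|\lambda|^\alpha)$ for all $t\ge0$, $\lambda\in\mathbb{C}$, with $\langle\cdot,\cdot\rangle$ the Euclidean inner product. Almost surely $Z$ never visits $0$, $|Z_t|\to\infty$, and no jump segment of $Z$ contains $0$. Winding process $\theta=(\theta_t,t\ge0)$: on $[0,t]$, complete the path of $Z$ into a continuous curve in $\mathbb{C}\setminus\{0\}$ starting at $1$ by filling in each jump with the line segment $[Z_{s-},Z_s]$; $\theta_t$ is the total variation of the continuous determination of the argument along this curve (signed total angle wound around $0$). Equivalently, $\theta$ is the cadlag process with $\theta_0=0$, $\exp(i\theta_t)=Z_t/|Z_t|$ for all $t$, and all jumps of absolute value less than $\pi$. Clock: $H(t)=\int_0^t |Z_s|^{-\alpha}\,ds$,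 with inverse $A(u)=\inf\{t\ge0: H(t)>u\}$. The process $\rho_u=\theta_{A(u)}$ is a symmetric real-valued L\'evy process started at $0$ (a known result). *)

theory Defs
  imports "HOL-Probability.Probability"
begin

text \<open>Processes are curried, time first: \<open>X t \<omega>\<close>. Only times \<open>t \<ge> 0\<close> carry meaning.\<close>

definition cadlag :: "(real \<Rightarrow> 'a::topological_space) \<Rightarrow> bool" where
  "cadlag f \<longleftrightarrow>
     (\<forall>t\<ge>0. (f \<longlongrightarrow> f t) (at_right t)) \<and> (\<forall>t>0. \<exists>l. (f \<longlongrightarrow> l) (at_left t))"

text \<open>The isotropic \<open>\<alpha>\<close>-stable process with scale \<open>c\<close> started at \<open>x\<close>. For \<open>'a = complex\<close>
  and \<open>c = 1\<close> this is the standard isotropic planar stable process; for \<open>'a = real\<close> it is the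
  symmetric one-dimensional stable process.\<close>

locale isotropic_stable_process = prob_space M
  for M :: "'w measure" +
  fixes \<alpha> c :: real and x :: "'a::euclidean_space" and Z :: "real \<Rightarrow> 'w \<Rightarrow> 'a"
  assumes random_variable: "\<And>t. 0 \<le> t \<Longrightarrow> random_variable borel (Z t)"
    and start: "AE \<omega> in M. Z 0 \<omega> = x"
    and cadlag_paths: "AE \<omega> in M. cadlag (\<lambda>t. Z t \<omega>)"
    and independent_increments:
      "\<And>(t :: nat \<Rightarrow> real) n. mono t \<Longrightarrow> 0 \<le> t 0 \<Longrightarrow>
         indep_vars (\<lambda>_. borel) (\<lambda>i \<omega>. Z (t (Suc i)) \<omega> - Z (t i) \<omega>) {..<n}"
    and stationary_increments:
      "\<And>s t. 0 \<le> s \<Longrightarrow> 0 \<le> t \<Longrightarrow>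
         distr M borel (\<lambda>\<omega>. Z (s + t) \<omega> - Z s \<omega>) = distr M borel (\<lambda>\<omega>. Z t \<omega> - Z 0 \<omega>)"
    and characteristic_function:
      "\<And>t \<xi>. 0 \<le> t \<Longrightarrow>
         (\<integral>\<omega>. exp (\<i> * complex_of_real (\<xi> \<bullet> (Z t \<omega> - Z 0 \<omega>))) \<partial>M)
           = complex_of_real (exp (- (c * t * norm \<xi> powr \<alpha>)))"

text \<open>The space \<open>D([0,\<infinity>), \<real>)\<close>; extensionality makes a path determined by its values on
  \<open>[0,\<infinity>)\<close>.\<close>

definition skorokhod_space :: "(real \<Rightarrow> real) set" where
  "skorokhod_space = {f \<in> extensional {0..}. cadlag f}"

text \<open>The winding of a path \<open>z\<close> around \<open>0\<close>: the unique cadlag determination of the argument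
  that starts at \<open>0\<close> and whose jumps are less than \<open>\<pi>\<close>, i.e. each jump of \<open>z\<close> contributes the
  angle swept by its line segment. It exists when \<open>z\<close> is cadlag, starts at \<open>1\<close>, and
  neither \<open>z\<close>, its left limits nor its jump segments meet \<open>0\<close>; for the stable process this
  happens almost surely. Here \<open>sgn w = w / \<bar>w\<bar>\<close>.\<close>

definition is_winding :: "(real \<Rightarrow> complex) \<Rightarrow> (real \<Rightarrow> real) \<Rightarrow> bool" where
  "is_winding z f \<longleftrightarrow> f \<in> skorokhod_space \<and> f 0 = 0
     \<and> (\<forall>t\<ge>0. exp (\<i> * complex_of_real (f t)) = sgn (z t))
     \<and> (\<forall>t>0. \<bar>f t - Lim (at_left t) f\<bar> < pi)"

definition winding :: "(real \<Rightarrow> complex) \<Rightarrow> real \<Rightarrow> real" where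
  "winding z = (THE f. is_winding z f)"

definition clock :: "real \<Rightarrow> (real \<Rightarrow> complex) \<Rightarrow> real \<Rightarrow> ennreal" where
  "clock \<alpha> z t = (\<integral>\<^sup>+s\<in>{0..t}. ennreal (norm (z s) powr - \<alpha>) \<partial>lborel)"

definition inverse_clock :: "real \<Rightarrow> (real \<Rightarrow> complex) \<Rightarrow> real \<Rightarrow> real" where
  "inverse_clock \<alpha> z u = Inf {t. 0 \<le> t \<and> ennreal u < clock \<alpha> z t}"

definition time_changed_winding ::
    "real \<Rightarrow> (real \<Rightarrow> 'w \<Rightarrow> complex) \<Rightarrow> real \<Rightarrow> 'w \<Rightarrow> real" where
  "time_changed_winding \<alpha> Z u \<omega> =
     winding (\<lambda>s. Z s \<omega>) (inverse_clock \<alpha> (\<lambda>s. Z s \<omega>) u)"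

text \<open>Skorohod's \<open>J\<^sub>1\<close> topology on \<open>D([0,\<infinity>), \<real>)\<close> is the metrizable topology whose convergent
  sequences are those in \<open>skorokhod_converges\<close> (Jacod and Shiryaev, Limit Theorems for
  Stochastic Processes, Theorem VI.1.14). By metrizability its open sets are exactly the
  sequentially open ones. The time changes are the increasing bijections of \<open>[0,\<infinity>)\<close>,
  which are automatically continuous and fix \<open>0\<close>.\<close>

definition time_changes :: "(real \<Rightarrow> real) set" where
  "time_changes = {l. strict_mono_on {0..} l \<and> l ` {0..} = {0..}}"

definition skorokhod_converges :: "(nat \<Rightarrow> real \<Rightarrow> real) \<Rightarrow> (real \<Rightarrow> real) \<Rightarrow> bool" where
  "skorokhod_converges xs x \<longleftrightarrow>
     (\<exists>l. (\<forall>n. l n \<in> time_changes)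
        \<and> uniform_limit {0..} l (\<lambda>s. s) sequentially
        \<and> (\<forall>T. uniform_limit {0..T} (\<lambda>n s. xs n (l n s)) x sequentially))"

definition skorokhod_open :: "(real \<Rightarrow> real) set \<Rightarrow> bool" where
  "skorokhod_open U \<longleftrightarrow> U \<subseteq> skorokhod_space \<and>
     (\<forall>x\<in>U. \<forall>xs. (\<forall>n. xs n \<in> skorokhod_space) \<longrightarrow> skorokhod_converges xs x \<longrightarrow>
        (\<forall>\<^sub>F n in sequentially. xs n \<in> U))"

definition skorokhod_topology :: "(real \<Rightarrow> real) topology" where
  "skorokhod_topology = topology skorokhod_open"

lemma openin_skorokhod_topology: "openin skorokhod_topology U \<longleftrightarrow> skorokhod_open U"
proof -
  have "skorokhod_open (S \<inter> T)" if "skorokhod_open S" "skorokhod_open T" for S T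
    using that unfolding skorokhod_open_def by (auto intro: eventually_conj)
  moreover have "skorokhod_open (\<Union>\<K>)" if *: "\<forall>K\<in>\<K>. skorokhod_open K" for \<K>
    unfolding skorokhod_open_def
  proof (intro conjI ballI allI impI)
    show "\<Union>\<K> \<subseteq> skorokhod_space" using * unfolding skorokhod_open_def by blast
  next
    fix x xs
    assume "x \<in> \<Union>\<K>" and xs: "\<forall>n. xs n \<in> skorokhod_space" "skorokhod_converges xs x"
    then obtain K where K: "K \<in> \<K>" "x \<in> K" by blast
    then have "\<forall>\<^sub>F n in sequentially. xs n \<in> K"
      using * xs unfolding skorokhod_open_def by blast
    then show "\<forall>\<^sub>F n in sequentially. xs n \<in> \<Union>\<K>"
      by (rule eventually_mono) (use K in blast)
  qed
  ultimately have "istopology skorokhod_open"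
    unfolding istopology_def by blast
  then show ?thesis
    unfolding skorokhod_topology_def by (simp only: topology_inverse')
qed

lemma topspace_skorokhod_topology: "topspace skorokhod_topology = skorokhod_space"
proof
  show "topspace skorokhod_topology \<subseteq> skorokhod_space"
    using openin_topspace[of skorokhod_topology]
    unfolding openin_skorokhod_topology skorokhod_open_def by blast
  have "openin skorokhod_topology skorokhod_space"
    by (simp add: openin_skorokhod_topology skorokhod_open_def)
  then show "skorokhod_space \<subseteq> topspace skorokhod_topology"
    by (rule openin_subset)
qed

definition skorokhod_borel :: "(real \<Rightarrow> real) measure" where
  "skorokhod_borel = sigma skorokhod_space {U. openin skorokhod_topology U}"

text \<open>A process with almost surely cadlag paths is a random element of \<open>D([0,\<infinity>), \<real>)\<close> after
  its exceptional paths are replaced by the zero path. Passing to the completion makes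
  measurability and law insensitive to that choice.\<close>

definition sample_path :: "(real \<Rightarrow> 'w \<Rightarrow> real) \<Rightarrow> 'w \<Rightarrow> real \<Rightarrow> real" where
  "sample_path X \<omega> =
     (if cadlag (\<lambda>s. X s \<omega>) then (\<lambda>s\<in>{0..}. X s \<omega>) else (\<lambda>s\<in>{0..}. 0))"

definition skorokhod_random_element :: "'w measure \<Rightarrow> (real \<Rightarrow> 'w \<Rightarrow> real) \<Rightarrow> bool" where
  "skorokhod_random_element M X \<longleftrightarrow>
     (AE \<omega> in M. cadlag (\<lambda>s. X s \<omega>))
     \<and> sample_path X \<in> completion M \<rightarrow>\<^sub>M skorokhod_borel"

definition skorokhod_law :: "'w measure \<Rightarrow> (real \<Rightarrow> 'w \<Rightarrow> real) \<Rightarrow> (real \<Rightarrow> real) measure" where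
  "skorokhod_law M X = distr (completion M) skorokhod_borel (sample_path X)"

text \<open>\<open>X i\<close> (on \<open>M\<close>) converges in distribution to \<open>Y\<close> (on \<open>N\<close>) along the filter \<open>F\<close>.\<close>

definition converges_in_distribution ::
    "'w measure \<Rightarrow> ('i \<Rightarrow> real \<Rightarrow> 'w \<Rightarrow> real) \<Rightarrow> 'i filter \<Rightarrow>
     'v measure \<Rightarrow> (real \<Rightarrow> 'v \<Rightarrow> real) \<Rightarrow> bool" where
  "converges_in_distribution M X F N Y \<longleftrightarrow>
     (\<forall>\<^sub>F i in F. skorokhod_random_element M (X i)) \<and> skorokhod_random_element N Y \<and>
     (\<forall>\<Phi>. continuous_map skorokhod_topology euclideanreal \<Phi> \<and> bounded (\<Phi> ` skorokhod_space) \<longrightarrow>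
        ((\<lambda>i. \<integral>x. \<Phi> x \<partial>skorokhod_law M (X i)) \<longlongrightarrow> (\<integral>x. \<Phi> x \<partial>skorokhod_law N Y)) F)"

end

theory Submission imports Defs "HOL-Real_Asymp.Real_Asymp" begin

text \<open>
  The proof is a coupling: self-similarity turns convergence in law into convergence along almost
  every path, and the limit is read off from \<open>Z\<close> itself.

  For \<open>t > 0\<close> put \<open>\<epsilon> = t powr (1 / \<alpha>)\<close> and \<open>Y s = 1 + \<epsilon> *\<^sub>R (Z (s / t) - 1)\<close>. By scaling, \<open>Y\<close> is
  again a standard planar stable process started at 1 (\<open>scaled_process\<close>), hence has the law of
  \<open>Z\<close>, and the rescaled time-changed winding of \<open>Z\<close> has the law of that of \<open>Y\<close>. Now
  \<open>Y (t * s) = 1 + \<epsilon> *\<^sub>R (Z s - 1)\<close> stays close to 1 on compact time intervals. There its winding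
  angle is the principal argument, which is \<open>\<epsilon> * Im (Z s)\<close> up to an error of order \<open>\<epsilon>\<^sup>2\<close>, and its
  clock at time \<open>t * s\<close>, divided by \<open>t\<close>, is close to \<open>s\<close>. This clock is itself an admissible time
  change, so the rescaled winding of \<open>Y\<close> converges in Skorohod's topology to the path of \<open>Im Z\<close>
  (\<open>scaled_winding_converges\<close>), a symmetric \<open>\<alpha>\<close>-stable process on the line. Dominated convergence
  finishes the proof, with \<open>c = 1\<close>.

  The rest of the work makes these objects exist and makes the argument measurable.

  Almost surely the winding and the time change are well defined (\<open>AE_good_path\<close>), for three
  reasons. The process does not approach the origin: an increment over time \<open>t - s\<close> has a law that
  charges discs of radius \<open>r\<close> with mass \<open>o(r powr \<alpha>)\<close>, uniformly for \<open>t - s\<close> away from 0, and a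
  maximal inequality transfers this to blocks of time of length \<open>r powr \<alpha>\<close>. No jump segment meets
  the origin: the direction of a jump is uniform and independent of the past. The clock tends to
  infinity: \<open>norm (Z s) powr - \<alpha>\<close> is at least of order \<open>1 / s\<close> at most times \<open>s\<close>, and the integral of
  \<open>1 / s\<close> diverges.

  For a path with these properties, sums of principal arguments of quotients along fine grids
  become constant, and their value is the winding (\<open>winding_eq\<close>). This proves existence and
  uniqueness of the winding, and shows that it is a measurable function of the path.

  Finally, every Borel set of Skorohod space is generated by evaluations
  (\<open>measurable_skorokhod_borel\<close>), so that random paths are random elements as soon as their
  marginals are random variables, and the law of a planar stable path on the space of such paths
  is determined by its characteristic functions (\<open>good_path_law_unique\<close>).\<close>

section \<open>The Skorohod topology and its Borel sets\<close>

lemma time_changesD: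
  assumes "l \<in> time_changes"
  shows "\<And>s t. 0 \<le> s \<Longrightarrow> s < t \<Longrightarrow> l s < l t"
    and "\<And>s. 0 \<le> s \<Longrightarrow> 0 \<le> l s"
    and "bij_betw l {0..} {0..}"
proof -
  have *: "strict_mono_on {0..} l" "l ` {0..} = {0..}"
    using assms by (auto simp: time_changes_def)
  show "\<And>s t. 0 \<le> s \<Longrightarrow> s < t \<Longrightarrow> l s < l t"
    using strict_mono_onD[OF *(1)] by auto
  show "\<And>s. 0 \<le> s \<Longrightarrow> 0 \<le> l s" using *(2) by auto
  show "bij_betw l {0..} {0..}"
    using *(2) strict_mono_on_imp_inj_on[OF *(1)] by (simp add: bij_betw_def)
qed

lemma id_time_change: "(\<lambda>s. s) \<in> time_changes"
  by (auto simp: time_changes_def strict_mono_on_def)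

lemma time_changes_comp:
  assumes "l \<in> time_changes" "m \<in> time_changes"
  shows "(\<lambda>s. m (l s)) \<in> time_changes"
proof -
  have "(\<lambda>s. m (l s)) ` {0..} = {0..}"
    using assms unfolding time_changes_def by (force simp: image_image[symmetric])
  moreover have "strict_mono_on {0..} (\<lambda>s. m (l s))"
    using time_changesD[OF assms(1)] time_changesD[OF assms(2)] by (auto intro!: strict_mono_onI)
  ultimately show ?thesis by (simp add: time_changes_def)
qed

lemma time_changes_inverse:
  assumes "l \<in> time_changes"
  obtains m where "m \<in> time_changes" "\<And>s. 0 \<le> s \<Longrightarrow> l (m s) = s"
proof
  let ?m = "inv_into {0..} l"
  have b: "bij_betw l {0..} {0..}" by (rule time_changesD(3)[OF assms])
  show inv: "l (?m s) = s" if "0 \<le> s" for s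
    using b that by (simp add: bij_betw_inv_into_right)
  have m: "bij_betw ?m {0..} {0..}" by (rule bij_betw_inv_into[OF b])
  have nn: "0 \<le> ?m s" if "0 \<le> s" for s using m that by (auto simp: bij_betw_def)
  have "?m s < ?m t" if "0 \<le> s" "s < t" for s t
  proof (rule ccontr)
    assume "\<not> ?m s < ?m t"
    then have "?m t \<le> ?m s" by simp
    then have "l (?m t) \<le> l (?m s)"
      using time_changesD(1)[OF assms, of "?m t" "?m s"] nn[of t] that by (cases "?m t = ?m s") auto
    then show False using inv that by simp
  qed
  then have "strict_mono_on {0..} ?m" by (auto intro!: strict_mono_onI)
  with m show "?m \<in> time_changes" by (simp add: time_changes_def bij_betw_def)
qed

text \<open>Basic neighbourhoods of Skorohod's topology. They behave like the balls of a
  uniformity only up to a change of the horizon \<open>T\<close>: the time change moves the end of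
  the interval by at most \<open>e\<close>.\<close>

definition skorokhod_ball :: "real \<Rightarrow> real \<Rightarrow> (real \<Rightarrow> real) \<Rightarrow> (real \<Rightarrow> real) set" where
  "skorokhod_ball T e x = {y. \<exists>l\<in>time_changes.
     (\<forall>s\<ge>0. \<bar>l s - s\<bar> \<le> e) \<and> (\<forall>s\<in>{0..T}. \<bar>y (l s) - x s\<bar> \<le> e)}"

lemma skorokhod_ball_mono:
  "T' \<le> T \<Longrightarrow> e \<le> e' \<Longrightarrow> skorokhod_ball T e x \<subseteq> skorokhod_ball T' e' x"
  unfolding skorokhod_ball_def
  by (intro Collect_mono impI, elim bexE, rule bexI) (auto intro: order_trans)

lemma skorokhod_ball_sym:
  assumes "y \<in> skorokhod_ball T e x"
  shows "x \<in> skorokhod_ball (T - e) e y"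
proof -
  obtain l where l: "l \<in> time_changes" "\<And>s. 0 \<le> s \<Longrightarrow> \<bar>l s - s\<bar> \<le> e"
    "\<And>s. s \<in> {0..T} \<Longrightarrow> \<bar>y (l s) - x s\<bar> \<le> e"
    using assms by (auto simp: skorokhod_ball_def)
  obtain m where m: "m \<in> time_changes" "\<And>s. 0 \<le> s \<Longrightarrow> l (m s) = s"
    using time_changes_inverse[OF l(1)] by blast
  have nn: "0 \<le> m s" if "0 \<le> s" for s using time_changesD(2)[OF m(1) that] .
  have d: "\<bar>m s - s\<bar> \<le> e" if "0 \<le> s" for s
    using l(2)[OF nn[OF that]] m(2)[OF that] by (simp add: abs_minus_commute)
  have "\<bar>x (m s) - y s\<bar> \<le> e" if "s \<in> {0..T - e}" for s
    using l(3)[of "m s"] m(2)[of s] nn[of s] d[of s] that by (simp add: abs_minus_commute abs_le_iff)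
  with m(1) d show ?thesis unfolding skorokhod_ball_def by blast
qed

lemma skorokhod_ball_trans:
  assumes "y \<in> skorokhod_ball T e x" "z \<in> skorokhod_ball (T + e) d y"
  shows "z \<in> skorokhod_ball T (e + d) x"
proof -
  obtain l where l: "l \<in> time_changes" "\<And>s. 0 \<le> s \<Longrightarrow> \<bar>l s - s\<bar> \<le> e"
    "\<And>s. s \<in> {0..T} \<Longrightarrow> \<bar>y (l s) - x s\<bar> \<le> e"
    using assms(1) by (auto simp: skorokhod_ball_def)
  obtain m where m: "m \<in> time_changes" "\<And>s. 0 \<le> s \<Longrightarrow> \<bar>m s - s\<bar> \<le> d"
    "\<And>s. s \<in> {0..T + e} \<Longrightarrow> \<bar>z (m s) - y s\<bar> \<le> d"
    using assms(2) by (auto simp: skorokhod_ball_def)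
  have nn: "0 \<le> l s" if "0 \<le> s" for s using time_changesD(2)[OF l(1) that] .
  have 1: "\<bar>m (l s) - s\<bar> \<le> e + d" if "0 \<le> s" for s
    using l(2)[OF that] m(2)[OF nn[OF that]] by linarith
  have "\<bar>z (m (l s)) - x s\<bar> \<le> e + d" if "s \<in> {0..T}" for s
    using l(2)[of s] l(3)[OF that] m(3)[of "l s"] nn[of s] that by (simp add: abs_le_iff)
  with 1 time_changes_comp[OF l(1) m(1)] show ?thesis
    unfolding skorokhod_ball_def by (intro CollectI bexI[of _ "\<lambda>s. m (l s)"]) auto
qed

text \<open>A diagonal argument: a single sequence of time changes must serve all horizons, so the
  one used for \<open>xs n\<close> comes from the largest \<open>k \<le> n\<close> whose
  neighbourhood contains \<open>xs n\<close>.\<close>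

lemma skorokhod_convergesI:
  assumes ev: "\<And>k::nat. \<forall>\<^sub>F n in sequentially. xs n \<in> skorokhod_ball k (1 / Suc k) x"
  shows "skorokhod_converges xs x"
proof -
  \<comment> \<open>the neighbourhoods known to contain \<open>xs n\<close>; for large \<open>n\<close> their indices are unbounded\<close>
  define good where "good n = {k. k \<le> n \<and> xs n \<in> skorokhod_ball (real k) (1 / real (Suc k)) x}" for n
  have "\<exists>l\<in>time_changes. good n \<noteq> {} \<longrightarrow> (\<forall>s::real\<ge>0. \<bar>l s - s\<bar> \<le> 1 / Suc (Max (good n)))
     \<and> (\<forall>s\<in>{0..real (Max (good n))}. \<bar>xs n (l s) - x s\<bar> \<le> 1 / Suc (Max (good n)))" for n
  proof (cases "good n = {}")
    case True
    then show ?thesis using id_time_change by blast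
  next
    case False
    have "finite (good n)" by (simp add: good_def)
    then have "Max (good n) \<in> good n" using False by simp
    then have "xs n \<in> skorokhod_ball (real (Max (good n))) (1 / real (Suc (Max (good n)))) x"
      by (simp add: good_def)
    then show ?thesis unfolding skorokhod_ball_def by blast
  qed
  then obtain l where l: "\<And>n. l n \<in> time_changes"
     "\<And>n s. good n \<noteq> {} \<Longrightarrow> s \<ge> 0 \<Longrightarrow> \<bar>l n s - s\<bar> \<le> 1 / Suc (Max (good n))"
     "\<And>n s. good n \<noteq> {} \<Longrightarrow> s \<in> {0..real (Max (good n))} \<Longrightarrow> \<bar>xs n (l n s) - x s\<bar> \<le> 1 / Suc (Max (good n))"
    by metis
  have big: "\<forall>\<^sub>F n in sequentially. good n \<noteq> {} \<and> k \<le> Max (good n)" for k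
    using ev[of k] eventually_ge_at_top[of k]
  proof eventually_elim
    case (elim n)
    then have "k \<in> good n" "finite (good n)" by (auto simp: good_def)
    then show ?case by auto
  qed
  have le: "1 / real (Suc m) \<le> 1 / real (Suc k)" if "k \<le> m" for k m :: nat
    using that by (simp add: frac_le)
  have "uniform_limit {0..} l (\<lambda>s. s) sequentially"
  proof (rule uniform_limitI)
    fix e :: real assume "0 < e"
    then obtain k where k: "1 / real (Suc k) < e" using nat_approx_posE by (metis)
    show "\<forall>\<^sub>F n in sequentially. \<forall>s\<in>{0..}. dist (l n s) s < e"
      using big[of k]
    proof eventually_elim
      case (elim n)
      then show ?case using l(2)[of n] le[of k "Max (good n)"] k
        by (fastforce simp: dist_real_def)
    qed
  qed
  moreover have "uniform_limit {0..T} (\<lambda>n s. xs n (l n s)) x sequentially" for T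
  proof (rule uniform_limitI)
    fix e :: real assume "0 < e"
    then obtain k where k: "1 / real (Suc k) < e" using nat_approx_posE by (metis)
    obtain K where K: "T \<le> real K" using real_arch_simple by blast
    show "\<forall>\<^sub>F n in sequentially. \<forall>s\<in>{0..T}. dist (xs n (l n s)) (x s) < e"
      using big[of "max k K"]
    proof eventually_elim
      case (elim n)
      then have m: "T \<le> real (Max (good n))" "k \<le> Max (good n)" "good n \<noteq> {}" using K by auto
      show ?case
      proof
        fix s assume "s \<in> {0..T}"
        then have "s \<in> {0..real (Max (good n))}" using m by auto
        from l(3)[OF m(3) this] show "dist (xs n (l n s)) (x s) < e"
          using le[OF m(2)] k by (simp add: dist_real_def)
      qed
    qed
  qed
  ultimately show ?thesis unfolding skorokhod_converges_def using l(1) by blast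
qed

text \<open>Otherwise one could choose a point outside \<open>U\<close> in each of the shrinking
  neighbourhoods, and these points would converge to \<open>x\<close>.\<close>

lemma skorokhod_open_ball:
  assumes U: "skorokhod_open U" and x: "x \<in> U"
  shows "\<exists>k::nat. skorokhod_ball k (1 / Suc k) x \<inter> skorokhod_space \<subseteq> U"
proof (rule ccontr)
  assume "\<not> ?thesis"
  then have "\<forall>k. \<exists>y. y \<in> skorokhod_ball (real k) (1 / real (Suc k)) x \<and> y \<in> skorokhod_space \<and> y \<notin> U"
    by blast
  then obtain y where y: "\<And>k. y k \<in> skorokhod_ball (real k) (1 / real (Suc k)) x"
      "\<And>k. y k \<in> skorokhod_space" "\<And>k. y k \<notin> U" by metis
  have "skorokhod_converges y x"
  proof (rule skorokhod_convergesI)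
    fix k :: nat
    show "\<forall>\<^sub>F n in sequentially. y n \<in> skorokhod_ball (real k) (1 / real (Suc k)) x"
      using eventually_ge_at_top[of k]
    proof eventually_elim
      case (elim n)
      then show ?case using y(1)[of n] skorokhod_ball_mono[of "real k" "real n" "1 / real (Suc n)" "1 / real (Suc k)" x]
        by (auto simp: frac_le)
    qed
  qed
  then have "\<forall>\<^sub>F n in sequentially. y n \<in> U"
    using U x y(2) unfolding skorokhod_open_def by blast
  then show False using y(3) by simp
qed

text \<open>A step function with values in \<open>(1/n)\<int>\<close> that only looks at the times
  \<open>k / n\<close> with \<open>k \<le> n\<^sup>2\<close>. For each \<open>n\<close> there are
  thus only countably many approximations, whatever the path.\<close>

definition grid_approximation :: "nat \<Rightarrow> (real \<Rightarrow> real) \<Rightarrow> real \<Rightarrow> real" where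
  "grid_approximation n x s =
     \<lfloor>n * x (real (min (nat \<lfloor>n * s\<rfloor>) (n * n)) / n)\<rfloor> / n"

text \<open>Continuous induction in a form suited to functions with one-sided limits: an additive
  property of intervals holds everywhere if it holds on short intervals to the right and to the
  left of each point. It replaces the choice of a partition on which a cadlag function oscillates
  little.\<close>

lemma interval_gluing:
  fixes P :: "real \<Rightarrow> real \<Rightarrow> bool"
  assumes "a \<le> b"
    and refl: "\<And>t. a \<le> t \<Longrightarrow> P t t"
    and trans: "\<And>r s t. a \<le> r \<Longrightarrow> r \<le> s \<Longrightarrow> s \<le> t \<Longrightarrow> P r s \<Longrightarrow> P s t \<Longrightarrow> P r t"
    and right: "\<And>t. a \<le> t \<Longrightarrow> \<forall>\<^sub>F s in at_right t. P t s"
    and left: "\<And>t. a < t \<Longrightarrow> \<forall>\<^sub>F s in at_left t. P s t"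
  shows "P a b"
proof -
  define Q where "Q r s \<longleftrightarrow> a \<le> r \<longrightarrow> P r s" for r s
  have "Q a b"
  proof (rule Bolzano[OF \<open>a \<le> b\<close>])
    show "Q r t" if "Q r s" "Q s t" "r \<le> s" "s \<le> t" for r s t
      using trans that by (auto simp: Q_def)
  next
    fix t assume t: "a \<le> t" "t \<le> b"
    obtain d1 where d1: "d1 > t" "\<And>s. t < s \<Longrightarrow> s < d1 \<Longrightarrow> P t s"
      using right[OF t(1)] unfolding eventually_at_right_field by blast
    have "\<exists>d2<t. \<forall>s. d2 < s \<and> s < t \<and> a \<le> s \<longrightarrow> P s t"
    proof (cases "a < t")
      case True
      from left[OF this] show ?thesis unfolding eventually_at_left_field by blast
    next
      case False
      then show ?thesis by (intro exI[of _ "t - 1"]) auto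
    qed
    then obtain d2 where d2: "d2 < t" "\<And>s. d2 < s \<Longrightarrow> s < t \<Longrightarrow> a \<le> s \<Longrightarrow> P s t" by blast
    show "\<exists>d>0. \<forall>r s. r \<le> t \<and> t \<le> s \<and> s - r < d \<longrightarrow> Q r s"
    proof (intro exI[of _ "min (d1 - t) (t - d2)"] conjI allI impI)
      fix r s assume rs: "r \<le> t \<and> t \<le> s \<and> s - r < min (d1 - t) (t - d2)"
      show "Q r s" unfolding Q_def
      proof
        assume "a \<le> r"
        have "P r t" using d2(2)[of r] refl[OF t(1)] rs \<open>a \<le> r\<close> by (cases "r = t") auto
        moreover have "P t s" using d1(2)[of s] refl[OF t(1)] rs by (cases "s = t") auto
        ultimately show "P r s" using trans[of r t s] rs \<open>a \<le> r\<close> by auto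
      qed
    qed (use d1 d2 in auto)
  qed
  then show ?thesis by (simp add: Q_def)
qed

definition grid_up :: "nat \<Rightarrow> real \<Rightarrow> real" where "grid_up n t = \<lceil>n * t\<rceil> / n"

text \<open>A time change from the interval \<open>[a, b]\<close> to the interval between the next
  grid points, along which sampling \<open>x\<close> at the preceding grid point costs an error of
  at most \<open>e\<close>. Rounding the endpoints up makes such time changes fit together on
  adjacent intervals.\<close>

definition grid_match :: "(real \<Rightarrow> real) \<Rightarrow> real \<Rightarrow> nat \<Rightarrow> real \<Rightarrow> real \<Rightarrow> bool" where
  "grid_match x e n a b \<longleftrightarrow> (\<exists>l. strict_mono_on {a..b} l \<and> l ` {a..b} = {grid_up n a..grid_up n b}
      \<and> (\<forall>s\<in>{a..b}. \<bar>l s - s\<bar> \<le> 1 / n)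
      \<and> (\<forall>s\<in>{a..<b}. \<bar>x (\<lfloor>n * l s\<rfloor> / n) - x s\<bar> \<le> e))"

lemma grid_up_bounds: "0 < n \<Longrightarrow> t \<le> grid_up n t" "0 < n \<Longrightarrow> grid_up n t < t + 1 / n"
proof -
  assume n: "0 < n"
  have "n * t \<le> \<lceil>n * t\<rceil>" "\<lceil>n * t\<rceil> < n * t + 1" by linarith+
  with n show "t \<le> grid_up n t" "grid_up n t < t + 1 / n"
    by (auto simp: grid_up_def field_simps)
qed

lemma grid_match_refl: "0 < n \<Longrightarrow> grid_match x e n t t"
  unfolding grid_match_def
  by (intro exI[of _ "\<lambda>_. grid_up n t"]) 
     (use grid_up_bounds[of n t] in \<open>auto simp: strict_mono_on_def\<close>)

lemma grid_match_trans:
  assumes ab: "a \<le> b" "b \<le> c" and 1: "grid_match x e n a b" and 2: "grid_match x e n b c"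
  shows "grid_match x e n a c"
proof -
  obtain l :: "real \<Rightarrow> real" where l: "strict_mono_on {a..b} l" "l ` {a..b} = {grid_up n a..grid_up n b}"
      "\<forall>s\<in>{a..b}. \<bar>l s - s\<bar> \<le> 1 / n"
      "\<forall>s\<in>{a..<b}. \<bar>x (\<lfloor>n * l s\<rfloor> / n) - x s\<bar> \<le> e"
    using 1 unfolding grid_match_def by blast
  obtain m :: "real \<Rightarrow> real" where m: "strict_mono_on {b..c} m" "m ` {b..c} = {grid_up n b..grid_up n c}"
      "\<forall>s\<in>{b..c}. \<bar>m s - s\<bar> \<le> 1 / n"
      "\<forall>s\<in>{b..<c}. \<bar>x (\<lfloor>n * m s\<rfloor> / n) - x s\<bar> \<le> e"
    using 2 unfolding grid_match_def by blast
  have lm: "l s \<le> l t" if "s \<le> t" "s \<in> {a..b}" "t \<in> {a..b}" for s t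
    using strict_mono_onD[OF l(1) that(2,3)] that(1) by (cases "s = t") auto
  have mm: "m s \<le> m t" if "s \<le> t" "s \<in> {b..c}" "t \<in> {b..c}" for s t
    using strict_mono_onD[OF m(1) that(2,3)] that(1) by (cases "s = t") auto
  have "l ` {a..b} \<noteq> {}" "m ` {b..c} \<noteq> {}" using ab by auto
  then have ge: "grid_up n a \<le> grid_up n b" "grid_up n b \<le> grid_up n c"
    unfolding l(2) m(2) by auto
  have "grid_up n b \<in> l ` {a..b}" "grid_up n b \<in> m ` {b..c}" unfolding l(2) m(2) using ge by auto
  then obtain s1 s2 where s12: "s1 \<in> {a..b}" "l s1 = grid_up n b" "s2 \<in> {b..c}" "m s2 = grid_up n b"
    by (metis imageE)
  have "l b \<in> l ` {a..b}" "m b \<in> m ` {b..c}" using ab by auto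
  then have lb: "l b = grid_up n b" and mb: "m b = grid_up n b"
    using lm[of s1 b] mm[of b s2] s12 ab unfolding l(2) m(2) by auto
  define k where "k s = (if s \<le> b then l s else m s)" for s
  have "strict_mono_on {a..c} k"
  proof (rule strict_mono_onI)
    fix s t assume st: "s \<in> {a..c}" "t \<in> {a..c}" "s < t"
    consider "t \<le> b" | "b < s" | "s \<le> b" "b < t" by linarith
    then show "k s < k t"
    proof cases
      case 1 then show ?thesis using strict_mono_onD[OF l(1), of s t] st by (auto simp: k_def)
    next
      case 2 then show ?thesis using strict_mono_onD[OF m(1), of s t] st by (auto simp: k_def)
    next
      case 3
      then have "l s \<le> l b" using lm[of s b] st ab by auto
      also have "\<dots> = m b" by (simp add: lb mb)
      also have "m b < m t" using strict_mono_onD[OF m(1), of b t] st 3 ab by auto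
      finally show ?thesis using 3 by (auto simp: k_def)
    qed
  qed
  moreover have "k ` {a..c} = {grid_up n a..grid_up n c}"
  proof -
    have "k ` {a..c} = l ` {a..b} \<union> m ` {b..c}"
    proof -
      have "{a..c} = {a..b} \<union> {b..c}" using ab by auto
      moreover have "k ` {a..b} = l ` {a..b}" by (auto simp: k_def)
      moreover have "k ` {b..c} = m ` {b..c}" by (rule image_cong) (auto simp: k_def lb mb)
      ultimately show ?thesis by (simp add: image_Un)
    qed
    then show ?thesis using l(2) m(2) ge by auto
  qed
  moreover have "\<forall>s\<in>{a..c}. \<bar>k s - s\<bar> \<le> 1 / n" using l(3) m(3) by (auto simp: k_def)
  moreover have "\<forall>s\<in>{a..<c}. \<bar>x (\<lfloor>n * k s\<rfloor> / n) - x s\<bar> \<le> e"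
  proof
    fix s assume s: "s \<in> {a..<c}"
    show "\<bar>x (\<lfloor>n * k s\<rfloor> / n) - x s\<bar> \<le> e"
    proof (cases "s < b")
      case True then show ?thesis using l(4) s by (auto simp: k_def)
    next
      case False
      then have "k s = m s" using lb mb by (auto simp: k_def)
      then show ?thesis using m(4) s False by auto
    qed
  qed
  ultimately show ?thesis unfolding grid_match_def by blast
qed

text \<open>On an interval where \<open>x\<close> oscillates by at most \<open>e\<close> the
  linear map works: the last grid point before the image of \<open>s < b\<close> lies in
  \<open>[a, b)\<close> again.\<close>

lemma grid_match_interval:
  assumes ab: "a < b" and n: "0 < n" "1 / n < b - a"
    and osc: "\<And>s t. s \<in> {a..<b} \<Longrightarrow> t \<in> {a..<b} \<Longrightarrow> \<bar>x s - x t\<bar> \<le> e"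
  shows "grid_match x e n a b"
proof -
  let ?a = "grid_up n a" and ?b = "grid_up n b"
  have a: "a \<le> ?a" "?a < a + 1 / n" and b: "b \<le> ?b" "?b < b + 1 / n"
    using grid_up_bounds[OF n(1)] by auto
  have lt: "?a < ?b" using a b n by linarith
  define l where "l s = ?a + (s - a) / (b - a) * (?b - ?a)" for s
  have mono: "l s < l t" if "s < t" for s t
    unfolding l_def using that lt ab by (simp add: divide_strict_right_mono mult_strict_right_mono)
  have la: "l a = ?a" and lb: "l b = ?b" using ab by (auto simp: l_def)
  have img: "l ` {a..b} = {?a..?b}"
  proof
    show "l ` {a..b} \<subseteq> {?a..?b}" using mono la lb by (force simp: le_less)
    show "{?a..?b} \<subseteq> l ` {a..b}"
    proof
      fix y assume y: "y \<in> {?a..?b}"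
      let ?s = "a + (y - ?a) / (?b - ?a) * (b - a)"
      have "0 \<le> (y - ?a) / (?b - ?a)" "(y - ?a) / (?b - ?a) \<le> 1" using y lt by auto
      then have "0 \<le> (y - ?a) / (?b - ?a) * (b - a)" "(y - ?a) / (?b - ?a) * (b - a) \<le> 1 * (b - a)"
        using ab by (intro mult_nonneg_nonneg mult_right_mono; simp)+
      then have "?s \<in> {a..b}" by auto
      moreover have "l ?s = y" using ab lt by (simp add: l_def)
      ultimately show "y \<in> l ` {a..b}" by (metis imageI)
    qed
  qed
  have near: "\<bar>l s - s\<bar> \<le> 1 / n" if s: "s \<in> {a..b}" for s
  proof -
    define u where "u = (s - a) / (b - a)"
    have u: "0 \<le> u" "u \<le> 1" using s ab by (auto simp: u_def)
    have s': "s = a + u * (b - a)" using ab by (simp add: u_def)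
    have "l s - s = (1 - u) * (?a - a) + u * (?b - b)"
      unfolding l_def u_def[symmetric] by (subst s') algebra
    moreover have "0 \<le> (1 - u) * (?a - a)" "(1 - u) * (?a - a) \<le> (1 - u) * (1 / n)"
      "0 \<le> u * (?b - b)" "u * (?b - b) \<le> u * (1 / n)"
      using u a b by (auto intro!: mult_left_mono simp del: times_divide_eq_right)
    moreover have "(1 - u) * (1 / n) + u * (1 / n) = 1 / n" by (simp add: diff_divide_distrib)
    ultimately show ?thesis by linarith
  qed
  have "\<bar>x (\<lfloor>n * l s\<rfloor> / n) - x s\<bar> \<le> e" if s: "s \<in> {a..<b}" for s
  proof (rule osc[OF _ s])
    have "?a \<le> l s" "l s < ?b" using mono[of a s] mono[of s b] la lb s by (auto simp: le_less)
    then have "\<lceil>n * a\<rceil> \<le> n * l s" "n * l s < \<lceil>n * b\<rceil>" using n by (auto simp: grid_up_def field_simps)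
    then have "\<lceil>n * a\<rceil> \<le> \<lfloor>n * l s\<rfloor>" "\<lfloor>n * l s\<rfloor> < \<lceil>n * b\<rceil>"
      by (auto simp: le_floor_iff floor_less_iff)
    then have "n * a \<le> \<lfloor>n * l s\<rfloor>" "\<lfloor>n * l s\<rfloor> < n * b" by linarith+
    then show "\<lfloor>n * l s\<rfloor> / n \<in> {a..<b}" using n by (auto simp: field_simps)
  qed
  with mono img near show ?thesis unfolding grid_match_def
    by (intro exI[of _ l]) (auto intro!: strict_mono_onI)
qed

lemma left_limit_oscillation:
  fixes f :: "real \<Rightarrow> 'a::real_normed_vector"
  assumes lim: "(f \<longlongrightarrow> l) (at_left t)" and e: "0 < e"
  shows "\<exists>b<t. \<forall>r s. b < r \<and> r < t \<and> b < s \<and> s < t \<longrightarrow> norm (f r - f s) < e"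
proof -
  from tendstoD[OF lim, of "e / 2"] e obtain b where b: "b < t" "\<And>s. b < s \<Longrightarrow> s < t \<Longrightarrow> dist (f s) l < e / 2"
    unfolding eventually_at_left_field by auto
  show ?thesis
    by (intro exI[of _ b]) (use b dist_triangle_half_l[of "f _" l e "f _"] in \<open>auto simp: dist_norm[symmetric]\<close>)
qed

text \<open>Near each time, \<open>x\<close> oscillates little on the intervals to the right,
  which contain that time, and to the left, which do not; gluing such intervals yields any compact
  interval.\<close>

lemma eventually_grid_match:
  assumes x: "cadlag x" and e: "0 < e" and T: "0 \<le> T"
  shows "\<forall>\<^sub>F n in sequentially. grid_match x e n 0 T"
proof (rule interval_gluing[where P = "\<lambda>a b. \<forall>\<^sub>F n in sequentially. grid_match x e n a b", OF T])
  show "\<forall>\<^sub>F n in sequentially. grid_match x e n t t" for t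
    using eventually_gt_at_top[of 0] by eventually_elim (rule grid_match_refl)
  show "\<forall>\<^sub>F n in sequentially. grid_match x e n r t"
    if "r \<le> s" "s \<le> t" "\<forall>\<^sub>F n in sequentially. grid_match x e n r s" "\<forall>\<^sub>F n in sequentially. grid_match x e n s t" for r s t
    using that(3,4) by eventually_elim (rule grid_match_trans[OF that(1,2)])
next
  have ev: "\<forall>\<^sub>F n in sequentially. grid_match x e n a b"
    if "a < b" and osc: "\<And>s t. s \<in> {a..<b} \<Longrightarrow> t \<in> {a..<b} \<Longrightarrow> \<bar>x s - x t\<bar> \<le> e" for a b
  proof -
    have "\<forall>\<^sub>F n in sequentially. 1 / real n < b - a"
      using order_tendstoD(2)[OF lim_1_over_n, of "b - a"] that by auto
    with eventually_gt_at_top[of 0] show ?thesis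
      by eventually_elim (rule grid_match_interval[OF \<open>a < b\<close> _ _ osc])
  qed
  fix t :: real
  show "\<forall>\<^sub>F s in at_right t. \<forall>\<^sub>F n in sequentially. grid_match x e n t s" if "0 \<le> t"
  proof -
    have "(x \<longlongrightarrow> x t) (at_right t)" using x that by (auto simp: cadlag_def)
    from tendstoD[OF this, of "e / 2"] e obtain b where b: "b > t" "\<And>s. t < s \<Longrightarrow> s < b \<Longrightarrow> dist (x s) (x t) < e / 2"
      unfolding eventually_at_right_field by auto
    have b': "dist (x s) (x t) < e / 2" if "t \<le> s" "s < b" for s
      using b(2)[of s] that e by (cases "s = t") auto
    show ?thesis unfolding eventually_at_right_field
    proof (intro exI[of _ b] conjI allI impI)
      fix s assume s: "t < s" "s < b"
      show "\<forall>\<^sub>F n in sequentially. grid_match x e n t s"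
      proof (rule ev[OF s(1)])
        fix u v assume "u \<in> {t..<s}" "v \<in> {t..<s}"
        then have "dist (x u) (x t) < e / 2" "dist (x v) (x t) < e / 2" using b'[of u] b'[of v] s by auto
        then have "dist (x u) (x v) < e" by (rule dist_triangle_half_l)
        then show "\<bar>x u - x v\<bar> \<le> e" by (simp add: dist_real_def)
      qed
    qed (rule b)
  qed
  show "\<forall>\<^sub>F s in at_left t. \<forall>\<^sub>F n in sequentially. grid_match x e n s t" if "0 < t"
  proof -
    obtain l where "(x \<longlongrightarrow> l) (at_left t)" using x \<open>0 < t\<close> unfolding cadlag_def by blast
    from left_limit_oscillation[OF this e] obtain b where b: "b < t"
        "\<And>r s. b < r \<Longrightarrow> r < t \<Longrightarrow> b < s \<Longrightarrow> s < t \<Longrightarrow> norm (x r - x s) < e" by blast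
    show ?thesis unfolding eventually_at_left_field
    proof (intro exI[of _ b] conjI allI impI)
      fix s assume s: "b < s" "s < t"
      show "\<forall>\<^sub>F n in sequentially. grid_match x e n s t"
        by (rule ev[OF s(2)]) (use b(2) s in \<open>fastforce simp: less_imp_le\<close>)
    qed (rule b)
  qed
qed

lemma time_change_extend:
  assumes T: "0 \<le> T" and mono: "strict_mono_on {0..T} l" and img: "l ` {0..T} = {0..c}"
  shows "(\<lambda>s. if s \<le> T then l s else s + (c - T)) \<in> time_changes"
    and "l T = c"
proof -
  have le: "l s \<le> l t" if "s \<le> t" "0 \<le> s" "t \<le> T" for s t
    using strict_mono_onD[OF mono, of s t] that by (cases "s = t") auto
  have c: "0 \<le> c" using img T by (metis atLeastAtMost_iff atLeastatMost_empty_iff image_is_empty not_less order.refl)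
  have "c \<in> l ` {0..T}" using c unfolding img by simp
  then obtain s where "s \<in> {0..T}" "l s = c" by auto
  moreover have "l T \<in> {0..c}" using img T by fastforce
  ultimately show lT: "l T = c" using le[of s T] by auto
  let ?k = "\<lambda>s. if s \<le> T then l s else s + (c - T)"
  have "strict_mono_on {0..} ?k"
  proof (rule strict_mono_onI)
    fix s t :: real assume st: "s \<in> {0..}" "t \<in> {0..}" "s < t"
    consider "t \<le> T" | "T < s" | "s \<le> T" "T < t" by linarith
    then show "?k s < ?k t"
    proof cases
      case 1 then show ?thesis using strict_mono_onD[OF mono, of s t] st by auto
    next
      case 2 then show ?thesis using st by auto
    next
      case 3
      then have "l s \<le> c" using le[of s T] st lT by auto
      then show ?thesis using 3 by auto
    qed
  qed
  moreover have "?k ` {0..} = {0..}"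
  proof
    show "?k ` {0..} \<subseteq> {0..}" using img c by auto
    show "{0..} \<subseteq> ?k ` {0..}"
    proof
      fix y :: real assume y: "y \<in> {0..}"
      show "y \<in> ?k ` {0..}"
      proof (cases "y \<le> c")
        case True
        then have "y \<in> l ` {0..T}" using y img by auto
        then show ?thesis by auto
      next
        case False
        then have "y = ?k (y - (c - T))" "y - (c - T) \<in> {0..}" using T by auto
        then show ?thesis by blast
      qed
    qed
  qed
  ultimately show "?k \<in> time_changes" by (simp add: time_changes_def)
qed

lemma grid_approximation_converges:
  assumes x: "cadlag x"
  shows "\<forall>\<^sub>F n in sequentially. grid_approximation n x \<in> skorokhod_ball (real k) (1 / Suc k) x"
proof -
  define e where "e = 1 / (2 * real (Suc k))"
  have e: "0 < e" by (simp add: e_def)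
  define T where "T = real (Suc k)"
  have "\<forall>\<^sub>F n in sequentially. 1 / real n < e"
    using order_tendstoD(2)[OF lim_1_over_n e] by auto
  then show ?thesis
    using eventually_gt_at_top[of "0::nat"] eventually_ge_at_top[of "k + 3"]
      eventually_grid_match[OF x e, of T, unfolded T_def, OF of_nat_0_le_iff]
  proof eventually_elim
    case (elim n)
    then obtain l :: "real \<Rightarrow> real" where l: "strict_mono_on {0..T} l" "l ` {0..T} = {grid_up n 0..grid_up n T}"
      "\<forall>s\<in>{0..T}. \<bar>l s - s\<bar> \<le> 1 / n"
      "\<forall>s\<in>{0..<T}. \<bar>x (\<lfloor>n * l s\<rfloor> / n) - x s\<bar> \<le> e"
      unfolding grid_match_def T_def by blast
    have T: "0 \<le> T" by (simp add: T_def)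
    have l2: "l ` {0..T} = {0..grid_up n T}" using l(2) by (simp add: grid_up_def)
    let ?k = "\<lambda>s. if s \<le> T then l s else s + (grid_up n T - T)"
    have k: "?k \<in> time_changes" by (rule time_change_extend(1)[OF T l(1) l2])
    have ek: "1 / real n \<le> 1 / real (Suc k)"
      using elim by (intro divide_left_mono) auto
    have "\<bar>?k s - s\<bar> \<le> 1 / n" if "0 \<le> s" for s
      using l(3) that grid_up_bounds[of n T] elim by (cases "s \<le> T") auto
    then have "\<bar>?k s - s\<bar> \<le> 1 / Suc k" if "0 \<le> s" for s
      using that ek order_trans by blast
    moreover have "\<bar>grid_approximation n x (?k s) - x s\<bar> \<le> 1 / Suc k" if s: "s \<in> {0..real k}" for s
    proof -
      have sT: "s \<in> {0..<T}" using s by (auto simp: T_def)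
      have ls: "0 \<le> l s" using l2 sT by (metis atLeastAtMost_iff atLeastLessThan_iff imageI less_imp_le)
      have "\<bar>l s - s\<bar> \<le> 1 / n" using l(3) sT by auto
      then have "l s \<le> s + 1 / n" by linarith
      also have "\<dots> \<le> k + 1"
      proof -
        have "1 / real n \<le> 1" using elim by simp
        then show ?thesis using s by auto
      qed
      finally have "l s \<le> real n" using elim by linarith
      then have "real n * l s \<le> real n * real n" using elim by (intro mult_left_mono) auto
      then have "n * l s < real_of_int (int (n * n)) + 1" by simp
      then have "\<lfloor>n * l s\<rfloor> \<le> int (n * n)" by (simp only: floor_le_iff)
      then have mn: "min (nat \<lfloor>n * l s\<rfloor>) (n * n) = nat \<lfloor>n * l s\<rfloor>" by linarith
      have "0 \<le> \<lfloor>n * l s\<rfloor>" using ls by simp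
      then have rn: "real (min (nat \<lfloor>n * l s\<rfloor>) (n * n)) / n = \<lfloor>n * l s\<rfloor> / n"
        unfolding mn by simp
      define y where "y = x (\<lfloor>n * l s\<rfloor> / n)"
      have ap: "grid_approximation n x (l s) = \<lfloor>n * y\<rfloor> / n"
        unfolding grid_approximation_def rn y_def ..
      have "\<lfloor>n * y\<rfloor> \<le> n * y" "n * y < \<lfloor>n * y\<rfloor> + 1" by linarith+
      then have "\<lfloor>n * y\<rfloor> / n \<le> y" "y \<le> \<lfloor>n * y\<rfloor> / n + 1 / n" using elim by (auto simp: field_simps)
      then have "\<bar>\<lfloor>n * y\<rfloor> / n - y\<bar> \<le> e" using elim by linarith
      moreover have "\<bar>y - x s\<bar> \<le> e" using l(4) sT y_def by auto
      ultimately have "\<bar>\<lfloor>n * y\<rfloor> / n - x s\<bar> \<le> e + e" by linarith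
      moreover have "e + e = 1 / Suc k" by (simp add: e_def field_simps)
      ultimately show ?thesis using ap sT by auto
    qed
    ultimately show ?case unfolding skorokhod_ball_def mem_Collect_eq
      by (intro bexI[OF _ k] conjI allI ballI impI) simp_all
  qed
qed

lemma grid_approximation_measurable:
  assumes X: "\<And>s. 0 \<le> s \<Longrightarrow> X s \<in> borel_measurable M"
  shows "{\<omega> \<in> space M. grid_approximation n (\<lambda>s. X s \<omega>) \<in> F} \<in> sets M"
proof -
  define v where "v \<omega> = map (\<lambda>k. \<lfloor>n * X (real k / n) \<omega>\<rfloor>) [0..<Suc (n * n)]" for \<omega>
  define step where "step w = (\<lambda>s::real. real_of_int (w ! min (nat \<lfloor>n * s\<rfloor>) (n * n)) / n)" for w :: "int list"
  have ap: "grid_approximation n (\<lambda>s. X s \<omega>) = step (v \<omega>)" for \<omega>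
  proof
    fix s :: real
    have "min (nat \<lfloor>n * s\<rfloor>) (n * n) < Suc (n * n)" by simp
    then have "v \<omega> ! min (nat \<lfloor>n * s\<rfloor>) (n * n)
        = \<lfloor>n * X (real (min (nat \<lfloor>n * s\<rfloor>) (n * n)) / n) \<omega>\<rfloor>"
      unfolding v_def by (simp del: upt_Suc)
    then show "grid_approximation n (\<lambda>s. X s \<omega>) s = step (v \<omega>) s"
      unfolding grid_approximation_def step_def by simp
  qed
  have single: "{\<omega> \<in> space M. v \<omega> = w} \<in> sets M" for w
  proof -
    have "{\<omega> \<in> space M. v \<omega> = w} = {\<omega> \<in> space M. length w = Suc (n * n) \<and>
        (\<forall>k\<in>{..<Suc (n * n)}. \<lfloor>n * X (real k / n) \<omega>\<rfloor> = w ! k)}"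
      unfolding v_def by (auto simp del: upt_Suc simp: list_eq_iff_nth_eq)
    also have "\<dots> \<in> sets M" using X by measurable
    finally show ?thesis .
  qed
  have "{\<omega> \<in> space M. grid_approximation n (\<lambda>s. X s \<omega>) \<in> F}
      = (\<Union>w\<in>{w. step w \<in> F}. {\<omega> \<in> space M. v \<omega> = w})"
    by (auto simp: ap)
  also have "\<dots> \<in> sets M"
    using single by (intro sets.countable_UN') auto
  finally show ?thesis .
qed

lemma cadlag_cong: "(\<And>t. 0 \<le> t \<Longrightarrow> f t = g t) \<Longrightarrow> cadlag f \<Longrightarrow> cadlag g"
proof -
  assume eq: "\<And>t. 0 \<le> t \<Longrightarrow> f t = g t" and f: "cadlag f"
  show "cadlag g" unfolding cadlag_def
  proof (intro conjI allI impI)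
    fix t :: real
    show "(g \<longlongrightarrow> g t) (at_right t)" if t: "0 \<le> t"
    proof (rule Lim_transform_eventually)
      show "(f \<longlongrightarrow> g t) (at_right t)" using f eq t by (auto simp: cadlag_def)
      show "\<forall>\<^sub>F s in at_right t. f s = g s"
        using eventually_at_right_less[of t] by eventually_elim (use t eq in auto)
    qed
    show "\<exists>l. (g \<longlongrightarrow> l) (at_left t)" if t: "0 < t"
    proof -
      obtain l where "(f \<longlongrightarrow> l) (at_left t)" using f t unfolding cadlag_def by blast
      moreover have "\<forall>\<^sub>F s in at_left t. f s = g s"
        using eventually_at_left_real[OF t] by eventually_elim (use eq in auto)
      ultimately show ?thesis using Lim_transform_eventually by blast
    qed
  qed
qed

lemma cadlag_continuous_image:
  fixes f :: "real \<Rightarrow> 'a::t2_space"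
  assumes f: "cadlag f" and g: "continuous_on UNIV g"
  shows "cadlag (\<lambda>s. g (f s))"
  unfolding cadlag_def
proof (intro conjI allI impI)
  have g': "isCont g x" for x using g by (simp add: continuous_on_eq_continuous_at)
  fix t :: real
  show "((\<lambda>s. g (f s)) \<longlongrightarrow> g (f t)) (at_right t)" if "0 \<le> t"
    by (rule isCont_tendsto_compose[OF g']) (use f that in \<open>auto simp: cadlag_def\<close>)
  show "\<exists>l. ((\<lambda>s. g (f s)) \<longlongrightarrow> l) (at_left t)" if t: "0 < t"
  proof -
    obtain l where "(f \<longlongrightarrow> l) (at_left t)" using f t unfolding cadlag_def by blast
    then show ?thesis using isCont_tendsto_compose[OF g'] by blast
  qed
qed

lemma space_skorokhod_borel: "space skorokhod_borel = skorokhod_space"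
  and sets_skorokhod_borel: "sets skorokhod_borel = sigma_sets skorokhod_space {U. skorokhod_open U}"
proof -
  have "{U. openin skorokhod_topology U} \<subseteq> Pow skorokhod_space"
    by (auto simp: openin_skorokhod_topology skorokhod_open_def)
  then show "space skorokhod_borel = skorokhod_space"
    "sets skorokhod_borel = sigma_sets skorokhod_space {U. skorokhod_open U}"
    by (simp_all add: skorokhod_borel_def openin_skorokhod_topology)
qed

text \<open>The Borel sets of Skorohod space are generated by the evaluations. An open
  \<open>U\<close> is the union over \<open>k\<close> of the sets of paths whose grid
  approximations eventually lie in \<open>F k\<close>, the set of functions whose
  \<open>k\<close>-th neighbourhood lies in \<open>U\<close>. These sets are measurable because
  each approximation takes only countably many values.\<close>

proposition measurable_skorokhod_borel:
  assumes X: "\<And>s. 0 \<le> s \<Longrightarrow> X s \<in> borel_measurable M"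
    and path: "\<And>\<omega>. \<omega> \<in> space M \<Longrightarrow> cadlag (\<lambda>s. X s \<omega>)"
  shows "(\<lambda>\<omega>. \<lambda>s\<in>{0..}. X s \<omega>) \<in> M \<rightarrow>\<^sub>M skorokhod_borel"
proof -
  let ?x = "\<lambda>\<omega>. \<lambda>s\<in>{0..}. X s \<omega>"
  have cad: "cadlag (?x \<omega>)" if "\<omega> \<in> space M" for \<omega>
    by (rule cadlag_cong[OF _ path[OF that]]) simp
  then have D: "?x \<omega> \<in> skorokhod_space" if "\<omega> \<in> space M" for \<omega>
    using that by (auto simp: skorokhod_space_def)
  show ?thesis unfolding skorokhod_borel_def openin_skorokhod_topology
  proof (rule measurable_measure_of)
    show "{U. skorokhod_open U} \<subseteq> Pow skorokhod_space" by (auto simp: skorokhod_open_def)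
    show "?x \<in> space M \<rightarrow> skorokhod_space" using D by auto
    fix U assume "U \<in> {U. skorokhod_open U}"
    then have U: "skorokhod_open U" by simp
    define F where "F k = {y. skorokhod_ball (real k) (1 / real (Suc k)) y \<inter> skorokhod_space \<subseteq> U}" for k
    define E where "E k n = {\<omega> \<in> space M. grid_approximation n (?x \<omega>) \<in> F k}" for k n
    have E: "E k n \<in> sets M" for k n
      unfolding E_def by (rule grid_approximation_measurable[where X = "\<lambda>s \<omega>. ?x \<omega> s"]) (use X in auto)
    have "?x -` U \<inter> space M = (\<Union>k. \<Union>m. \<Inter>n\<in>{m..}. E k n)"
    proof (intro equalityI subsetI)
      fix \<omega> assume "\<omega> \<in> ?x -` U \<inter> space M"
      then have w: "\<omega> \<in> space M" "?x \<omega> \<in> U" by auto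
      from skorokhod_open_ball[OF U w(2)] obtain k :: nat where
        k: "skorokhod_ball (real k) (1 / real (Suc k)) (?x \<omega>) \<inter> skorokhod_space \<subseteq> U" by blast
      \<comment> \<open>neighbourhoods of half the size, so that two of them fit into one\<close>
      define j where "j = 2 * k + 1"
      have "\<forall>\<^sub>F n in sequentially. grid_approximation n (?x \<omega>) \<in> F j"
        using grid_approximation_converges[OF cad[OF w(1)], of j]
      proof eventually_elim
        case (elim n)
        let ?y = "grid_approximation n (?x \<omega>)"
        have y: "?y \<in> skorokhod_ball (real k) (1 / real (Suc j)) (?x \<omega>)"
          using elim skorokhod_ball_mono[of "real k" "real j" "1 / real (Suc j)" "1 / real (Suc j)"] by (auto simp: j_def)
        have s: "1 / real (Suc j) + 1 / real (Suc j) = 1 / real (Suc k)" by (simp add: j_def field_simps)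
        have "z \<in> skorokhod_ball (real k) (1 / real (Suc k)) (?x \<omega>)"
          if "z \<in> skorokhod_ball (real j) (1 / real (Suc j)) ?y" for z
        proof -
          have "real k + 1 / real (Suc j) \<le> real j" by (simp add: j_def field_simps)
          then have "z \<in> skorokhod_ball (real k + 1 / real (Suc j)) (1 / real (Suc j)) ?y"
            using that skorokhod_ball_mono[of "real k + 1 / real (Suc j)" "real j" "1 / real (Suc j)" "1 / real (Suc j)"] by auto
          from skorokhod_ball_trans[OF y this] show ?thesis unfolding s .
        qed
        then show ?case using k unfolding F_def by blast
      qed
      then show "\<omega> \<in> (\<Union>k. \<Union>m. \<Inter>n\<in>{m..}. E k n)"
        using w unfolding E_def eventually_sequentially by blast
    next
      fix \<omega> assume "\<omega> \<in> (\<Union>k. \<Union>m. \<Inter>n\<in>{m..}. E k n)"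
      then obtain k m where km: "\<And>n. n \<ge> m \<Longrightarrow> \<omega> \<in> E k n" by auto
      then have w: "\<omega> \<in> space M" by (auto simp: E_def)
      have "\<forall>\<^sub>F n in sequentially. grid_approximation n (?x \<omega>) \<in> skorokhod_ball (real (Suc k)) (1 / Suc (Suc k)) (?x \<omega>)"
        by (rule grid_approximation_converges[OF cad[OF w]])
      then obtain n where n: "n \<ge> m" "grid_approximation n (?x \<omega>) \<in> skorokhod_ball (real (Suc k)) (1 / real (Suc (Suc k))) (?x \<omega>)"
        unfolding eventually_sequentially by (meson nle_le)
      have *: "real k \<le> real (Suc k) - 1 / real (Suc (Suc k))" "1 / real (Suc (Suc k)) \<le> 1 / real (Suc k)"
        by (auto simp: field_simps)
      have "?x \<omega> \<in> skorokhod_ball (real k) (1 / real (Suc k)) (grid_approximation n (?x \<omega>))"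
        using skorokhod_ball_sym[OF n(2)] skorokhod_ball_mono[OF *] by blast
      then show "\<omega> \<in> ?x -` U \<inter> space M"
        using km[OF n(1)] D[OF w] w unfolding E_def F_def by blast
    qed
    also have "\<dots> \<in> sets M" using E by measurable
    finally show "?x -` U \<inter> space M \<in> sets M" .
  qed
qed

section \<open>Characteristic functions in the plane\<close>

text \<open>Levy's uniqueness theorem for the measures with densities \<open>g1\<close> and
  \<open>g2\<close>, once these are normalised to probability measures.\<close>

lemma weighted_Levy_uniqueness:
  fixes g1 :: "'a \<Rightarrow> real" and g2 :: "'b \<Rightarrow> real" and X1 :: "'a \<Rightarrow> real" and X2 :: "'b \<Rightarrow> real"
  assumes M1: "prob_space M1" and M2: "prob_space M2"
    and [measurable]: "g1 \<in> borel_measurable M1" "g2 \<in> borel_measurable M2"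
      "X1 \<in> borel_measurable M1" "X2 \<in> borel_measurable M2"
    and g1: "\<And>x. 0 \<le> g1 x" "\<And>x. g1 x \<le> B"
    and g2: "\<And>x. 0 \<le> g2 x" "\<And>x. g2 x \<le> B"
    and eq: "\<And>t. (\<integral>x. g1 x *\<^sub>R iexp (t * X1 x) \<partial>M1) = (\<integral>x. g2 x *\<^sub>R iexp (t * X2 x) \<partial>M2)"
    and A[measurable]: "A \<in> sets borel"
  shows "(\<integral>x. g1 x * indicator A (X1 x) \<partial>M1) = (\<integral>x. g2 x * indicator A (X2 x) \<partial>M2)"
proof -
  interpret M1: prob_space M1 by (rule M1)
  interpret M2: prob_space M2 by (rule M2)
  have i1: "integrable M1 g1" by (rule M1.integrable_const_bound[of _ B]) (use g1 in auto)
  have i2: "integrable M2 g2" by (rule M2.integrable_const_bound[of _ B]) (use g2 in auto)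
  \<comment> \<open>the common total mass, by the case \<open>t = 0\<close> of the hypothesis\<close>
  define m where "m = (\<integral>x. g1 x \<partial>M1)"
  have m2: "(\<integral>x. g2 x \<partial>M2) = m"
  proof -
    have "(\<integral>x. complex_of_real (g1 x) \<partial>M1) = (\<integral>x. complex_of_real (g2 x) \<partial>M2)"
      using eq[of 0] by (simp add: scaleR_conv_of_real)
    then show ?thesis by (simp add: m_def)
  qed
  have m0: "0 \<le> m" unfolding m_def by (rule integral_nonneg_AE) (use g1 in auto)
  show ?thesis
  proof (cases "m = 0")
    case True
    have "AE x in M1. g1 x = 0"
      using integral_nonneg_eq_0_iff_AE[OF i1] g1 True by (auto simp: m_def)
    then have 1: "(\<integral>x. g1 x * indicator A (X1 x) \<partial>M1) = 0" by (intro integral_eq_zero_AE) auto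
    have "AE x in M2. g2 x = 0"
      using integral_nonneg_eq_0_iff_AE[OF i2] g2 True m2 by auto
    then have 2: "(\<integral>x. g2 x * indicator A (X2 x) \<partial>M2) = 0" by (intro integral_eq_zero_AE) auto
    from 1 2 show ?thesis by simp
  next
    case False
    then have m: "0 < m" using m0 by simp
    have prob: "prob_space (density M (\<lambda>x. ennreal (g x / m)))"
      if "integrable M g" "\<And>x. 0 \<le> g x" "(\<integral>x. g x \<partial>M) = m" for M and g :: "'x \<Rightarrow> real"
    proof
      have [measurable]: "g \<in> borel_measurable M" using that(1) by simp
      have "emeasure (density M (\<lambda>x. ennreal (g x / m))) (space (density M (\<lambda>x. ennreal (g x / m))))
         = (\<integral>\<^sup>+x. ennreal (g x / m) \<partial>M)"
        by (subst emeasure_density) (auto intro!: nn_integral_cong)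
      also have "\<dots> = ennreal (\<integral>x. g x / m \<partial>M)"
        using that m by (intro nn_integral_eq_integral) auto
      also have "\<dots> = 1" using that m by simp
      finally show "emeasure (density M (\<lambda>x. ennreal (g x / m))) (space (density M (\<lambda>x. ennreal (g x / m)))) = 1" .
    qed
    let ?N1 = "density M1 (\<lambda>x. ennreal (g1 x / m))" and ?N2 = "density M2 (\<lambda>x. ennreal (g2 x / m))"
    interpret N1: prob_space ?N1 by (rule prob) (use i1 g1 in \<open>auto simp: m_def\<close>)
    interpret N2: prob_space ?N2 by (rule prob) (use i2 g2 m2 in auto)
    have d1: "real_distribution (distr ?N1 borel X1)" by (rule N1.real_distribution_distr) simp
    have d2: "real_distribution (distr ?N2 borel X2)" by (rule N2.real_distribution_distr) simp
    have "char (distr ?N1 borel X1) t = char (distr ?N2 borel X2) t" for t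
    proof -
      have "char (distr ?N1 borel X1) t = (\<integral>x. (g1 x / m) *\<^sub>R iexp (t * X1 x) \<partial>M1)"
        unfolding char_def by (subst integral_distr, simp, simp, subst integral_density)
            (use g1 m in auto)
      also have "\<dots> = (1 / m) *\<^sub>R (\<integral>x. g1 x *\<^sub>R iexp (t * X1 x) \<partial>M1)"
        by (subst integral_scaleR_right[symmetric]) (simp add: field_simps)
      also have "\<dots> = (1 / m) *\<^sub>R (\<integral>x. g2 x *\<^sub>R iexp (t * X2 x) \<partial>M2)" by (simp only: eq)
      also have "\<dots> = (\<integral>x. (g2 x / m) *\<^sub>R iexp (t * X2 x) \<partial>M2)"
        by (subst integral_scaleR_right[symmetric]) (simp add: field_simps)
      also have "\<dots> = char (distr ?N2 borel X2) t"
        unfolding char_def by (subst integral_distr, simp, simp, subst integral_density)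
            (use g2 m in auto)
      finally show ?thesis .
    qed
    then have "distr ?N1 borel X1 = distr ?N2 borel X2"
      by (intro Levy_uniqueness[OF d1 d2]) auto
    moreover have "measure (distr ?N1 borel X1) A = (\<integral>x. g1 x * indicator A (X1 x) \<partial>M1) / m"
    proof -
      have "measure (distr ?N1 borel X1) A = (\<integral>x. indicator A x \<partial>distr ?N1 borel X1)" by simp
      also have "\<dots> = (\<integral>x. (g1 x / m) *\<^sub>R indicator A (X1 x) \<partial>M1)"
        by (subst integral_distr, simp, simp, subst integral_density) (use g1 m in auto)
      finally show ?thesis by simp
    qed
    moreover have "measure (distr ?N2 borel X2) A = (\<integral>x. g2 x * indicator A (X2 x) \<partial>M2) / m"
    proof -
      have "measure (distr ?N2 borel X2) A = (\<integral>x. indicator A x \<partial>distr ?N2 borel X2)" by simp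
      also have "\<dots> = (\<integral>x. (g2 x / m) *\<^sub>R indicator A (X2 x) \<partial>M2)"
        by (subst integral_distr, simp, simp, subst integral_density) (use g2 m in auto)
      finally show ?thesis by simp
    qed
    ultimately show ?thesis using m by simp
  qed
qed

lemma inner_Complex: "Complex a b \<bullet> z = a * Re z + b * Im z"
  by (simp add: inner_complex_def)

text \<open>Two applications of uniqueness on the line. With the nonnegative weights \<open>1 +
  cos (b * Im z)\<close> and \<open>1 + sin (b * Im z)\<close>, the characteristic function
  determines the integrals of \<open>exp (i b Im z)\<close> over sets \<open>Re z \<in> A\<close>;
  with the weight \<open>indicator A (Re z)\<close>, these determine the measures of rectangles.\<close>

proposition plane_characteristic_function_unique:
  fixes M N :: "complex measure"
  assumes M: "prob_space M" "sets M = sets borel" and N: "prob_space N" "sets N = sets borel"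
    and eq: "\<And>\<xi>. (\<integral>z. iexp (\<xi> \<bullet> z) \<partial>M) = (\<integral>z. iexp (\<xi> \<bullet> z) \<partial>N)"
  shows "M = N"
proof -
  interpret M: prob_space M by (rule M(1))
  interpret N: prob_space N by (rule N(1))
  note [measurable_cong] = M(2) N(2)
  have iM: "integrable M (\<lambda>z. c z *\<^sub>R iexp (f z))" and iN: "integrable N (\<lambda>z. c z *\<^sub>R iexp (f z))"
    if [measurable]: "c \<in> borel_measurable borel" "f \<in> borel_measurable borel" and "\<And>z. \<bar>c z\<bar> \<le> B"
    for c f :: "complex \<Rightarrow> real" and B
    by (auto intro!: M.integrable_const_bound[of _ B] N.integrable_const_bound[of _ B] simp: that)
  have iM1: "integrable M (\<lambda>z. iexp (f z))" and iN1: "integrable N (\<lambda>z. iexp (f z))"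
    if "f \<in> borel_measurable borel" for f :: "complex \<Rightarrow> real"
    using iM[of "\<lambda>_. 1" f 1] iN[of "\<lambda>_. 1" f 1] that by auto
  have e: "(\<integral>z. iexp (a * Re z + b * Im z) \<partial>M) = (\<integral>z. iexp (a * Re z + b * Im z) \<partial>N)" for a b
    using eq[of "Complex a b"] by (simp only: inner_Complex)
  have tr: "(1 + cos (b * Im z)) *\<^sub>R iexp (a * Re z)
      = iexp (a * Re z + 0 * Im z) + (1/2) * iexp (a * Re z + b * Im z) + (1/2) * iexp (a * Re z + (- b) * Im z)"
     "(1 + sin (b * Im z)) *\<^sub>R iexp (a * Re z)
      = iexp (a * Re z + 0 * Im z) + (- \<i>/2) * iexp (a * Re z + b * Im z) + (\<i>/2) * iexp (a * Re z + (- b) * Im z)"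
    for a b and z :: complex
    by (auto simp: complex_eq_iff Re_exp Im_exp cos_add sin_add cos_diff sin_diff algebra_simps
       add_divide_distrib diff_divide_distrib)
  have c: "(\<integral>z. (1 + cos (b * Im z)) *\<^sub>R iexp (a * Re z) \<partial>M) = (\<integral>z. (1 + cos (b * Im z)) *\<^sub>R iexp (a * Re z) \<partial>N)"
   and s: "(\<integral>z. (1 + sin (b * Im z)) *\<^sub>R iexp (a * Re z) \<partial>M) = (\<integral>z. (1 + sin (b * Im z)) *\<^sub>R iexp (a * Re z) \<partial>N)" for a b
  proof -
    have lin: "(\<integral>z. F1 z + c2 * F2 z + c3 * F3 z \<partial>K) = (\<integral>z. F1 z \<partial>K) + c2 * (\<integral>z. F2 z \<partial>K) + c3 * (\<integral>z. F3 z \<partial>K)"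
      if "integrable K F1" "integrable K F2" "integrable K F3"
      for K :: "complex measure" and F1 F2 F3 and c2 c3 :: complex
      using that by simp
    have mb: "(\<lambda>z. p * Re z + q * Im z) \<in> borel_measurable borel" for p q by measurable
    show "(\<integral>z. (1 + cos (b * Im z)) *\<^sub>R iexp (a * Re z) \<partial>M) = (\<integral>z. (1 + cos (b * Im z)) *\<^sub>R iexp (a * Re z) \<partial>N)"
      unfolding tr by (simp only: lin iM1[OF mb] iN1[OF mb] e)
    show "(\<integral>z. (1 + sin (b * Im z)) *\<^sub>R iexp (a * Re z) \<partial>M) = (\<integral>z. (1 + sin (b * Im z)) *\<^sub>R iexp (a * Re z) \<partial>N)"
      unfolding tr by (simp only: lin iM1[OF mb] iN1[OF mb] e)
  qed
  have wc: "(\<integral>z. (1 + cos (b * Im z)) * indicator A (Re z) \<partial>M) = (\<integral>z. (1 + cos (b * Im z)) * indicator A (Re z) \<partial>N)"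
    if [measurable]: "A \<in> sets borel" for A b
  proof (rule weighted_Levy_uniqueness[OF M(1) N(1), where B = 2])
    show "0 \<le> 1 + cos (b * Im z)" "1 + cos (b * Im z) \<le> 2" for z
      using cos_ge_minus_one[of "b * Im z"] cos_le_one[of "b * Im z"] by linarith+
    then show "0 \<le> 1 + cos (b * Im z)" "1 + cos (b * Im z) \<le> 2" for z .
  qed (use c in auto)
  have ws: "(\<integral>z. (1 + sin (b * Im z)) * indicator A (Re z) \<partial>M) = (\<integral>z. (1 + sin (b * Im z)) * indicator A (Re z) \<partial>N)"
    if [measurable]: "A \<in> sets borel" for A b
  proof (rule weighted_Levy_uniqueness[OF M(1) N(1), where B = 2])
    show "0 \<le> 1 + sin (b * Im z)" "1 + sin (b * Im z) \<le> 2" for z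
      using sin_ge_minus_one[of "b * Im z"] sin_le_one[of "b * Im z"] by linarith+
    then show "0 \<le> 1 + sin (b * Im z)" "1 + sin (b * Im z) \<le> 2" for z .
  qed (use s in auto)
  have rect: "measure M {z. Re z \<in> A \<and> Im z \<in> B} = measure N {z. Re z \<in> A \<and> Im z \<in> B}"
    if [measurable]: "A \<in> sets borel" "B \<in> sets borel" for A B
  proof -
    have r: "integrable M (\<lambda>z. c z * indicator A (Re z))" "integrable N (\<lambda>z. c z * indicator A (Re z))"
      if [measurable]: "c \<in> borel_measurable borel" and "\<And>z. \<bar>c z\<bar> \<le> 2" for c :: "complex \<Rightarrow> real"
      using that by (auto intro!: M.integrable_const_bound[of _ 2] N.integrable_const_bound[of _ 2] simp: indicator_def)
    have 0: "(\<integral>z. indicator A (Re z) \<partial>M) = (\<integral>z. indicator A (Re z) \<partial>N :: real)"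
      using wc[of A 0] by simp
    have "(\<integral>z. indicator A (Re z) *\<^sub>R iexp (t * Im z) \<partial>M) = (\<integral>z. indicator A (Re z) *\<^sub>R iexp (t * Im z) \<partial>N)" for t
    proof -
      have tr2: "indicator A (Re z) *\<^sub>R iexp (t * Im z) = 
          complex_of_real ((1 + cos (t * Im z)) * indicator A (Re z))
           + \<i> * complex_of_real ((1 + sin (t * Im z)) * indicator A (Re z)) 
           - (1 + \<i>) * complex_of_real (indicator A (Re z))" for z
        by (simp add: complex_eq_iff Re_exp Im_exp algebra_simps)
      have b: "\<bar>1 + cos u\<bar> \<le> 2" "\<bar>1 + sin u\<bar> \<le> 2" for u :: real
        using cos_ge_minus_one[of u] cos_le_one[of u] sin_ge_minus_one[of u] sin_le_one[of u] by linarith+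
      have R: "integrable M (\<lambda>z. complex_of_real ((1 + cos (t * Im z)) * indicator A (Re z)))"
         "integrable N (\<lambda>z. complex_of_real ((1 + cos (t * Im z)) * indicator A (Re z)))"
         "integrable M (\<lambda>z. \<i> * complex_of_real ((1 + sin (t * Im z)) * indicator A (Re z)))"
         "integrable N (\<lambda>z. \<i> * complex_of_real ((1 + sin (t * Im z)) * indicator A (Re z)))"
         "integrable M (\<lambda>z. (1 + \<i>) * complex_of_real (indicator A (Re z)))"
         "integrable N (\<lambda>z. (1 + \<i>) * complex_of_real (indicator A (Re z)))"
        using r[of "\<lambda>z. 1 + cos (t * Im z)"] r[of "\<lambda>z. 1 + sin (t * Im z)"] r[of "\<lambda>z. 1"] b
        by (auto intro!: integrable_mult_right integrable_of_real simp del: of_real_mult)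
      have "(\<integral>z. indicator A (Re z) *\<^sub>R iexp (t * Im z) \<partial>K) = 
          complex_of_real (\<integral>z. (1 + cos (t * Im z)) * indicator A (Re z) \<partial>K)
           + \<i> * complex_of_real (\<integral>z. (1 + sin (t * Im z)) * indicator A (Re z) \<partial>K) 
           - (1 + \<i>) * complex_of_real (\<integral>z. indicator A (Re z) \<partial>K)"
        if "integrable K (\<lambda>z. complex_of_real ((1 + cos (t * Im z)) * indicator A (Re z)))"
         "integrable K (\<lambda>z. \<i> * complex_of_real ((1 + sin (t * Im z)) * indicator A (Re z)))"
         "integrable K (\<lambda>z. (1 + \<i>) * complex_of_real (indicator A (Re z)))" for K
        unfolding tr2 using that
        by (simp only: Bochner_Integration.integral_diff Bochner_Integration.integral_add Bochner_Integration.integrable_add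
             integral_complex_of_real integral_mult_right_zero)
      from this[OF R(1,3,5)] this[OF R(2,4,6)] show ?thesis using wc[of A t] ws[of A t] 0 by simp
    qed
    then have "(\<integral>z. indicator A (Re z) * indicator B (Im z) \<partial>M) = (\<integral>z. indicator A (Re z) * indicator B (Im z) \<partial>N :: real)"
      by (intro weighted_Levy_uniqueness[OF M(1) N(1), where B = 1]) (auto simp: indicator_def)
    moreover have "(\<lambda>z. indicator A (Re z) * indicator B (Im z)) = (indicator {z. Re z \<in> A \<and> Im z \<in> B} :: complex \<Rightarrow> real)"
      by (auto simp: indicator_def)
    ultimately show ?thesis by simp
  qed
  let ?p = "\<lambda>z. (Re z, Im z)" and ?q = "\<lambda>(x, y). Complex x y"
  have [measurable]: "?p \<in> borel \<rightarrow>\<^sub>M borel \<Otimes>\<^sub>M borel" by measurable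
  have q[measurable]: "?q \<in> borel \<Otimes>\<^sub>M borel \<rightarrow>\<^sub>M borel"
    unfolding case_prod_beta Complex_eq by measurable
  have "distr M (borel \<Otimes>\<^sub>M borel) ?p = distr N (borel \<Otimes>\<^sub>M borel) ?p"
  proof (rule measure_eqI_generator_eq[where A = "\<lambda>_. UNIV" and \<Omega> = UNIV
        and E = "{A \<times> B | A B. A \<in> sets (borel :: real measure) \<and> B \<in> sets (borel :: real measure)}"])
    show "Int_stable {A \<times> B | A B. A \<in> sets (borel :: real measure) \<and> B \<in> sets (borel :: real measure)}"
      using Int_stable_pair_measure_generator[of "borel :: real measure" "borel :: real measure"] by simp
    show "sets (distr M (borel \<Otimes>\<^sub>M borel) ?p) = sigma_sets UNIV {A \<times> B | A B. A \<in> sets (borel :: real measure) \<and> B \<in> sets (borel :: real measure)}"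
      "sets (distr N (borel \<Otimes>\<^sub>M borel) ?p) = sigma_sets UNIV {A \<times> B | A B. A \<in> sets (borel :: real measure) \<and> B \<in> sets (borel :: real measure)}"
      by (simp_all add: sets_pair_measure)
    fix X assume "X \<in> {A \<times> B | A B. A \<in> sets (borel :: real measure) \<and> B \<in> sets (borel :: real measure)}"
    then obtain A B where X: "X = A \<times> B" and [measurable]: "A \<in> sets borel" "B \<in> sets borel" by blast
    have pre: "?p -` (A \<times> B) = {z. Re z \<in> A \<and> Im z \<in> B}" by auto
    have "space M = UNIV" "space N = UNIV" using sets_eq_imp_space_eq[OF M(2)] sets_eq_imp_space_eq[OF N(2)] by auto
    then show "emeasure (distr M (borel \<Otimes>\<^sub>M borel) ?p) X = emeasure (distr N (borel \<Otimes>\<^sub>M borel) ?p) X"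
      unfolding X using rect[of A B]
      by (simp add: emeasure_distr pre M.emeasure_eq_measure N.emeasure_eq_measure)
  next
    show "range (\<lambda>_. UNIV) \<subseteq> {A \<times> B | A B. A \<in> sets (borel :: real measure) \<and> B \<in> sets (borel :: real measure)}"
      by (auto intro!: exI[of _ UNIV])
    fix i :: nat
    interpret D: prob_space "distr M (borel \<Otimes>\<^sub>M borel) ?p" by (rule M.prob_space_distr) simp
    show "emeasure (distr M (borel \<Otimes>\<^sub>M borel) ?p) UNIV \<noteq> \<infinity>" using D.emeasure_finite by simp
  qed auto
  then have "distr (distr M (borel \<Otimes>\<^sub>M borel) ?p) borel ?q = distr (distr N (borel \<Otimes>\<^sub>M borel) ?p) borel ?q" by simp
  then have "distr M borel (\<lambda>z. z) = distr N borel (\<lambda>z. z)"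
    by (subst (asm) (1 2) distr_distr) (auto simp: comp_def)
  moreover have "distr M borel (\<lambda>z. z) = M" by (rule distr_id2) (rule M(2)[symmetric])
  moreover have "distr N borel (\<lambda>z. z) = N" by (rule distr_id2) (rule N(2)[symmetric])
  ultimately show ?thesis by simp
qed

section \<open>Tails and small balls of planar stable vectors\<close>

abbreviation planar_gaussian :: "(real \<times> real) measure" where
  "planar_gaussian \<equiv> std_normal_distribution \<Otimes>\<^sub>M std_normal_distribution"

lemma prob_space_planar_gaussian: "prob_space planar_gaussian"
proof -
  interpret G: prob_space std_normal_distribution by (rule real_distribution.axioms(1)[OF real_dist_normal_dist])
  interpret GG: pair_prob_space std_normal_distribution std_normal_distribution ..
  show ?thesis by unfold_locales
qed

lemma planar_gaussian_characteristic_function: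
  "(\<integral>p. iexp (Complex (fst p) (snd p) \<bullet> w) \<partial>planar_gaussian) = of_real (exp (- (norm w)\<^sup>2 / 2))"
proof -
  interpret G: prob_space std_normal_distribution by (rule real_distribution.axioms(1)[OF real_dist_normal_dist])
  interpret GG: pair_prob_space std_normal_distribution std_normal_distribution ..
  have int: "integrable planar_gaussian (\<lambda>p. iexp (Complex (fst p) (snd p) \<bullet> w))"
    by (rule GG.P.integrable_const_bound[of _ 1]) (auto simp: inner_complex_def)
  have c: "(\<integral>x. iexp (x * t) \<partial>std_normal_distribution) = of_real (exp (- t\<^sup>2 / 2))" for t
  proof -
    have "(\<integral>x. iexp (x * t) \<partial>std_normal_distribution) = char std_normal_distribution t"
      unfolding char_def by (simp only: mult.commute)
    then show ?thesis by (simp add: char_std_normal_distribution)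
  qed
  have "(\<integral>p. iexp (Complex (fst p) (snd p) \<bullet> w) \<partial>planar_gaussian)
      = (\<integral>x. (\<integral>y. iexp (Complex x y \<bullet> w) \<partial>std_normal_distribution) \<partial>std_normal_distribution)"
    using GG.integral_fst'[OF int] by simp
  also have "\<dots> = (\<integral>x. (\<integral>y. iexp (x * Re w) * iexp (y * Im w) \<partial>std_normal_distribution) \<partial>std_normal_distribution)"
    by (simp add: inner_complex_def exp_add[symmetric] distrib_left)
  also have "\<dots> = of_real (exp (- (Re w)\<^sup>2 / 2)) * of_real (exp (- (Im w)\<^sup>2 / 2))"
    by (simp only: integral_mult_right_zero integral_mult_left_zero c)
  also have "\<dots> = of_real (exp (- (norm w)\<^sup>2 / 2))"
    by (simp add: cmod_power2 exp_add[symmetric] of_real_mult[symmetric] add_divide_distrib[symmetric] del: of_real_mult)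
  finally show ?thesis .
qed

text \<open>The Gaussian function is its own Fourier transform. Integrals of a smooth bump against
  the law of \<open>W\<close> thus become Gaussian averages of the characteristic function of
  \<open>W\<close>, which is all that is known explicitly about a stable vector.\<close>

lemma gaussian_smoothing:
  assumes M: "prob_space M" and W[measurable]: "W \<in> borel_measurable M"
  shows "(\<integral>\<omega>. complex_of_real (exp (- (norm (W \<omega>))\<^sup>2 / 2)) \<partial>M)
     = (\<integral>p. (\<integral>\<omega>. iexp (Complex (fst p) (snd p) \<bullet> W \<omega>) \<partial>M) \<partial>planar_gaussian)"
proof -
  interpret M: prob_space M by (rule M)
  interpret GG: prob_space planar_gaussian by (rule prob_space_planar_gaussian)
  interpret PM: pair_prob_space M planar_gaussian ..
  have "integrable (M \<Otimes>\<^sub>M planar_gaussian) (\<lambda>(\<omega>, p). iexp (Complex (fst p) (snd p) \<bullet> W \<omega>))"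
    by (rule PM.P.integrable_const_bound[of _ 1]) (auto simp: inner_complex_def case_prod_beta)
  from PM.Fubini_integral[OF this] show ?thesis
    by (simp add: planar_gaussian_characteristic_function)
qed

lemma second_moment_planar_gaussian:
  "integrable planar_gaussian (\<lambda>p. 1 + (norm (Complex (fst p) (snd p)))\<^sup>2)"
  "(\<integral>p. 1 + (norm (Complex (fst p) (snd p)))\<^sup>2 \<partial>planar_gaussian) = 3"
proof -
  interpret G: prob_space std_normal_distribution by (rule real_distribution.axioms(1)[OF real_dist_normal_dist])
  interpret GG: pair_prob_space std_normal_distribution std_normal_distribution ..
  have "has_bochner_integral lborel (\<lambda>x. std_normal_density x * x ^ (2 * 1)) (fact (2 * 1) / (2 ^ 1 * fact 1))"
    by (rule std_normal_moment_even)
  then have m: "integrable std_normal_distribution (\<lambda>x. x\<^sup>2)" "(\<integral>x. x\<^sup>2 \<partial>std_normal_distribution) = 1"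
    by (auto simp: has_bochner_integral_iff integrable_density integral_density power2_eq_square fact_2)
  have e: "1 + (norm (Complex x y))\<^sup>2 = 1 + x\<^sup>2 + y\<^sup>2" for x y by (simp add: cmod_power2)
  have i1: "integrable planar_gaussian (\<lambda>p. (fst p)\<^sup>2)"
    using m G.nn_integral_fst[of "\<lambda>p. ennreal ((fst p)\<^sup>2)" std_normal_distribution] G.emeasure_space_1
    by (subst integrable_iff_bounded) (auto simp: integrable_iff_bounded)
  have i2: "integrable planar_gaussian (\<lambda>p. (snd p)\<^sup>2)"
    using m G.nn_integral_fst[of "\<lambda>p. ennreal ((snd p)\<^sup>2)" std_normal_distribution] G.emeasure_space_1
    by (subst integrable_iff_bounded) (auto simp: integrable_iff_bounded)
  show "integrable planar_gaussian (\<lambda>p. 1 + (norm (Complex (fst p) (snd p)))\<^sup>2)"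
    unfolding e using i1 i2 by auto
  have "(\<integral>p. (fst p)\<^sup>2 \<partial>planar_gaussian) = 1"
    using GG.integral_fst'[OF i1] m G.prob_space by simp
  moreover have "(\<integral>p. (snd p)\<^sup>2 \<partial>planar_gaussian) = 1"
    using GG.integral_fst'[OF i2] m G.prob_space by simp
  ultimately show "(\<integral>p. 1 + (norm (Complex (fst p) (snd p)))\<^sup>2 \<partial>planar_gaussian) = 3"
    unfolding e using i1 i2 GG.P.prob_space by simp
qed

text \<open>An increment of the standard planar stable process over a time span of length
  \<open>s\<close>.\<close>

locale stable_vector = prob_space M for M :: "'w measure" +
  fixes \<alpha> s :: real and W :: "'w \<Rightarrow> complex"
  assumes W[measurable]: "W \<in> borel_measurable M"
    and \<alpha>: "0 < \<alpha>" "\<alpha> < 2" and s: "0 \<le> s"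
    and char: "\<And>\<xi>. (\<integral>\<omega>. iexp (\<xi> \<bullet> W \<omega>) \<partial>M) = of_real (exp (- (s * norm \<xi> powr \<alpha>)))"
begin

lemma scaled_shifted_characteristic_function:
  assumes r: "0 < r"
  shows "(\<integral>\<omega>. iexp (\<xi> \<bullet> ((1 / r) *\<^sub>R (W \<omega> - y))) \<partial>M)
     = iexp (- (\<xi> \<bullet> y / r)) * of_real (exp (- (s * (norm \<xi> / r) powr \<alpha>)))"
proof -
  have "(\<integral>\<omega>. iexp (\<xi> \<bullet> ((1 / r) *\<^sub>R (W \<omega> - y))) \<partial>M)
      = (\<integral>\<omega>. iexp (- (\<xi> \<bullet> y / r)) * iexp (((1 / r) *\<^sub>R \<xi>) \<bullet> W \<omega>) \<partial>M)"
    by (intro Bochner_Integration.integral_cong)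
      (auto simp: exp_add[symmetric] inner_diff_right diff_divide_distrib algebra_simps)
  also have "\<dots> = iexp (- (\<xi> \<bullet> y / r)) * of_real (exp (- (s * norm ((1 / r) *\<^sub>R \<xi>) powr \<alpha>)))"
    by (simp only: integral_mult_right_zero char)
  also have "norm ((1 / r) *\<^sub>R \<xi>) = norm \<xi> / r" using r by simp
  finally show ?thesis .
qed

text \<open>The difference \<open>1 - exp (- (norm (W / r))\<^sup>2 / 2)\<close> is at least
  \<open>1/3\<close> where \<open>r \<le> norm W\<close>, and its expectation is the Gaussian
  average of \<open>1 - exp (- s (norm \<xi> / r) powr \<alpha>) \<le> s (norm \<xi> / r) powr
  \<alpha>\<close>. The moment of order \<open>\<alpha> < 2\<close> is bounded by the one of
  \<open>1 + (norm \<xi>)\<^sup>2\<close>, which is 3.\<close>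

lemma tail_bound:
  assumes r: "0 < r"
  shows "prob {\<omega> \<in> space M. r \<le> norm (W \<omega>)} \<le> 9 * s / r powr \<alpha>"
proof -
  interpret GG: prob_space planar_gaussian by (rule prob_space_planar_gaussian)
  let ?V = "\<lambda>\<omega>. (1 / r) *\<^sub>R (W \<omega> - 0)"
  let ?E = "\<lambda>\<omega>. exp (- (norm (?V \<omega>))\<^sup>2 / 2)"
  let ?n = "\<lambda>p. norm (Complex (fst p) (snd p))"
  let ?F = "\<lambda>p. exp (- (s * (?n p / r) powr \<alpha>))"
  have iE: "integrable M ?E" by (rule integrable_const_bound[of _ 1]) auto
  have iF: "integrable planar_gaussian ?F"
    by (rule GG.integrable_const_bound[of _ 1]) (use s in \<open>auto simp: Complex_eq\<close>)
  have "complex_of_real (\<integral>\<omega>. ?E \<omega> \<partial>M) = of_real (\<integral>p. ?F p \<partial>planar_gaussian)"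
    using gaussian_smoothing[OF prob_space_axioms, of ?V]
    unfolding scaled_shifted_characteristic_function[OF r] by simp
  then have EF: "(\<integral>\<omega>. ?E \<omega> \<partial>M) = (\<integral>p. ?F p \<partial>planar_gaussian)" by (simp only: of_real_eq_iff)
  have le: "1 - ?F p \<le> s / r powr \<alpha> * (1 + (?n p)\<^sup>2)" for p
  proof -
    have "1 - ?F p \<le> s * (?n p / r) powr \<alpha>" using exp_ge_add_one_self[of "- (s * (?n p / r) powr \<alpha>)"] by simp
    also have "\<dots> = s / r powr \<alpha> * ?n p powr \<alpha>" using r by (simp add: powr_divide)
    also have "\<dots> \<le> s / r powr \<alpha> * (1 + (?n p)\<^sup>2)"
    proof (rule mult_left_mono)
    show "?n p powr \<alpha> \<le> 1 + (?n p)\<^sup>2"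
    proof (cases "?n p \<le> 1")
      case True
      then have "?n p powr \<alpha> \<le> 1 powr \<alpha>" by (intro powr_mono2) (use \<alpha> in auto)
      then show ?thesis by (simp add: add_increasing2)
    next
      case False
      then have "?n p powr \<alpha> \<le> ?n p powr 2" by (intro powr_mono) (use \<alpha> in auto)
      also have "\<dots> = (?n p)\<^sup>2" using False by (subst powr_numeral) auto
      finally show ?thesis by simp
    qed
    qed (use s in auto)
    finally show ?thesis .
  qed
  have "1 - (\<integral>p. ?F p \<partial>planar_gaussian) = (\<integral>p. 1 - ?F p \<partial>planar_gaussian)"
    using iF GG.prob_space by simp
  also have "\<dots> \<le> (\<integral>p. s / r powr \<alpha> * (1 + (?n p)\<^sup>2) \<partial>planar_gaussian)"
    using second_moment_planar_gaussian(1) iF le by (intro integral_mono) auto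
  also have "\<dots> = s / r powr \<alpha> * 3" by (subst integral_mult_right_zero, subst second_moment_planar_gaussian(2)) simp
  finally have up: "1 - (\<integral>\<omega>. ?E \<omega> \<partial>M) \<le> 3 * (s / r powr \<alpha>)" unfolding EF by (simp add: mult.commute)
  let ?A = "{\<omega> \<in> space M. r \<le> norm (W \<omega>)}"
  have A[measurable]: "?A \<in> sets M" by measurable
  have pt: "1 / 3 * indicator ?A \<omega> \<le> 1 - ?E \<omega>" if "\<omega> \<in> space M" for \<omega>
  proof (cases "\<omega> \<in> ?A")
    case True
    then have "1 \<le> norm (?V \<omega>)" using r by simp
    then have "1 \<le> (norm (?V \<omega>))\<^sup>2" by (simp only: one_le_power)
    then have "?E \<omega> \<le> exp (- (1 / 2))" by simp
    also have "\<dots> \<le> 2 / 3" 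
    proof -
      have "1 + 1/2 \<le> exp (1/2 :: real)" using exp_ge_add_one_self[of "1/2 :: real"] by simp
      then have "1 / exp (1/2 :: real) \<le> 1 / (3 / 2)" by (intro divide_left_mono) auto
      then show ?thesis by (simp add: exp_minus inverse_eq_divide)
    qed
    finally show ?thesis using True by simp
  next
    case False
    then show ?thesis by simp
  qed
  have "1 / 3 * prob ?A = (\<integral>\<omega>. 1 / 3 * indicator ?A \<omega> \<partial>M)" by simp
  also have "\<dots> \<le> (\<integral>\<omega>. 1 - ?E \<omega> \<partial>M)"
    using iE pt by (intro integral_mono) (auto intro!: integrable_real_indicator simp: emeasure_eq_measure)
  also have "\<dots> = 1 - (\<integral>\<omega>. ?E \<omega> \<partial>M)" using iE prob_space by simp
  finally show ?thesis using up by simp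
qed

text \<open>Again by smoothing at scale \<open>r\<close>: in the Gaussian average of \<open>exp (-
  s (norm \<xi> / r) powr \<alpha>)\<close> the points \<open>\<xi>\<close> in the square of
  half-width \<open>R\<close> contribute at most its Gaussian mass, which is at most
  \<open>R\<^sup>2\<close>, and the others have a small integrand. The phase caused by the centre
  \<open>y\<close> disappears in absolute values.\<close>

lemma small_ball_bound:
  assumes r: "0 < r" and R: "0 < R"
  shows "prob {\<omega> \<in> space M. norm (W \<omega> - y) \<le> r} \<le> 2 * (R\<^sup>2 + exp (- (s * (R / r) powr \<alpha>)))"
proof -
  interpret G: prob_space std_normal_distribution by (rule real_distribution.axioms(1)[OF real_dist_normal_dist])
  interpret GG: prob_space planar_gaussian by (rule prob_space_planar_gaussian)
  let ?V = "\<lambda>\<omega>. (1 / r) *\<^sub>R (W \<omega> - y)"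
  let ?E = "\<lambda>\<omega>. exp (- (norm (?V \<omega>))\<^sup>2 / 2)"
  let ?n = "\<lambda>p. norm (Complex (fst p) (snd p))"
  let ?F = "\<lambda>p. exp (- (s * (?n p / r) powr \<alpha>))"
  let ?B = "{-R..R} \<times> {-R..R}"
  have iE: "integrable M ?E" by (rule integrable_const_bound[of _ 1]) auto
  have iF: "integrable planar_gaussian ?F"
    by (rule GG.integrable_const_bound[of _ 1]) (use s in \<open>auto simp: Complex_eq\<close>)
  have "norm (complex_of_real (\<integral>\<omega>. ?E \<omega> \<partial>M)) 
     \<le> (\<integral>p. norm (iexp (- (Complex (fst p) (snd p) \<bullet> y / r)) * complex_of_real (?F p)) \<partial>planar_gaussian)"
    using gaussian_smoothing[OF prob_space_axioms, of ?V] integral_norm_bound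
    unfolding scaled_shifted_characteristic_function[OF r] by simp
  then have EF: "(\<integral>\<omega>. ?E \<omega> \<partial>M) \<le> (\<integral>p. ?F p \<partial>planar_gaussian)"
    by (simp add: norm_mult)
  have le: "?F p \<le> indicator ?B p + exp (- (s * (R / r) powr \<alpha>))" for p
  proof (cases "p \<in> ?B")
    case True
    have "?F p \<le> 1" using s by simp
    then show ?thesis using True by (simp add: add_increasing2)
  next
    case False
    then have "R \<le> \<bar>fst p\<bar> \<or> R \<le> \<bar>snd p\<bar>" by (cases p) (auto simp: abs_le_iff)
    then have "R \<le> ?n p" using abs_Re_le_cmod[of "Complex (fst p) (snd p)"] abs_Im_le_cmod[of "Complex (fst p) (snd p)"] by auto
    then have "(R / r) powr \<alpha> \<le> (?n p / r) powr \<alpha>"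
      using r R \<alpha> by (intro powr_mono2) (auto simp: divide_right_mono)
    then have "?F p \<le> exp (- (s * (R / r) powr \<alpha>))" using s by (simp add: mult_left_mono)
    then show ?thesis using False by simp
  qed
  have B: "GG.prob ?B \<le> R\<^sup>2"
  proof -
    have "emeasure std_normal_distribution {-R..R} = (\<integral>\<^sup>+x. ennreal (std_normal_density x) * indicator {-R..R} x \<partial>lborel)"
      by (subst emeasure_density) auto
    also have "\<dots> \<le> (\<integral>\<^sup>+x. ennreal (1/2) * indicator {-R..R} x \<partial>lborel)"
    proof (intro nn_integral_mono mult_right_mono ennreal_leI)
      fix x :: real
      have "2 \<le> sqrt (2 * pi)" using pi_ge_two by (intro real_le_rsqrt) auto
      then have "1 / sqrt (2 * pi) * exp (- x\<^sup>2 / 2) \<le> 1 / 2 * 1"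
        by (intro mult_mono) (auto simp: field_simps)
      then show "std_normal_density x \<le> 1 / 2" by (simp add: std_normal_density_def)
    qed auto
    also have "\<dots> = ennreal (1/2) * ennreal (2 * R)"
      using R by (subst nn_integral_cmult_indicator) auto
    also have "\<dots> = ennreal R" using R by (simp only: ennreal_mult[symmetric]) simp
    finally have "G.prob {-R..R} \<le> R" using R by (simp add: G.emeasure_eq_measure)
    then have "G.prob {-R..R} * G.prob {-R..R} \<le> R * R" by (intro mult_mono) (use R in auto)
    moreover have "GG.prob ?B = G.prob {-R..R} * G.prob {-R..R}"
      using G.emeasure_pair_measure_Times[of "{-R..R}" std_normal_distribution "{-R..R}"]
      by (simp add: measure_def enn2real_mult)
    ultimately show ?thesis by (simp add: power2_eq_square)
  qed
  have iB: "integrable planar_gaussian (indicator ?B :: _ \<Rightarrow> real)"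
    by (auto intro!: integrable_real_indicator simp: GG.emeasure_eq_measure)
  have "(\<integral>p. ?F p \<partial>planar_gaussian) \<le> (\<integral>p. indicator ?B p + exp (- (s * (R / r) powr \<alpha>)) \<partial>planar_gaussian)"
    using iF iB le by (intro integral_mono) auto
  also have "\<dots> = GG.prob ?B + exp (- (s * (R / r) powr \<alpha>))"
    using iB GG.prob_space by simp
  finally have up: "(\<integral>\<omega>. ?E \<omega> \<partial>M) \<le> R\<^sup>2 + exp (- (s * (R / r) powr \<alpha>))" using EF B by linarith
  let ?A = "{\<omega> \<in> space M. norm (W \<omega> - y) \<le> r}"
  have A[measurable]: "?A \<in> sets M" by measurable
  have pt: "1 / 2 * indicator ?A \<omega> \<le> ?E \<omega>" if "\<omega> \<in> space M" for \<omega>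
  proof (cases "\<omega> \<in> ?A")
    case True
    then have "norm (?V \<omega>) \<le> 1" using r by simp
    then have "(norm (?V \<omega>))\<^sup>2 \<le> 1" by (simp only: power_le_one norm_ge_zero)
    moreover have "1 + - (norm (?V \<omega>))\<^sup>2 / 2 \<le> ?E \<omega>" by (rule exp_ge_add_one_self)
    ultimately show ?thesis using True by simp
  qed simp
  have "1 / 2 * prob ?A = (\<integral>\<omega>. 1 / 2 * indicator ?A \<omega> \<partial>M)" by simp
  also have "\<dots> \<le> (\<integral>\<omega>. ?E \<omega> \<partial>M)"
    using iE pt by (intro integral_mono) (auto intro!: integrable_real_indicator simp: emeasure_eq_measure)
  finally show ?thesis using up by simp
qed

end

text \<open>The choice \<open>R = (K r) powr \<gamma>\<close> in the small ball bound makes the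
  mass of a disc of radius \<open>K r\<close> negligible against \<open>r powr \<alpha>\<close> if
  \<open>\<alpha> < 2 \<gamma> < 2\<close>; here \<open>\<gamma> = (\<alpha> + 2) / 4\<close>.\<close>

lemma small_ball_rate:
  fixes \<alpha> s K :: real
  assumes "0 < \<alpha>" "\<alpha> < 2" "0 < s" "0 < K"
  shows "((\<lambda>r. r powr - \<alpha> * (2 * (((K * r) powr ((\<alpha> + 2) / 4))\<^sup>2 + exp (- (s * ((K * r) powr ((\<alpha> + 2) / 4) / (K * r)) powr \<alpha>)))))
      \<longlongrightarrow> 0) (at_right 0)"
proof -
  define \<gamma> where "\<gamma> = (\<alpha> + 2) / 4"
  have \<gamma>: "\<alpha> < 2 * \<gamma>" "\<gamma> < 1" using assms by (auto simp: \<gamma>_def)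
  define \<kappa> where "\<kappa> = (1 - \<gamma>) * \<alpha>"
  have \<kappa>: "0 < \<kappa>" using \<gamma> assms by (simp add: \<kappa>_def)
  define u where "u = s * K powr - \<kappa>"
  have u: "0 < u" using assms by (simp add: u_def)
  have "((\<lambda>r. 2 * (K powr (2 * \<gamma>) * r powr (2 * \<gamma> - \<alpha>) + r powr - \<alpha> * exp (- (u * r powr - \<kappa>)))) \<longlongrightarrow> 0) (at_right 0)"
  proof -
    define b where "b = 2 * \<gamma> - \<alpha>"
    have "0 < b" using \<gamma> by (simp add: b_def)
    then have 1: "((\<lambda>r::real. r powr b) \<longlongrightarrow> 0) (at_right 0)" by real_asymp
    have 2: "((\<lambda>r::real. r powr - \<alpha> * exp (- (u * r powr - \<kappa>))) \<longlongrightarrow> 0) (at_right 0)"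
      using u \<kappa> assms(1) by real_asymp
    show ?thesis unfolding b_def[symmetric]
      by (rule tendsto_eq_intros 1 2 | simp)+
  qed
  moreover have "\<forall>\<^sub>F r in at_right 0. 2 * (K powr (2 * \<gamma>) * r powr (2 * \<gamma> - \<alpha>) + r powr - \<alpha> * exp (- (u * r powr - \<kappa>)))
     = r powr - \<alpha> * (2 * (((K * r) powr ((\<alpha> + 2) / 4))\<^sup>2 + exp (- (s * ((K * r) powr ((\<alpha> + 2) / 4) / (K * r)) powr \<alpha>))))"
    using eventually_at_right_less[of 0]
  proof eventually_elim
    case (elim r)
    have "((K * r) powr \<gamma> / (K * r)) powr \<alpha> = (K * r) powr (- \<kappa>)"
    proof -
      have "(K * r) powr \<gamma> / (K * r) = (K * r) powr (\<gamma> - 1)"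
        using elim assms by (simp add: powr_diff)
      then show ?thesis by (simp add: powr_powr \<kappa>_def algebra_simps)
    qed
    then have 1: "s * ((K * r) powr \<gamma> / (K * r)) powr \<alpha> = u * r powr - \<kappa>"
      using elim assms by (simp add: u_def powr_mult)
    have dbl: "a powr (2 * \<gamma>) = a powr \<gamma> * a powr \<gamma>" for a :: real
      by (simp add: powr_add[symmetric])
    have 2: "((K * r) powr \<gamma>)\<^sup>2 = K powr (2 * \<gamma>) * r powr (2 * \<gamma>)"
      using elim assms by (simp add: powr_mult power2_eq_square dbl)
    have 3: "r powr - \<alpha> * r powr (2 * \<gamma>) = r powr (2 * \<gamma> - \<alpha>)"
      by (simp add: powr_add[symmetric])
    show ?case unfolding \<gamma>_def[symmetric] 1 2 using 3 by (simp add: algebra_simps)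
  qed
  ultimately show ?thesis by (rule Lim_transform_eventually)
qed

section \<open>Angles along a path\<close>

text \<open>The paths that have a winding around the origin. The lower bounds on compact intervals
  exclude zeros of the path and of its left limits alike. The last condition says that no jump
  segment contains the origin.\<close>

definition nonvanishing_path :: "(real \<Rightarrow> complex) \<Rightarrow> bool" where
  "nonvanishing_path z \<longleftrightarrow> cadlag z \<and> z 0 = 1 \<and> (\<forall>T. \<exists>d>0. \<forall>s\<in>{0..T}. d \<le> norm (z s)) \<and>
     (\<forall>t>0. \<forall>l. (z \<longlongrightarrow> l) (at_left t) \<longrightarrow> z t / l \<notin> \<real>\<^sub>\<le>\<^sub>0)"

text \<open>Both one-sided neighbourhoods of \<open>t\<close> in one statement. At \<open>t =
  0\<close> there is no left-hand side, and the value of \<open>l\<close> is a default.\<close>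

lemma cadlag_near:
  assumes g: "cadlag g" and t: "0 \<le> t"
  obtains l where "0 < t \<Longrightarrow> (g \<longlongrightarrow> l) (at_left t)" "t = 0 \<Longrightarrow> l = g 0"
    "\<And>U V. open U \<Longrightarrow> l \<in> U \<Longrightarrow> open V \<Longrightarrow> g t \<in> V \<Longrightarrow>
       \<exists>d>0. (\<forall>s. 0 \<le> s \<and> t - d < s \<and> s < t \<longrightarrow> g s \<in> U) \<and> (\<forall>s. t \<le> s \<and> s < t + d \<longrightarrow> g s \<in> V)"
proof -
  obtain l where l: "0 < t \<Longrightarrow> (g \<longlongrightarrow> l) (at_left t)" "t = 0 \<Longrightarrow> l = g 0"
    using g t unfolding cadlag_def by (metis less_irrefl)
  have near: "\<exists>d>0. (\<forall>s. 0 \<le> s \<and> t - d < s \<and> s < t \<longrightarrow> g s \<in> U) \<and> (\<forall>s. t \<le> s \<and> s < t + d \<longrightarrow> g s \<in> V)"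
    if UV: "open U" "l \<in> U" "open V" "g t \<in> V" for U V
  proof -
    have "(g \<longlongrightarrow> g t) (at_right t)" using g t by (auto simp: cadlag_def)
    from topological_tendstoD[OF this UV(3,4)] obtain b where b: "b > t" "\<And>s. t < s \<Longrightarrow> s < b \<Longrightarrow> g s \<in> V"
      unfolding eventually_at_right_field by auto
    have "\<exists>c<t. \<forall>s. 0 \<le> s \<and> c < s \<and> s < t \<longrightarrow> g s \<in> U"
    proof (cases "t = 0")
      case True
      then show ?thesis by (intro exI[of _ "-1"]) auto
    next
      case False
      then have "(g \<longlongrightarrow> l) (at_left t)" using l t by auto
      from topological_tendstoD[OF this UV(1,2)] show ?thesis
        unfolding eventually_at_left_field by auto
    qed
    then obtain c where c: "c < t" "\<And>s. 0 \<le> s \<Longrightarrow> c < s \<Longrightarrow> s < t \<Longrightarrow> g s \<in> U" by blast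
    show ?thesis
    proof (intro exI[of _ "min (b - t) (t - c)"] conjI allI impI)
      fix s assume "t \<le> s \<and> s < t + min (b - t) (t - c)"
      then show "g s \<in> V" using b(2)[of s] UV(4) by (cases "s = t") auto
    qed (use b(1) c in auto)
  qed
  show ?thesis by (rule that[OF l near])
qed

lemma Arg_ratio_near:
  assumes l: "l \<noteq> 0" and r: "r / l \<notin> \<real>\<^sub>\<le>\<^sub>0" and e: "0 < e"
  obtains U V where "open U" "l \<in> U" "open V" "r \<in> V"
    "\<And>x y. x \<in> U \<Longrightarrow> y \<in> V \<Longrightarrow> \<bar>Arg (y / x) - Arg (r / l)\<bar> < e"
proof -
  have "((\<lambda>p. Arg (snd p / fst p)) \<longlongrightarrow> Arg (snd (l, r) / fst (l, r))) (nhds (l, r))"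
    using tendsto_fst[OF filterlim_ident, of "(l, r)"] tendsto_snd[OF filterlim_ident, of "(l, r)"] l r
    by (intro tendsto_Arg tendsto_divide) simp_all
  from tendstoD[OF this e] obtain P Q where PQ: "eventually P (nhds l)" "eventually Q (nhds r)"
      "\<And>x y. P x \<Longrightarrow> Q y \<Longrightarrow> \<bar>Arg (y / x) - Arg (r / l)\<bar> < e"
    unfolding nhds_prod eventually_prod_filter by (auto simp: dist_real_def)
  from PQ(1) obtain U where U: "open U" "l \<in> U" "\<And>x. x \<in> U \<Longrightarrow> P x" unfolding eventually_nhds by blast
  from PQ(2) obtain V where V: "open V" "r \<in> V" "\<And>x. x \<in> V \<Longrightarrow> Q x" unfolding eventually_nhds by blast
  show ?thesis by (rule that[OF U(1,2) V(1,2)]) (use PQ(3) U(3) V(3) in blast)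
qed

lemma nonvanishing_path_nonzero:
  assumes "nonvanishing_path z" "0 \<le> t"
  shows "z t \<noteq> 0"
proof -
  obtain d where "d > 0" "\<forall>s\<in>{0..t}. d \<le> norm (z s)" using assms unfolding nonvanishing_path_def by blast
  then show ?thesis using assms(2) by force
qed

lemma nonvanishing_path_left_limit:
  assumes z: "nonvanishing_path z" and tp: "0 < t" and l: "(z \<longlongrightarrow> l) (at_left t)"
  shows "l \<noteq> 0"
proof -
  obtain d where d: "d > 0" "\<And>s. s \<in> {0..t} \<Longrightarrow> d \<le> norm (z s)" using z unfolding nonvanishing_path_def by blast
  have "\<forall>\<^sub>F s in at_left t. d \<le> norm (z s)"
    using eventually_at_left_real[OF tp] by eventually_elim (use d in auto)
  then have "d \<le> norm l"
    using tendsto_lowerbound[OF tendsto_norm[OF l]] by (simp add: trivial_limit_at_left_real)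
  then show ?thesis using d by auto
qed

text \<open>Here \<open>\<phi>\<close> is the angle swept at time \<open>t\<close>. It is smaller
  than \<open>\<pi>\<close> in absolute value because the jump segment misses the origin, and
  close to \<open>t\<close> every other angle is small.\<close>

lemma angle_local:
  assumes z: "nonvanishing_path z" and t: "0 \<le> t"
  obtains \<phi> where "\<bar>\<phi>\<bar> < pi"
    "\<And>e. 0 < e \<Longrightarrow> \<exists>d>0. \<forall>a b. 0 \<le> a \<and> a \<le> b \<and> t - d < a \<and> b < t + d \<longrightarrow>
        (if a < t \<and> t \<le> b then \<bar>Arg (z b / z a) - \<phi>\<bar> < e else \<bar>Arg (z b / z a)\<bar> < e)"
proof -
  have c: "cadlag z" using z by (simp add: nonvanishing_path_def)
  obtain l where l: "0 < t \<Longrightarrow> (z \<longlongrightarrow> l) (at_left t)" "t = 0 \<Longrightarrow> l = z 0"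
    "\<And>U V. open U \<Longrightarrow> l \<in> U \<Longrightarrow> open V \<Longrightarrow> z t \<in> V \<Longrightarrow>
       \<exists>d>0. (\<forall>s. 0 \<le> s \<and> t - d < s \<and> s < t \<longrightarrow> z s \<in> U) \<and> (\<forall>s. t \<le> s \<and> s < t + d \<longrightarrow> z s \<in> V)"
    using cadlag_near[OF c t] by blast
  have l0: "l \<noteq> 0"
  proof (cases "t = 0")
    case True
    then show ?thesis using l(2) nonvanishing_path_nonzero[OF z t] by simp
  next
    case False
    then have "0 < t" using t by simp
    from nonvanishing_path_left_limit[OF z this l(1)[OF this]] show ?thesis .
  qed
  have zt: "z t \<noteq> 0" by (rule nonvanishing_path_nonzero[OF z t])
  have rl: "z t / l \<notin> \<real>\<^sub>\<le>\<^sub>0"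
  proof (cases "t = 0")
    case True then show ?thesis using l(2) zt by (simp add: complex_nonpos_Reals_iff)
  next
    case False then show ?thesis using l(1) t z by (auto simp: nonvanishing_path_def)
  qed
  have one: "w / w \<notin> \<real>\<^sub>\<le>\<^sub>0" if "w \<noteq> 0" for w :: complex using that by (simp add: complex_nonpos_Reals_iff)
  show ?thesis
  proof (rule that[of "Arg (z t / l)"])
    have "Arg (z t / l) \<noteq> pi" using rl by (auto simp: Arg_eq_pi complex_nonpos_Reals_iff)
    then show "\<bar>Arg (z t / l)\<bar> < pi"
      using mpi_less_Arg[of "z t / l"] Arg_le_pi[of "z t / l"] by (auto simp: abs_less_iff)
    fix e :: real assume e: "0 < e"
    obtain U1 V1 where A1: "open U1" "l \<in> U1" "open V1" "l \<in> V1"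
      "\<And>x y. x \<in> U1 \<Longrightarrow> y \<in> V1 \<Longrightarrow> \<bar>Arg (y / x)\<bar> < e"
      using Arg_ratio_near[OF l0 one[OF l0] e] l0 by auto
    obtain U2 V2 where A2: "open U2" "z t \<in> U2" "open V2" "z t \<in> V2"
      "\<And>x y. x \<in> U2 \<Longrightarrow> y \<in> V2 \<Longrightarrow> \<bar>Arg (y / x)\<bar> < e"
      using Arg_ratio_near[OF zt one[OF zt] e] zt by auto
    obtain U3 V3 where A3: "open U3" "l \<in> U3" "open V3" "z t \<in> V3"
      "\<And>x y. x \<in> U3 \<Longrightarrow> y \<in> V3 \<Longrightarrow> \<bar>Arg (y / x) - Arg (z t / l)\<bar> < e"
      using Arg_ratio_near[OF l0 rl e] by auto
    have "\<exists>d>0. (\<forall>s. 0 \<le> s \<and> t - d < s \<and> s < t \<longrightarrow> z s \<in> U1 \<inter> V1 \<inter> U3) \<and> (\<forall>s. t \<le> s \<and> s < t + d \<longrightarrow> z s \<in> U2 \<inter> V2 \<inter> V3)"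
      by (rule l(3)) (use A1 A2 A3 in auto)
    then obtain d where d: "d > 0" "\<And>s. 0 \<le> s \<Longrightarrow> t - d < s \<Longrightarrow> s < t \<Longrightarrow> z s \<in> U1 \<inter> V1 \<inter> U3"
      "\<And>s. t \<le> s \<Longrightarrow> s < t + d \<Longrightarrow> z s \<in> U2 \<inter> V2 \<inter> V3" by blast
    show "\<exists>d>0. \<forall>a b. 0 \<le> a \<and> a \<le> b \<and> t - d < a \<and> b < t + d \<longrightarrow>
        (if a < t \<and> t \<le> b then \<bar>Arg (z b / z a) - Arg (z t / l)\<bar> < e else \<bar>Arg (z b / z a)\<bar> < e)"
    proof (intro exI[of _ d] conjI allI impI)
      fix a b assume ab: "0 \<le> a \<and> a \<le> b \<and> t - d < a \<and> b < t + d"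
      consider "b < t" | "a < t" "t \<le> b" | "t \<le> a" by linarith
      then show "if a < t \<and> t \<le> b then \<bar>Arg (z b / z a) - Arg (z t / l)\<bar> < e else \<bar>Arg (z b / z a)\<bar> < e"
      proof cases
        case 1 then show ?thesis using A1(5) d(2)[of a] d(2)[of b] ab by auto
      next
        case 2 then show ?thesis using A3(5) d(2)[of a] d(3)[of b] ab by auto
      next
        case 3 then show ?thesis using A2(5) d(3)[of a] d(3)[of b] ab by auto
      qed
    qed (rule d(1))
  qed
qed

text \<open>The Lebesgue number of the cover of \<open>[0, T]\<close> by the given neighbourhoods.\<close>

lemma uniform_from_local:
  fixes Q :: "real \<Rightarrow> real \<Rightarrow> bool"
  assumes loc: "\<And>t. 0 \<le> t \<Longrightarrow> \<exists>d>0. \<forall>a b. 0 \<le> a \<and> a \<le> b \<and> t - d < a \<and> b < t + d \<longrightarrow> Q a b"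
  shows "\<exists>\<delta>>0. \<forall>a b. 0 \<le> a \<and> a \<le> b \<and> b \<le> T \<and> b - a < \<delta> \<longrightarrow> Q a b"
proof -
  obtain d where d: "\<And>t. 0 \<le> t \<Longrightarrow> 0 < d t"
    "\<And>t a b. 0 \<le> t \<Longrightarrow> 0 \<le> a \<Longrightarrow> a \<le> b \<Longrightarrow> t - d t < a \<Longrightarrow> b < t + d t \<Longrightarrow> Q a b"
    using loc by metis
  obtain e where e: "0 < e" "\<And>x. x \<in> {0..T} \<Longrightarrow> \<exists>G\<in>(\<lambda>t. {t - d t<..<t + d t}) ` {0..T}. ball x e \<subseteq> G"
  proof (rule Heine_Borel_lemma[of "{0..T}" "(\<lambda>t. {t - d t<..<t + d t}) ` {0..T}"])
    show "{0..T} \<subseteq> \<Union>((\<lambda>t. {t - d t<..<t + d t}) ` {0..T})" using d(1) by fastforce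
  qed auto
  show ?thesis
  proof (intro exI[of _ e] conjI allI impI)
    fix a b assume ab: "0 \<le> a \<and> a \<le> b \<and> b \<le> T \<and> b - a < e"
    then obtain t where t: "t \<in> {0..T}" "ball a e \<subseteq> {t - d t<..<t + d t}" using e(2)[of a] by auto
    have "a \<in> ball a e" "b \<in> ball a e" using ab e(1) by (auto simp: dist_real_def)
    then have "a \<in> {t - d t<..<t + d t}" "b \<in> {t - d t<..<t + d t}" using t(2) by (blast dest: subsetD)+
    then show "Q a b" using d(2)[of t a b] t(1) ab by auto
  qed (rule e(1))
qed

text \<open>Principal arguments add up as long as their sum stays in \<open>(-\<pi>,
  \<pi>)\<close>. Of two adjacent short intervals at most one contains a large jump, so one angle
  is close to some \<open>\<phi>\<close> with \<open>\<bar>\<phi>\<bar> < \<pi>\<close> and the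
  other one is close to 0.\<close>

lemma angle_additive:
  assumes z: "nonvanishing_path z"
  shows "\<exists>\<delta>>0. \<forall>a b. 0 \<le> a \<and> a \<le> b \<and> b \<le> T \<and> b - a < \<delta> \<longrightarrow>
     (\<forall>c\<in>{a..b}. Arg (z b / z a) = Arg (z c / z a) + Arg (z b / z c))"
proof (rule uniform_from_local)
  fix t :: real assume t: "0 \<le> t"
  from angle_local[OF z t] obtain \<phi> where \<phi>: "\<bar>\<phi>\<bar> < pi"
    "\<And>e. 0 < e \<Longrightarrow> \<exists>d>0. \<forall>a b. 0 \<le> a \<and> a \<le> b \<and> t - d < a \<and> b < t + d \<longrightarrow>
        (if a < t \<and> t \<le> b then \<bar>Arg (z b / z a) - \<phi>\<bar> < e else \<bar>Arg (z b / z a)\<bar> < e)" by blast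
  define e where "e = (pi - \<bar>\<phi>\<bar>) / 2"
  have e: "0 < e" using \<phi> by (simp add: e_def)
  obtain d where d: "d > 0" "\<And>a b. 0 \<le> a \<Longrightarrow> a \<le> b \<Longrightarrow> t - d < a \<Longrightarrow> b < t + d \<Longrightarrow>
        (if a < t \<and> t \<le> b then \<bar>Arg (z b / z a) - \<phi>\<bar> < e else \<bar>Arg (z b / z a)\<bar> < e)" using \<phi>(2)[OF e] by blast
  show "\<exists>d>0. \<forall>a b. 0 \<le> a \<and> a \<le> b \<and> t - d < a \<and> b < t + d \<longrightarrow>
      (\<forall>c\<in>{a..b}. Arg (z b / z a) = Arg (z c / z a) + Arg (z b / z c))"
  proof (intro exI[of _ d] conjI allI impI ballI)
    fix a b c assume ab: "0 \<le> a \<and> a \<le> b \<and> t - d < a \<and> b < t + d" and c: "c \<in> {a..b}"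
    have n: "z a \<noteq> 0" "z b \<noteq> 0" "z c \<noteq> 0" using nonvanishing_path_nonzero[OF z] ab c by auto
    have s: "\<bar>Arg (z c / z a) + Arg (z b / z c)\<bar> < pi"
    proof -
      have "if a < t \<and> t \<le> c then \<bar>Arg (z c / z a) - \<phi>\<bar> < e else \<bar>Arg (z c / z a)\<bar> < e"
        using d(2)[of a c] ab c by auto
      moreover have "if c < t \<and> t \<le> b then \<bar>Arg (z b / z c) - \<phi>\<bar> < e else \<bar>Arg (z b / z c)\<bar> < e"
        using d(2)[of c b] ab c by auto
      moreover have "\<bar>\<phi>\<bar> + e + e = pi" by (simp add: e_def)
      ultimately show ?thesis by (auto split: if_splits)
    qed
    have "z b / z a = (z c / z a) * (z b / z c)" using n by simp
    also have "Arg \<dots> = Arg (z c / z a) + Arg (z b / z c)"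
      by (rule Arg_times) (use n s in auto)
    finally show "Arg (z b / z a) = Arg (z c / z a) + Arg (z b / z c)" .
  qed (rule d(1))
qed

text \<open>A continuous determination of the argument described without topology: over short time
  intervals its increments are principal arguments.\<close>

definition angle_lift :: "(real \<Rightarrow> complex) \<Rightarrow> real \<Rightarrow> (real \<Rightarrow> real) \<Rightarrow> bool" where
  "angle_lift z T f \<longleftrightarrow> f 0 = 0 \<and> (\<exists>\<delta>>0. \<forall>s t. 0 \<le> s \<and> s \<le> t \<and> t \<le> T \<and> t - s < \<delta> \<longrightarrow> f t - f s = Arg (z t / z s))"

text \<open>Add up the angles over the cells of a grid finer than half of the range on which
  angles are additive, and the angle over the last, incomplete cell. Two times at a distance below
  the mesh lie in the same cell or in adjacent ones, so additivity applies.\<close>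

lemma angle_lift_exists:
  assumes z: "nonvanishing_path z"
  shows "\<exists>f. angle_lift z T f"
proof -
  obtain \<delta> where \<delta>: "0 < \<delta>" "\<And>a b c. 0 \<le> a \<Longrightarrow> a \<le> c \<Longrightarrow> c \<le> b \<Longrightarrow> b \<le> T + 1 \<Longrightarrow> b - a < \<delta> \<Longrightarrow>
     Arg (z b / z a) = Arg (z c / z a) + Arg (z b / z c)"
    using angle_additive[OF z, of "T + 1"] by (metis atLeastAtMost_iff order_trans)
  \<comment> \<open>two cells fit into the range of additivity, and one cell beyond \<open>T\<close> ends before \<open>T + 1\<close>\<close>
  define h where "h = min (\<delta> / 3) 1"
  have h: "0 < h" "2 * h < \<delta>" "h \<le> 1" using \<delta>(1) by (auto simp: h_def min_def)
  define k where "k t = nat \<lfloor>t / h\<rfloor>" for t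
  have k: "k t * h \<le> t" "t < k t * h + h" if "0 \<le> t" for t
  proof -
    have "real (k t) = \<lfloor>t / h\<rfloor>" using that h by (simp add: k_def)
    then have "real (k t) \<le> t / h" "t / h < real (k t) + 1" by linarith+
    then show "k t * h \<le> t" "t < k t * h + h" using h by (auto simp: field_simps)
  qed
  have k1: "0 \<le> k t * h" for t using h by simp
  define F where "F j = (\<Sum>i<j. Arg (z (real (Suc i) * h) / z (real i * h)))" for j
  define f where "f t = F (k t) + Arg (z t / z (k t * h))" for t
  have "f 0 = 0" using nonvanishing_path_nonzero[OF z, of 0] by (simp add: f_def F_def k_def)
  moreover have "f t - f s = Arg (z t / z s)" if st: "0 \<le> s" "s \<le> t" "t \<le> T" "t - s < h" for s t
  proof -
    have t0: "0 \<le> t" using st by simp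
    note ks = k[OF st(1)] and kt = k[OF t0]
    have "s / h \<le> t / h" using st h by (simp add: divide_right_mono)
    then have "k s \<le> k t" unfolding k_def by (intro nat_mono floor_mono)
    moreover have "k t * h < (k s + 2) * h" using st ks kt by (simp add: algebra_simps)
    then have "k t < k s + 2" using h by (metis mult_less_cancel_right_pos of_nat_less_iff)
    ultimately consider "k t = k s" | "k t = Suc (k s)" by linarith
    then show ?thesis
    proof cases
      case 1
      then show ?thesis
        using \<delta>(2)[of "k s * h" s t] ks kt k1[of s] st h by (simp add: f_def)
    next
      case 2
      have T: "Suc (k s) * h \<le> T" using kt 2 st by simp
      have "Arg (z (Suc (k s) * h) / z (k s * h)) = Arg (z s / z (k s * h)) + Arg (z (Suc (k s) * h) / z s)"
        using \<delta>(2)[of "k s * h" s "Suc (k s) * h"] ks T h k1[of s] by (simp add: algebra_simps)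
      moreover have "Arg (z t / z s) = Arg (z (Suc (k s) * h) / z s) + Arg (z t / z (Suc (k s) * h))"
        using \<delta>(2)[of s "Suc (k s) * h" t] ks kt 2 st h by (simp add: algebra_simps)
      ultimately show ?thesis using 2 by (simp add: f_def F_def)
    qed
  qed
  ultimately show ?thesis unfolding angle_lift_def using h(1) by blast
qed

definition winding_sum :: "(real \<Rightarrow> complex) \<Rightarrow> real \<Rightarrow> nat \<Rightarrow> real" where
  "winding_sum z t n = (\<Sum>k<n. Arg (z (t * real (Suc k) / n) / z (t * k / n)))"

text \<open>The sums along fine grids are eventually constant, so the limit is attained. This
  expression is visibly measurable in the path.\<close>

definition winding_angle :: "(real \<Rightarrow> complex) \<Rightarrow> real \<Rightarrow> real" where
  "winding_angle z t = lim (winding_sum z t)"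

lemma angle_lift_winding_sum:
  assumes f: "angle_lift z T f" and t: "0 \<le> t" "t \<le> T"
  shows "\<forall>\<^sub>F n in sequentially. winding_sum z t n = f t"
proof -
  obtain \<delta> where \<delta>: "0 < \<delta>" "\<And>s t. 0 \<le> s \<Longrightarrow> s \<le> t \<Longrightarrow> t \<le> T \<Longrightarrow> t - s < \<delta> \<Longrightarrow> f t - f s = Arg (z t / z s)"
    and f0: "f 0 = 0" using f unfolding angle_lift_def by blast
  have "((\<lambda>n. t * (1 / real n)) \<longlongrightarrow> t * 0) sequentially" by (intro tendsto_intros lim_1_over_n)
  then have "\<forall>\<^sub>F n in sequentially. t * (1 / real n) < \<delta>" using \<delta>(1) by (intro order_tendstoD(2)) auto
  then show ?thesis using eventually_gt_at_top[of 0]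
  proof eventually_elim
    case (elim n)
    define g where "g k = f (t * real k / n)" for k
    have "winding_sum z t n = (\<Sum>k<n. g (Suc k) - g k)"
      unfolding winding_sum_def
    proof (rule sum.cong)
      fix k assume k: "k \<in> {..<n}"
      have "t * real (Suc k) / n - t * k / n = t * (1 / n)" by (simp add: algebra_simps add_divide_distrib)
      moreover have "t * real (Suc k) / n \<le> t * 1"
        using k t elim mult_left_mono[of "real (Suc k) / n" 1 t] by (simp del: of_nat_Suc)
      ultimately show "Arg (z (t * real (Suc k) / n) / z (t * k / n)) = g (Suc k) - g k"
        unfolding g_def using t elim
        by (intro \<delta>(2)[symmetric]) (auto intro!: divide_right_mono mult_left_mono)
    qed simp
    also have "\<dots> = g n - g 0" by (rule sum_lessThan_telescope)
    also have "\<dots> = f t" using elim f0 by (simp add: g_def)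
    finally show ?case .
  qed
qed

lemma angle_lift_unique:
  assumes "angle_lift z T f" "0 \<le> t" "t \<le> T"
  shows "f t = winding_angle z t"
  unfolding winding_angle_def
  using angle_lift_winding_sum[OF assms] by (intro limI[symmetric] tendsto_eventually)

lemma angle_lift_winding_angle:
  assumes z: "nonvanishing_path z" and T: "0 \<le> T"
  shows "angle_lift z T (winding_angle z)"
proof -
  obtain f where f: "angle_lift z T f" using angle_lift_exists[OF z] by blast
  have "f t = winding_angle z t" if "0 \<le> t" "t \<le> T" for t by (rule angle_lift_unique[OF f that])
  with f T show ?thesis unfolding angle_lift_def by (smt (verit, best) order_trans)
qed

lemma sgn_divide_complex: "sgn (x / y) = sgn x / sgn (y :: complex)"
  by (simp add: sgn_eq norm_divide)

lemma exp_Arg_eq_sgn: "w \<noteq> 0 \<Longrightarrow> exp (\<i> * complex_of_real (Arg w)) = sgn w"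
  unfolding sgn_eq by (subst (2) Arg_eq) simp_all

lemma cadlag_winding_angle:
  assumes z: "nonvanishing_path z"
  shows "0 \<le> t \<Longrightarrow> (winding_angle z \<longlongrightarrow> winding_angle z t) (at_right t)"
    and "0 < t \<Longrightarrow> (z \<longlongrightarrow> l) (at_left t) \<Longrightarrow>
       (winding_angle z \<longlongrightarrow> winding_angle z t - Arg (z t / l)) (at_left t)"
proof -
  let ?W = "winding_angle z"
  have c: "cadlag z" using z by (simp add: nonvanishing_path_def)
  show "(?W \<longlongrightarrow> ?W t) (at_right t)" if t: "0 \<le> t"
  proof -
    obtain \<delta> where \<delta>: "0 < \<delta>" "\<And>s s'. 0 \<le> s \<Longrightarrow> s \<le> s' \<Longrightarrow> s' \<le> t + 1 \<Longrightarrow> s' - s < \<delta> \<Longrightarrow> ?W s' - ?W s = Arg (z s' / z s)"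
      using angle_lift_winding_angle[OF z, of "t + 1"] t unfolding angle_lift_def by auto
    have zt: "z t \<noteq> 0" by (rule nonvanishing_path_nonzero[OF z t])
    have "(z \<longlongrightarrow> z t) (at_right t)" using c t by (auto simp: cadlag_def)
    then have "((\<lambda>s. Arg (z s / z t)) \<longlongrightarrow> Arg (z t / z t)) (at_right t)"
      using zt by (intro tendsto_intros) (auto simp: complex_nonpos_Reals_iff)
    then have "((\<lambda>s. ?W t + Arg (z s / z t)) \<longlongrightarrow> ?W t) (at_right t)"
      using zt tendsto_add[OF tendsto_const] by fastforce
    moreover have "\<forall>\<^sub>F s in at_right t. ?W t + Arg (z s / z t) = ?W s"
      unfolding eventually_at_right_field
    proof (intro exI[of _ "t + min 1 \<delta>"] conjI allI impI)
      fix s assume "t < s" "s < t + min 1 \<delta>"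
      then have "s \<le> t + 1" "s - t < \<delta>" "t \<le> s" by linarith+
      then show "?W t + Arg (z s / z t) = ?W s" using \<delta>(2)[of t s] t by auto
    qed (use \<delta> in auto)
    ultimately show ?thesis using Lim_transform_eventually by blast
  qed
  show "(?W \<longlongrightarrow> ?W t - Arg (z t / l)) (at_left t)" if t: "0 < t" and l: "(z \<longlongrightarrow> l) (at_left t)"
  proof -
    obtain \<delta> where \<delta>: "0 < \<delta>" "\<And>s s'. 0 \<le> s \<Longrightarrow> s \<le> s' \<Longrightarrow> s' \<le> t \<Longrightarrow> s' - s < \<delta> \<Longrightarrow> ?W s' - ?W s = Arg (z s' / z s)"
      using angle_lift_winding_angle[OF z, of t] t unfolding angle_lift_def by auto
    have "((\<lambda>s. ?W t - Arg (z t / z s)) \<longlongrightarrow> ?W t - Arg (z t / l)) (at_left t)"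
      using nonvanishing_path_left_limit[OF z t l] z t l
      by (intro tendsto_intros) (auto simp: nonvanishing_path_def)
    moreover have "\<forall>\<^sub>F s in at_left t. ?W t - Arg (z t / z s) = ?W s"
      unfolding eventually_at_left_field
    proof (intro exI[of _ "max 0 (t - \<delta>)"] conjI allI impI)
      fix s assume "max 0 (t - \<delta>) < s" "s < t"
      then show "?W t - Arg (z t / z s) = ?W s" using \<delta>(2)[of s t] t by auto
    qed (use \<delta> t in auto)
    ultimately show ?thesis using Lim_transform_eventually by blast
  qed
qed

lemma exp_winding_angle:
  assumes z: "nonvanishing_path z" and t: "0 \<le> t"
  shows "exp (\<i> * complex_of_real (winding_angle z t)) = sgn (z t)"
proof -
  let ?W = "winding_angle z"
  obtain \<delta> where \<delta>: "0 < \<delta>" "\<And>s s'. 0 \<le> s \<Longrightarrow> s \<le> s' \<Longrightarrow> s' \<le> t \<Longrightarrow> s' - s < \<delta> \<Longrightarrow> ?W s' - ?W s = Arg (z s' / z s)"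
    and W0: "?W 0 = 0"
    using angle_lift_winding_angle[OF z, of t] t unfolding angle_lift_def by auto
  define P where "P a b \<longleftrightarrow> 0 \<le> a \<longrightarrow> b \<le> t \<longrightarrow> exp (\<i> * complex_of_real (?W b - ?W a)) = sgn (z b / z a)" for a b
  have "P 0 t"
  proof (rule Bolzano[OF t])
    show "P a c" if "P a b" "P b c" "a \<le> b" "b \<le> c" for a b c
      unfolding P_def
    proof (intro impI)
      assume ac: "0 \<le> a" "c \<le> t"
      have n: "z b \<noteq> 0" using nonvanishing_path_nonzero[OF z, of b] ac that by auto
      have "exp (\<i> * complex_of_real (?W c - ?W a)) = exp (\<i> * complex_of_real (?W b - ?W a)) * exp (\<i> * complex_of_real (?W c - ?W b))"
        by (simp add: exp_add[symmetric] algebra_simps)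
      also have "\<dots> = sgn (z b / z a) * sgn (z c / z b)" using that ac by (auto simp: P_def)
      also have "\<dots> = sgn ((z b / z a) * (z c / z b))" by (simp only: sgn_mult)
      also have "(z b / z a) * (z c / z b) = z c / z a" using n by simp
      finally show "exp (\<i> * complex_of_real (?W c - ?W a)) = sgn (z c / z a)" .
    qed
    show "\<exists>d>0. \<forall>a b. a \<le> x \<and> x \<le> b \<and> b - a < d \<longrightarrow> P a b" for x
    proof (intro exI[of _ \<delta>] conjI allI impI)
      fix a b assume ab: "a \<le> x \<and> x \<le> b \<and> b - a < \<delta>"
      show "P a b" unfolding P_def
      proof (intro impI)
        assume *: "0 \<le> a" "b \<le> t"
        then have "z b / z a \<noteq> 0" using nonvanishing_path_nonzero[OF z, of a] nonvanishing_path_nonzero[OF z, of b] ab by auto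
        then show "exp (\<i> * complex_of_real (?W b - ?W a)) = sgn (z b / z a)"
          using \<delta>(2)[of a b] * ab exp_Arg_eq_sgn by auto
      qed
    qed (rule \<delta>(1))
  qed
  then show ?thesis using t W0 z by (simp add: P_def nonvanishing_path_def)
qed

text \<open>Existence: \<open>winding_angle z\<close> jumps by \<open>Arg (z t / l)\<close> at
  \<open>t\<close>, where \<open>l\<close> is the left limit of \<open>z\<close>. Uniqueness: a
  function whose jumps are less than \<open>\<pi>\<close> varies by less than \<open>\<pi>\<close>
  over short intervals, so any winding is an angle lift, and angle lifts are given by the grid
  sums.\<close>

lemma winding_eq:
  assumes z: "nonvanishing_path z"
  shows "winding z = (\<lambda>t\<in>{0..}. winding_angle z t)"
  unfolding winding_def
proof (rule the_equality)
  let ?W = "winding_angle z" and ?w = "\<lambda>t\<in>{0..}. winding_angle z t"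
  have c: "cadlag z" using z by (simp add: nonvanishing_path_def)
  have ev: "\<forall>\<^sub>F s in at_right t. ?W s = ?w s" if "0 \<le> t" for t
    using eventually_at_right_less[of t] by eventually_elim (use that in auto)
  have ev': "\<forall>\<^sub>F s in at_left t. ?W s = ?w s" if "0 < t" for t
    using eventually_at_left_real[OF that] by eventually_elim auto
  have R: "(?w \<longlongrightarrow> ?w t) (at_right t)" if "0 \<le> t" for t
  proof -
    have "?w t = ?W t" using that by simp
    then show ?thesis
      using Lim_transform_eventually[OF cadlag_winding_angle(1)[OF z that] ev[OF that]] by (simp only:)
  qed
  have L: "\<exists>l. (?w \<longlongrightarrow> ?W t - Arg (z t / l)) (at_left t) \<and> z t / l \<notin> \<real>\<^sub>\<le>\<^sub>0" if t: "0 < t" for t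
  proof -
    obtain l where l: "(z \<longlongrightarrow> l) (at_left t)" using c t unfolding cadlag_def by blast
    show ?thesis
      using Lim_transform_eventually[OF cadlag_winding_angle(2)[OF z t l] ev'[OF t]] z l t
      unfolding nonvanishing_path_def by blast
  qed
  have "cadlag ?w" unfolding cadlag_def using R L by blast
  moreover have "?w 0 = 0" using angle_lift_winding_angle[OF z, of 0] by (simp add: angle_lift_def)
  moreover have "\<forall>t\<ge>0. exp (\<i> * complex_of_real (?w t)) = sgn (z t)" using exp_winding_angle[OF z] by simp
  moreover have "\<bar>?w t - Lim (at_left t) ?w\<bar> < pi" if t: "0 < t" for t
  proof -
    obtain l where l: "(?w \<longlongrightarrow> ?W t - Arg (z t / l)) (at_left t)" "z t / l \<notin> \<real>\<^sub>\<le>\<^sub>0" using L[OF t] by blast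
    have "Lim (at_left t) ?w = ?W t - Arg (z t / l)"
      by (rule tendsto_Lim[OF _ l(1)]) (simp add: trivial_limit_at_left_real)
    moreover have "Arg (z t / l) \<noteq> pi" using l(2) by (auto simp: Arg_eq_pi complex_nonpos_Reals_iff)
    then have "\<bar>Arg (z t / l)\<bar> < pi"
      using mpi_less_Arg[of "z t / l"] Arg_le_pi[of "z t / l"] by (auto simp: abs_less_iff)
    ultimately show ?thesis using t by simp
  qed
  ultimately show "is_winding z ?w" unfolding is_winding_def skorokhod_space_def by simp
next
  fix g assume g: "is_winding z g"
  then have cg: "cadlag g" and ext: "g \<in> extensional {0..}" and g0: "g 0 = 0"
    and eg: "\<And>t. 0 \<le> t \<Longrightarrow> exp (\<i> * complex_of_real (g t)) = sgn (z t)"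
    and jg: "\<And>t. 0 < t \<Longrightarrow> \<bar>g t - Lim (at_left t) g\<bar> < pi"
    by (auto simp: is_winding_def skorokhod_space_def)
  have lift: "angle_lift z T g" for T
  proof -
    have "\<exists>\<delta>>0. \<forall>a b. 0 \<le> a \<and> a \<le> b \<and> b \<le> T \<and> b - a < \<delta> \<longrightarrow> \<bar>g b - g a\<bar> < pi"
    proof (rule uniform_from_local)
      fix t :: real assume t: "0 \<le> t"
      obtain l where l: "0 < t \<Longrightarrow> (g \<longlongrightarrow> l) (at_left t)" "t = 0 \<Longrightarrow> l = g 0"
       "\<And>U V. open U \<Longrightarrow> l \<in> U \<Longrightarrow> open V \<Longrightarrow> g t \<in> V \<Longrightarrow>
        \<exists>d>0. (\<forall>s. 0 \<le> s \<and> t - d < s \<and> s < t \<longrightarrow> g s \<in> U) \<and> (\<forall>s. t \<le> s \<and> s < t + d \<longrightarrow> g s \<in> V)"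
        using cadlag_near[OF cg t] by blast
      have j: "\<bar>g t - l\<bar> < pi"
      proof (cases "t = 0")
        case False
        then have tp: "0 < t" using t by simp
        have "Lim (at_left t) g = l" by (rule tendsto_Lim[OF _ l(1)[OF tp]]) (simp add: trivial_limit_at_left_real)
        then show ?thesis using jg[OF tp] by simp
      qed (use l(2) in auto)
      define e where "e = (pi - \<bar>g t - l\<bar>) / 2"
      have e1: "0 < e" using j by (simp add: e_def)
      have "2 * e = pi - \<bar>g t - l\<bar>" by (simp add: e_def)
      then have e2: "\<bar>g t - l\<bar> + 2 * e = pi" by simp
      note e = e1 e2
      have "\<exists>d>0. (\<forall>s. 0 \<le> s \<and> t - d < s \<and> s < t \<longrightarrow> g s \<in> {l - e<..<l + e}) \<and> (\<forall>s. t \<le> s \<and> s < t + d \<longrightarrow> g s \<in> {g t - e<..<g t + e})"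
        by (rule l(3)) (use e in auto)
      then obtain d where d: "d > 0" "\<And>s. 0 \<le> s \<Longrightarrow> t - d < s \<Longrightarrow> s < t \<Longrightarrow> g s \<in> {l - e<..<l + e}"
        "\<And>s. t \<le> s \<Longrightarrow> s < t + d \<Longrightarrow> g s \<in> {g t - e<..<g t + e}" by blast
      show "\<exists>d>0. \<forall>a b. 0 \<le> a \<and> a \<le> b \<and> t - d < a \<and> b < t + d \<longrightarrow> \<bar>g b - g a\<bar> < pi"
      proof (intro exI[of _ d] conjI allI impI)
        fix a b assume ab: "0 \<le> a \<and> a \<le> b \<and> t - d < a \<and> b < t + d"
        consider "b < t" | "a < t" "t \<le> b" | "t \<le> a" by linarith
        then show "\<bar>g b - g a\<bar> < pi"
        proof cases
          case 1 then show ?thesis using d(2)[of a] d(2)[of b] ab e by auto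
        next
          case 2 then show ?thesis using d(2)[of a] d(3)[of b] ab e by auto
        next
          case 3 then show ?thesis using d(3)[of a] d(3)[of b] ab e by auto
        qed
      qed (rule d(1))
    qed
    then obtain \<delta> where \<delta>: "0 < \<delta>" "\<And>a b. 0 \<le> a \<Longrightarrow> a \<le> b \<Longrightarrow> b \<le> T \<Longrightarrow> b - a < \<delta> \<Longrightarrow> \<bar>g b - g a\<bar> < pi" by blast
    have "g b - g a = Arg (z b / z a)" if ab: "0 \<le> a" "a \<le> b" "b \<le> T" "b - a < \<delta>" for a b
    proof (rule Arg_unique[symmetric])
      have n: "z a \<noteq> 0" "z b \<noteq> 0" using nonvanishing_path_nonzero[OF z] ab by auto
      have "exp (\<i> * complex_of_real (g b - g a)) = exp (\<i> * complex_of_real (g b)) / exp (\<i> * complex_of_real (g a))"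
        by (simp add: exp_diff[symmetric] algebra_simps)
      also have "\<dots> = sgn (z b / z a)" using eg ab by (simp add: sgn_divide_complex)
      finally show "complex_of_real (norm (z b / z a)) * exp (\<i> * complex_of_real (g b - g a)) = z b / z a"
        using n by (simp add: sgn_eq)
      show "0 < norm (z b / z a)" using n by simp
      show "- pi < g b - g a" "g b - g a \<le> pi" using \<delta>(2)[OF ab] by auto
    qed
    with \<delta>(1) g0 show ?thesis unfolding angle_lift_def by blast
  qed
  show "g = (\<lambda>t\<in>{0..}. winding_angle z t)"
  proof
    fix t
    show "g t = (\<lambda>t\<in>{0..}. winding_angle z t) t"
    proof (cases "0 \<le> t")
      case True
      then show ?thesis using angle_lift_unique[OF lift[of t] True] by simp
    next
      case False
      then show ?thesis using ext by (auto simp: extensional_def)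
    qed
  qed
qed

lemma cadlag_angle:
  assumes z: "nonvanishing_path z"
  shows "cadlag (winding_angle z)"
  unfolding cadlag_def
proof (intro conjI allI impI)
  show "\<exists>l. (winding_angle z \<longlongrightarrow> l) (at_left t)" if t: "0 < t" for t
  proof -
    obtain l where "(z \<longlongrightarrow> l) (at_left t)"
      using z t unfolding nonvanishing_path_def cadlag_def by blast
    then show ?thesis using cadlag_winding_angle(2)[OF z t] by blast
  qed
qed (rule cadlag_winding_angle(1)[OF z])

lemma cadlag_time_change:
  assumes f: "cadlag f" and l: "l \<in> time_changes"
  shows "cadlag (\<lambda>s. f (l s))"
  unfolding cadlag_def
proof (intro conjI allI impI)
  note mono = time_changesD(1)[OF l] and nn = time_changesD(2)[OF l]
  obtain m where m: "m \<in> time_changes" "\<And>s. 0 \<le> s \<Longrightarrow> l (m s) = s" using time_changes_inverse[OF l] by blast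
  note mnn = time_changesD(2)[OF m(1)]
  have rev: "s < t" if "l s < l t" "0 \<le> s" "0 \<le> t" for s t
  proof (rule ccontr)
    assume "\<not> s < t"
    then consider "t = s" | "t < s" by linarith
    then show False using mono[of t s] that by cases auto
  qed
  fix t :: real
  show "((\<lambda>s. f (l s)) \<longlongrightarrow> f (l t)) (at_right t)" if t: "0 \<le> t"
  proof (rule topological_tendstoI)
    fix S assume S: "open S" "f (l t) \<in> S"
    have "(f \<longlongrightarrow> f (l t)) (at_right (l t))" using f nn[OF t] by (auto simp: cadlag_def)
    from topological_tendstoD[OF this S] obtain b where b: "b > l t" "\<And>s. l t < s \<Longrightarrow> s < b \<Longrightarrow> f s \<in> S"
      unfolding eventually_at_right_field by auto
    have b0: "0 \<le> b" using b(1) nn[OF t] by simp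
    show "\<forall>\<^sub>F s in at_right t. f (l s) \<in> S" unfolding eventually_at_right_field
    proof (intro exI[of _ "m b"] conjI allI impI)
      show "t < m b" using rev[of t "m b"] m(2)[OF b0] mnn[OF b0] b t by simp
      fix s assume s: "t < s" "s < m b"
      then show "f (l s) \<in> S" using mono[of t s] mono[of s "m b"] m(2)[OF b0] t by (intro b(2)) auto
    qed
  qed
  show "\<exists>y. ((\<lambda>s. f (l s)) \<longlongrightarrow> y) (at_left t)" if t: "0 < t"
  proof -
    have lt: "0 < l t" using mono[of 0 t] nn[of 0] t by simp
    then obtain y where y: "(f \<longlongrightarrow> y) (at_left (l t))" using f unfolding cadlag_def by blast
    have "((\<lambda>s. f (l s)) \<longlongrightarrow> y) (at_left t)"
    proof (rule topological_tendstoI)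
      fix S assume S: "open S" "y \<in> S"
      from topological_tendstoD[OF y S] obtain b where b: "b < l t" "\<And>s. b < s \<Longrightarrow> s < l t \<Longrightarrow> f s \<in> S"
        unfolding eventually_at_left_field by auto
      define c where "c = max 0 b"
      have c: "0 \<le> c" "c < l t" "b \<le> c" using b lt by (auto simp: c_def)
      show "\<forall>\<^sub>F s in at_left t. f (l s) \<in> S" unfolding eventually_at_left_field
      proof (intro exI[of _ "m c"] conjI allI impI)
        show "m c < t" using rev[of "m c" t] m(2)[OF c(1)] mnn[OF c(1)] c t by simp
        fix s assume s: "m c < s" "s < t"
        then show "f (l s) \<in> S" using mono[of s t] mono[of "m c" s] m(2)[OF c(1)] mnn[OF c(1)] c t by (intro b(2)) auto
      qed
    qed
    then show ?thesis by blast
  qed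
qed

text \<open>The process is the limit of its values at the next grid time strictly after
  \<open>s\<close>.\<close>

lemma right_continuous_jointly_measurable:
  fixes X :: "real \<Rightarrow> 'w \<Rightarrow> 'b::{metric_space, second_countable_topology}"
  assumes X: "\<And>s. 0 \<le> s \<Longrightarrow> X s \<in> borel_measurable M"
    and rc: "\<And>\<omega> t. \<omega> \<in> space M \<Longrightarrow> 0 \<le> t \<Longrightarrow> ((\<lambda>s. X s \<omega>) \<longlongrightarrow> X t \<omega>) (at_right t)"
  shows "(\<lambda>(\<omega>, s). X (max 0 s) \<omega>) \<in> borel_measurable (M \<Otimes>\<^sub>M borel)"
proof (rule borel_measurable_LIMSEQ_metric)
  define g where "g n s = (real (nat \<lfloor>real (Suc n) * max 0 s\<rfloor>) + 1) / real (Suc n)" for n and s :: real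
  show "(\<lambda>p. X (g n (snd p)) (fst p)) \<in> borel_measurable (M \<Otimes>\<^sub>M borel)" for n
    unfolding g_def
  proof (rule measurable_compose_countable[where f = "\<lambda>i p. X ((real i + 1) / real (Suc n)) (fst p)"
        and g = "\<lambda>p. nat \<lfloor>real (Suc n) * max 0 (snd p)\<rfloor>"])
    show "(\<lambda>p. nat \<lfloor>real (Suc n) * max 0 (snd p)\<rfloor>) \<in> M \<Otimes>\<^sub>M borel \<rightarrow>\<^sub>M count_space UNIV" by measurable
    fix i :: nat
    have [measurable]: "X ((real i + 1) / real (Suc n)) \<in> borel_measurable M" by (rule X) simp
    show "(\<lambda>p. X ((real i + 1) / real (Suc n)) (fst p)) \<in> borel_measurable (M \<Otimes>\<^sub>M borel)" by measurable
  qed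
  fix p assume "p \<in> space (M \<Otimes>\<^sub>M (borel :: real measure))"
  then obtain \<omega> s where p: "p = (\<omega>, s)" "\<omega> \<in> space M" by (auto simp: space_pair_measure)
  define t where "t = max 0 s"
  have t: "0 \<le> t" by (simp add: t_def)
  have gt: "t < g n s" "g n s \<le> t + 1 / real (Suc n)" for n
  proof -
    have "real (nat \<lfloor>real (Suc n) * t\<rfloor>) = \<lfloor>real (Suc n) * t\<rfloor>" using t by (intro of_nat_nat) (simp del: of_nat_Suc)
    then have "real (nat \<lfloor>real (Suc n) * t\<rfloor>) \<le> real (Suc n) * t" "real (Suc n) * t < real (nat \<lfloor>real (Suc n) * t\<rfloor>) + 1" by linarith+
    then show "t < g n s" "g n s \<le> t + 1 / real (Suc n)" unfolding g_def t_def[symmetric] by (auto simp: field_simps simp del: of_nat_Suc)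
  qed
  have "(\<lambda>n. g n s) \<longlonglongrightarrow> t"
  proof (rule tendsto_sandwich[of "\<lambda>_. t" _ _ "\<lambda>n. t + 1 / real (Suc n)"])
    show "(\<lambda>n. t + 1 / real (Suc n)) \<longlonglongrightarrow> t"
      using tendsto_add[OF tendsto_const LIMSEQ_Suc[OF lim_1_over_n]] by fastforce
  qed (auto intro!: always_eventually less_imp_le gt(1) gt(2) simp del: of_nat_Suc)
  then have "filterlim (\<lambda>n. g n s) (at_right t) sequentially"
    using gt(1) less_imp_neq[OF gt(1), symmetric] by (simp add: filterlim_at)
  then show "(\<lambda>n. X (g n (snd p)) (fst p)) \<longlonglongrightarrow> (case p of (\<omega>, s) \<Rightarrow> X (max 0 s) \<omega>)"
    using filterlim_compose[OF rc[OF p(2) t]] by (simp add: p t_def)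
qed

lemma cadlag_measurable:
  fixes z :: "real \<Rightarrow> complex"
  assumes "cadlag z"
  shows "(\<lambda>s. z (max 0 s)) \<in> borel_measurable borel"
proof -
  have "(\<lambda>(\<omega>, s). z (max 0 s)) \<in> borel_measurable (count_space (UNIV :: unit set) \<Otimes>\<^sub>M borel)"
    by (rule right_continuous_jointly_measurable[where X = "\<lambda>s _. z s"]) (use assms in \<open>auto simp: cadlag_def\<close>)
  from measurable_compose[OF _ this, of "\<lambda>s. ((), s)" borel] show ?thesis by simp
qed

lemma cadlag_bounded:
  fixes z :: "real \<Rightarrow> 'a::real_normed_vector"
  assumes z: "cadlag z" and T: "0 \<le> T"
  shows "\<exists>B>0. \<forall>s\<in>{0..T}. norm (z s) \<le> B"
proof -
  have "\<exists>B. \<forall>s\<in>{0..T}. norm (z s) \<le> B"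
  proof (rule interval_gluing[where P = "\<lambda>a b. \<exists>B. \<forall>s\<in>{a..b}. norm (z s) \<le> B", OF T])
    show "\<exists>B. \<forall>s\<in>{t..t}. norm (z s) \<le> B" for t by auto
    show "\<exists>B. \<forall>u\<in>{r..t}. norm (z u) \<le> B"
      if "r \<le> s" "s \<le> t" and 1: "\<exists>B. \<forall>u\<in>{r..s}. norm (z u) \<le> B" and 2: "\<exists>B. \<forall>u\<in>{s..t}. norm (z u) \<le> B" for r s t
    proof -
      obtain A B where AB: "\<forall>u\<in>{r..s}. norm (z u) \<le> A" "\<forall>u\<in>{s..t}. norm (z u) \<le> B" using 1 2 by blast
      have "norm (z u) \<le> max A B" if "u \<in> {r..t}" for u
        using AB that by (cases "u \<le> s") (auto simp: le_max_iff_disj)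
      then show ?thesis by blast
    qed
    fix t :: real
    show "\<forall>\<^sub>F s in at_right t. \<exists>B. \<forall>u\<in>{t..s}. norm (z u) \<le> B" if t: "0 \<le> t"
    proof -
      have "(z \<longlongrightarrow> z t) (at_right t)" using z t by (auto simp: cadlag_def)
      from tendstoD[OF this, of 1] obtain b where b: "b > t" "\<And>s. t < s \<Longrightarrow> s < b \<Longrightarrow> dist (z s) (z t) < 1"
        unfolding eventually_at_right_field by auto
      have "norm (z u) \<le> norm (z t) + 1" if "t \<le> u" "u < b" for u
        using b(2)[of u] that norm_triangle_sub[of "z u" "z t"] by (cases "u = t") (auto simp: dist_norm)
      then have "\<forall>s. t < s \<and> s < b \<longrightarrow> (\<exists>B. \<forall>u\<in>{t..s}. norm (z u) \<le> B)"
        by (meson atLeastAtMost_iff le_less_trans)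
      then show ?thesis unfolding eventually_at_right_field using b(1) by blast
    qed
    show "\<forall>\<^sub>F s in at_left t. \<exists>B. \<forall>u\<in>{s..t}. norm (z u) \<le> B" if t: "0 < t"
    proof -
      obtain l where "(z \<longlongrightarrow> l) (at_left t)" using z t unfolding cadlag_def by blast
      from tendstoD[OF this, of 1] obtain b where b: "b < t" "\<And>s. b < s \<Longrightarrow> s < t \<Longrightarrow> dist (z s) l < 1"
        unfolding eventually_at_left_field by auto
      have "norm (z u) \<le> max (norm (z t)) (norm l + 1)" if "b < u" "u \<le> t" for u
        using b(2)[of u] that norm_triangle_sub[of "z u" l] by (cases "u = t") (auto simp: dist_norm)
      then have "\<forall>s. b < s \<and> s < t \<longrightarrow> (\<exists>B. \<forall>u\<in>{s..t}. norm (z u) \<le> B)"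
        by (meson atLeastAtMost_iff less_le_trans)
      then show ?thesis unfolding eventually_at_left_field using b(1) by blast
    qed
  qed
  then obtain B where "\<forall>s\<in>{0..T}. norm (z s) \<le> B" by blast
  then show ?thesis by (intro exI[of _ "max B 1"]) (auto simp: le_max_iff_disj)
qed

section \<open>The clock and the time change\<close>

text \<open>Comparison of the integrand with constants on the interval between \<open>s\<close>
  and \<open>t\<close>.\<close>

lemma clock_increment:
  assumes z: "cadlag z" and st: "0 \<le> s" "s \<le> t"
    and m: "\<And>r. s < r \<Longrightarrow> r \<le> t \<Longrightarrow> m \<le> norm (z r) powr - \<alpha>" "0 \<le> m"
    and K: "\<And>r. s < r \<Longrightarrow> r \<le> t \<Longrightarrow> norm (z r) powr - \<alpha> \<le> K" "0 \<le> K"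
  shows "clock \<alpha> z s + ennreal (m * (t - s)) \<le> clock \<alpha> z t"
    and "clock \<alpha> z t \<le> clock \<alpha> z s + ennreal (K * (t - s))"
proof -
  define h where "h r = ennreal (norm (z (max 0 r)) powr - \<alpha>)" for r
  have [measurable]: "(\<lambda>r. z (max 0 r)) \<in> borel_measurable borel" by (rule cadlag_measurable[OF z])
  have [measurable]: "h \<in> borel_measurable borel" unfolding h_def by measurable
  have c: "clock \<alpha> z u = (\<integral>\<^sup>+r. h r * indicator {0..u} r \<partial>lborel)" for u
    unfolding clock_def h_def by (intro nn_integral_cong) (auto split: split_indicator)
  have split: "clock \<alpha> z t = clock \<alpha> z s + (\<integral>\<^sup>+r. h r * indicator {s<..t} r \<partial>lborel)"
    unfolding c using st by (subst nn_integral_add[symmetric]) (auto intro!: nn_integral_cong split: split_indicator)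
  have "ennreal (m * (t - s)) = (\<integral>\<^sup>+r. ennreal m * indicator {s<..t} r \<partial>lborel)"
    using st m(2) by (subst nn_integral_cmult_indicator) (auto simp: ennreal_mult)
  also have "\<dots> \<le> (\<integral>\<^sup>+r. h r * indicator {s<..t} r \<partial>lborel)"
    using st m by (intro nn_integral_mono) (auto simp: h_def max_def split: split_indicator intro!: ennreal_leI)
  finally show "clock \<alpha> z s + ennreal (m * (t - s)) \<le> clock \<alpha> z t"
    unfolding split by (rule add_left_mono)
  have "(\<integral>\<^sup>+r. h r * indicator {s<..t} r \<partial>lborel) \<le> (\<integral>\<^sup>+r. ennreal K * indicator {s<..t} r \<partial>lborel)"
    using st K by (intro nn_integral_mono) (auto simp: h_def max_def split: split_indicator intro!: ennreal_leI)
  also have "\<dots> = ennreal (K * (t - s))"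
    using st K(2) by (subst nn_integral_cmult_indicator) (auto simp: ennreal_mult)
  finally show "clock \<alpha> z t \<le> clock \<alpha> z s + ennreal (K * (t - s))"
    unfolding split by (rule add_left_mono)
qed

lemma clock_0: "clock \<alpha> z 0 = 0"
proof -
  have "(\<integral>\<^sup>+r. ennreal (norm (z r) powr - \<alpha>) * indicator {0..0} r \<partial>lborel)
      = (\<integral>\<^sup>+(r::real). ennreal (norm (z 0) powr - \<alpha>) * indicator {0..0} r \<partial>lborel)"
    by (intro nn_integral_cong) (auto split: split_indicator)
  also have "\<dots> = 0" by (subst nn_integral_cmult_indicator) auto
  finally show ?thesis by (simp add: clock_def)
qed

text \<open>The paths for which the time-changed winding is defined for all times.\<close>

definition good_path :: "real \<Rightarrow> (real \<Rightarrow> complex) \<Rightarrow> bool" where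
  "good_path \<alpha> z \<longleftrightarrow> nonvanishing_path z \<and> (\<forall>u. \<exists>t\<ge>0. ennreal u < clock \<alpha> z t)"

definition real_clock :: "real \<Rightarrow> (real \<Rightarrow> complex) \<Rightarrow> real \<Rightarrow> real" where
  "real_clock \<alpha> z t = enn2real (clock \<alpha> z t)"

lemma nonvanishing_path_clock_bounds:
  assumes z: "nonvanishing_path z" and \<alpha>: "0 < \<alpha>" and T: "0 \<le> T"
  obtains m K where "0 < m" "0 < K"
    "\<And>s t. 0 \<le> s \<Longrightarrow> s \<le> t \<Longrightarrow> t \<le> T \<Longrightarrow>
       clock \<alpha> z s + ennreal (m * (t - s)) \<le> clock \<alpha> z t \<and> clock \<alpha> z t \<le> clock \<alpha> z s + ennreal (K * (t - s))"
proof -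
  have c: "cadlag z" using z by (simp add: nonvanishing_path_def)
  obtain d where d: "d > 0" "\<And>s. s \<in> {0..T} \<Longrightarrow> d \<le> norm (z s)" using z unfolding nonvanishing_path_def by blast
  obtain B where B: "B > 0" "\<And>s. s \<in> {0..T} \<Longrightarrow> norm (z s) \<le> B" using cadlag_bounded[OF c T] by blast
  have b: "B powr - \<alpha> \<le> norm (z r) powr - \<alpha>" "norm (z r) powr - \<alpha> \<le> d powr - \<alpha>" if "r \<in> {0..T}" for r
    using d(2)[OF that] B(2)[OF that] d(1) \<alpha> by (auto intro!: powr_mono2')
  show ?thesis
  proof (rule that[of "B powr - \<alpha>" "d powr - \<alpha>"])
    fix s t assume st: "0 \<le> s" "s \<le> t" "t \<le> T"
    then show "clock \<alpha> z s + ennreal (B powr - \<alpha> * (t - s)) \<le> clock \<alpha> z t \<and> clock \<alpha> z t \<le> clock \<alpha> z s + ennreal (d powr - \<alpha> * (t - s))"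
      using clock_increment[OF c st(1,2), of "B powr - \<alpha>" \<alpha> "d powr - \<alpha>"] b by auto
  qed (use B d in auto)
qed

lemma clock_real:
  assumes z: "nonvanishing_path z" and \<alpha>: "0 < \<alpha>" and t: "0 \<le> t"
  shows "clock \<alpha> z t = ennreal (real_clock \<alpha> z t)" "0 \<le> real_clock \<alpha> z t"
proof -
  obtain m K where "clock \<alpha> z t \<le> clock \<alpha> z 0 + ennreal (K * (t - 0))"
    using nonvanishing_path_clock_bounds[OF z \<alpha> t] t by (metis order_refl)
  then have "clock \<alpha> z t < \<top>" using clock_0 by (simp add: le_less_trans)
  then show "clock \<alpha> z t = ennreal (real_clock \<alpha> z t)" by (simp add: real_clock_def)
qed (simp add: real_clock_def)

text \<open>The clock is bi-Lipschitz on compact intervals, since the path is bounded and bounded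
  away from 0 there. Strict monotonicity and continuity follow.\<close>

lemma real_clock_bounds:
  assumes z: "nonvanishing_path z" and \<alpha>: "0 < \<alpha>" and T: "0 \<le> T"
  obtains m K where "0 < m" "0 < K"
    "\<And>s t. 0 \<le> s \<Longrightarrow> s \<le> t \<Longrightarrow> t \<le> T \<Longrightarrow>
       m * (t - s) \<le> real_clock \<alpha> z t - real_clock \<alpha> z s \<and> real_clock \<alpha> z t - real_clock \<alpha> z s \<le> K * (t - s)"
proof -
  obtain m K where mK: "0 < m" "0 < K"
    "\<And>s t. 0 \<le> s \<Longrightarrow> s \<le> t \<Longrightarrow> t \<le> T \<Longrightarrow>
       clock \<alpha> z s + ennreal (m * (t - s)) \<le> clock \<alpha> z t \<and> clock \<alpha> z t \<le> clock \<alpha> z s + ennreal (K * (t - s))"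
    using nonvanishing_path_clock_bounds[OF z \<alpha> T] by metis
  show ?thesis
  proof (rule that[OF mK(1,2)])
    fix s t assume st: "0 \<le> s" "s \<le> t" "t \<le> T"
    have t0: "0 \<le> t" using st by simp
    note h = clock_real[OF z \<alpha> st(1)] clock_real[OF z \<alpha> t0]
    have p: "0 \<le> m * (t - s)" "0 \<le> K * (t - s)" using mK st by auto
    show "m * (t - s) \<le> real_clock \<alpha> z t - real_clock \<alpha> z s \<and> real_clock \<alpha> z t - real_clock \<alpha> z s \<le> K * (t - s)"
      using mK(3)[OF st] h p by (auto simp: ennreal_plus[symmetric] simp del: ennreal_plus)
  qed
qed

lemma real_clock_strict_mono:
  assumes z: "nonvanishing_path z" and \<alpha>: "0 < \<alpha>" and st: "0 \<le> s" "s < t"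
  shows "real_clock \<alpha> z s < real_clock \<alpha> z t"
proof -
  have "0 \<le> t" using st by simp
  from real_clock_bounds[OF z \<alpha> this] obtain m K where "0 < m"
    "m * (t - s) \<le> real_clock \<alpha> z t - real_clock \<alpha> z s" using st by (metis less_imp_le order_refl)
  moreover have "0 < m * (t - s)" using \<open>0 < m\<close> st by simp
  ultimately show ?thesis by linarith
qed

lemma real_clock_continuous:
  assumes z: "nonvanishing_path z" and \<alpha>: "0 < \<alpha>" and T: "0 \<le> T"
  shows "continuous_on {0..T} (real_clock \<alpha> z)"
proof -
  obtain m K where mK: "0 < m" "0 < K"
    "\<And>s t. 0 \<le> s \<Longrightarrow> s \<le> t \<Longrightarrow> t \<le> T \<Longrightarrow>
       m * (t - s) \<le> real_clock \<alpha> z t - real_clock \<alpha> z s \<and> real_clock \<alpha> z t - real_clock \<alpha> z s \<le> K * (t - s)"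
    using real_clock_bounds[OF z \<alpha> T] by metis
  have "\<bar>real_clock \<alpha> z t - real_clock \<alpha> z s\<bar> \<le> K * \<bar>t - s\<bar>" if "s \<in> {0..T}" "t \<in> {0..T}" for s t
  proof (cases "s \<le> t")
    case True
    moreover have "0 \<le> m * (t - s)" using mK True by simp
    ultimately show ?thesis using mK(3)[of s t] that by auto
  next
    case False
    moreover have "0 \<le> m * (s - t)" using mK False by simp
    ultimately show ?thesis using mK(3)[of t s] that by auto
  qed
  then have "K-lipschitz_on {0..T} (real_clock \<alpha> z)"
    using mK(2) by (auto simp: lipschitz_on_def dist_real_def abs_minus_commute)
  then show ?thesis by (rule lipschitz_on_continuous_on)
qed

lemma real_clock_0: "real_clock \<alpha> z 0 = 0"
  by (simp add: real_clock_def clock_0)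

lemma real_clock_surj:
  assumes z: "good_path \<alpha> z" and \<alpha>: "0 < \<alpha>" and u: "0 \<le> u"
  shows "\<exists>t\<ge>0. real_clock \<alpha> z t = u"
proof -
  have n: "nonvanishing_path z" using z by (simp add: good_path_def)
  obtain T where T: "0 \<le> T" "ennreal u < clock \<alpha> z T" using z unfolding good_path_def by blast
  then have "u \<le> real_clock \<alpha> z T" using clock_real[OF n \<alpha> T(1)] u by (simp add: ennreal_less_iff)
  then show ?thesis
    using IVT'[of "real_clock \<alpha> z" 0 u T] real_clock_0 u T(1) real_clock_continuous[OF n \<alpha> T(1)] by auto
qed

lemma inverse_clock_real_clock:
  assumes z: "nonvanishing_path z" and \<alpha>: "0 < \<alpha>" and t: "0 \<le> t"
  shows "inverse_clock \<alpha> z (real_clock \<alpha> z t) = t"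
proof -
  have "{s. 0 \<le> s \<and> ennreal (real_clock \<alpha> z t) < clock \<alpha> z s} = {t<..}"
  proof (intro equalityI subsetI)
    fix s assume "s \<in> {s. 0 \<le> s \<and> ennreal (real_clock \<alpha> z t) < clock \<alpha> z s}"
    then have s: "0 \<le> s" "real_clock \<alpha> z t < real_clock \<alpha> z s"
      using clock_real[OF z \<alpha>, of s] clock_real[OF z \<alpha> t] by (auto simp: ennreal_less_iff)
    then show "s \<in> {t<..}" using real_clock_strict_mono[OF z \<alpha> s(1), of t] by (cases s t rule: linorder_cases) auto
  next
    fix s assume "s \<in> {t<..}"
    then show "s \<in> {s. 0 \<le> s \<and> ennreal (real_clock \<alpha> z t) < clock \<alpha> z s}"
      using real_clock_strict_mono[OF z \<alpha> t, of s] clock_real[OF z \<alpha>, of s] clock_real[OF z \<alpha> t] t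
      by (auto simp: ennreal_less_iff)
  qed
  then show ?thesis unfolding inverse_clock_def by simp
qed

text \<open>On a good path the clock is an increasing bijection of \<open>[0,
  \<infinity>)\<close>, hence so is its inverse.\<close>

lemma inverse_clock_time_change:
  assumes z: "good_path \<alpha> z" and \<alpha>: "0 < \<alpha>"
  shows "inverse_clock \<alpha> z \<in> time_changes"
    and "0 \<le> u \<Longrightarrow> real_clock \<alpha> z (inverse_clock \<alpha> z u) = u"
    and "0 \<le> u \<Longrightarrow> 0 \<le> inverse_clock \<alpha> z u"
proof -
  have n: "nonvanishing_path z" using z by (simp add: good_path_def)
  have *: "0 \<le> inverse_clock \<alpha> z u \<and> real_clock \<alpha> z (inverse_clock \<alpha> z u) = u" if u: "0 \<le> u" for u
    using real_clock_surj[OF z \<alpha> u] inverse_clock_real_clock[OF n \<alpha>] by auto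
  then show "0 \<le> u \<Longrightarrow> real_clock \<alpha> z (inverse_clock \<alpha> z u) = u" "0 \<le> u \<Longrightarrow> 0 \<le> inverse_clock \<alpha> z u" by auto
  have "strict_mono_on {0..} (inverse_clock \<alpha> z)"
  proof (rule strict_mono_onI, rule ccontr)
    fix u v :: real assume uv: "u \<in> {0..}" "v \<in> {0..}" "u < v" "\<not> inverse_clock \<alpha> z u < inverse_clock \<alpha> z v"
    then have "inverse_clock \<alpha> z v \<le> inverse_clock \<alpha> z u" by simp
    then have "real_clock \<alpha> z (inverse_clock \<alpha> z v) \<le> real_clock \<alpha> z (inverse_clock \<alpha> z u)"
      using real_clock_strict_mono[OF n \<alpha>, of "inverse_clock \<alpha> z v" "inverse_clock \<alpha> z u"] *[of v] uv
      by (cases "inverse_clock \<alpha> z v = inverse_clock \<alpha> z u") auto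
    then show False using *[of u] *[of v] uv by auto
  qed
  moreover have "inverse_clock \<alpha> z ` {0..} = {0..}"
  proof (intro equalityI subsetI)
    fix t :: real assume "t \<in> {0..}"
    then have "t = inverse_clock \<alpha> z (real_clock \<alpha> z t)" "real_clock \<alpha> z t \<in> {0..}"
      using inverse_clock_real_clock[OF n \<alpha>, of t] clock_real[OF n \<alpha>, of t] by auto
    then show "t \<in> inverse_clock \<alpha> z ` {0..}" by (rule image_eqI)
  qed (use * in auto)
  ultimately show "inverse_clock \<alpha> z \<in> time_changes" by (simp add: time_changes_def)
qed

lemma time_changed_winding_eq:
  assumes z: "good_path \<alpha> (\<lambda>s. Z s \<omega>)" and \<alpha>: "0 < \<alpha>" and u: "0 \<le> u"
  shows "time_changed_winding \<alpha> Z u \<omega> = winding_angle (\<lambda>s. Z s \<omega>) (inverse_clock \<alpha> (\<lambda>s. Z s \<omega>) u)"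
  unfolding time_changed_winding_def
  using z inverse_clock_time_change(3)[OF z \<alpha> u] by (simp add: winding_eq good_path_def)

lemma scale_time_change: "0 < t \<Longrightarrow> (\<lambda>s. t * s) \<in> time_changes"
proof -
  assume t: "0 < t"
  have "s \<in> (\<lambda>s. t * s) ` {0..}" if "0 \<le> s" for s
    using t that by (intro image_eqI[of _ _ "s / t"]) auto
  then show ?thesis using t by (auto simp: time_changes_def strict_mono_on_def)
qed

lemma cadlag_scaled_time_changed_winding:
  assumes z: "good_path \<alpha> (\<lambda>s. Z s \<omega>)" and \<alpha>: "0 < \<alpha>" and t: "0 < t"
  shows "cadlag (\<lambda>s. c * time_changed_winding \<alpha> Z (t * s) \<omega>)"
proof -
  let ?z = "\<lambda>s. Z s \<omega>"
  have "nonvanishing_path ?z" using z by (simp add: good_path_def)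
  from cadlag_time_change[OF cadlag_angle[OF this]
        time_changes_comp[OF scale_time_change[OF t] inverse_clock_time_change(1)[OF z \<alpha>]]]
  have "cadlag (\<lambda>s. c * winding_angle ?z (inverse_clock \<alpha> ?z (t * s)))"
    by (rule cadlag_continuous_image) (intro continuous_intros)
  then show ?thesis by (rule cadlag_cong[rotated]) (use time_changed_winding_eq[where Z = Z and \<omega> = \<omega>, OF z \<alpha>] t in simp)
qed

lemma Arg_measurable[measurable]: "Arg \<in> borel_measurable borel"
proof -
  have "Arg = (\<lambda>z. indicator (- \<real>\<^sub>\<le>\<^sub>0) z *\<^sub>R Arg z + (if Re z < 0 \<and> Im z = 0 then pi else 0))"
  proof
    fix z :: complex
    show "Arg z = indicator (- \<real>\<^sub>\<le>\<^sub>0) z *\<^sub>R Arg z + (if Re z < 0 \<and> Im z = 0 then pi else 0)"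
    proof (cases "z = 0")
      case True then show ?thesis by (simp add: Arg_zero)
    next
      case False
      then show ?thesis using Arg_eq_pi[of z] by (auto simp: indicator_def complex_nonpos_Reals_iff complex_eq_iff)
    qed
  qed
  moreover have "(\<lambda>z. indicator (- \<real>\<^sub>\<le>\<^sub>0) z *\<^sub>R Arg z) \<in> borel_measurable borel"
    by (rule borel_measurable_continuous_on_indicator) (auto intro: continuous_on_Arg borel_open)
  then have "(\<lambda>z. indicator (- \<real>\<^sub>\<le>\<^sub>0) z *\<^sub>R Arg z + (if Re z < 0 \<and> Im z = 0 then pi else 0)) \<in> borel_measurable borel"
    by measurable
  ultimately show ?thesis by simp
qed

lemma clock_measurable:
  assumes X: "\<And>s. 0 \<le> s \<Longrightarrow> X s \<in> borel_measurable M"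
    and rc: "\<And>\<omega> t. \<omega> \<in> space M \<Longrightarrow> 0 \<le> t \<Longrightarrow> ((\<lambda>s. X s \<omega>) \<longlongrightarrow> X t \<omega>) (at_right t)"
  shows "(\<lambda>\<omega>. clock \<alpha> (\<lambda>s. X s \<omega>) t) \<in> borel_measurable M"
proof -
  have [measurable]: "(\<lambda>(\<omega>, s). X (max 0 s) \<omega>) \<in> borel_measurable (M \<Otimes>\<^sub>M borel)"
    by (rule right_continuous_jointly_measurable) (use X rc in auto)
  have 1: "(\<lambda>\<omega>. \<integral>\<^sup>+r. ennreal (norm (case (\<omega>, r) of (\<omega>, s) \<Rightarrow> X (max 0 s) \<omega>) powr - \<alpha>) * indicator {0..t} r \<partial>lborel) \<in> borel_measurable M"
    by measurable
  have 2: "(\<lambda>\<omega>. \<integral>\<^sup>+r. ennreal (norm (case (\<omega>, r) of (\<omega>, s) \<Rightarrow> X (max 0 s) \<omega>) powr - \<alpha>) * indicator {0..t} r \<partial>lborel)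
     = (\<lambda>\<omega>. clock \<alpha> (\<lambda>s. X s \<omega>) t)"
    unfolding clock_def by (intro ext nn_integral_cong) (auto split: split_indicator)
  from 1 show ?thesis unfolding 2 .
qed

text \<open>The winding at a fixed time is a limit of grid sums; by right continuity it may be
  evaluated at the random time \<open>inverse_clock\<close>, which is measurable because
  \<open>a\<close> lies before it exactly if the clock at \<open>a\<close> is less than
  \<open>u\<close>.\<close>

lemma time_changed_winding_measurable:
  assumes X[measurable]: "\<And>s. 0 \<le> s \<Longrightarrow> X s \<in> borel_measurable M"
    and good: "\<And>\<omega>. \<omega> \<in> space M \<Longrightarrow> good_path \<alpha> (\<lambda>s. X s \<omega>)" and \<alpha>: "0 < \<alpha>" and u: "0 \<le> u"
  shows "time_changed_winding \<alpha> X u \<in> borel_measurable M"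
proof -
  have nv: "nonvanishing_path (\<lambda>s. X s \<omega>)" if "\<omega> \<in> space M" for \<omega> using good[OF that] by (simp add: good_path_def)
  have cad: "cadlag (\<lambda>s. X s \<omega>)" if "\<omega> \<in> space M" for \<omega> using nv[OF that] by (simp add: nonvanishing_path_def)
  have clock: "(\<lambda>\<omega>. clock \<alpha> (\<lambda>s. X s \<omega>) t) \<in> borel_measurable M" for t
    by (rule clock_measurable) (use X cad in \<open>auto simp: cadlag_def\<close>)
  have inv[measurable]: "(\<lambda>\<omega>. inverse_clock \<alpha> (\<lambda>s. X s \<omega>) u) \<in> borel_measurable M"
    unfolding borel_measurable_iff_greater
  proof
    fix a :: real
    show "{\<omega> \<in> space M. a < inverse_clock \<alpha> (\<lambda>s. X s \<omega>) u} \<in> sets M"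
    proof (cases "0 \<le> a")
      case False
      have "{\<omega> \<in> space M. a < inverse_clock \<alpha> (\<lambda>s. X s \<omega>) u} = space M"
        using inverse_clock_time_change(3)[OF good \<alpha> u] False by force
      then show ?thesis by simp
    next
      case a: True
      have "a < inverse_clock \<alpha> (\<lambda>s. X s \<omega>) u \<longleftrightarrow> clock \<alpha> (\<lambda>s. X s \<omega>) a < ennreal u" if w: "\<omega> \<in> space M" for \<omega>
      proof -
        let ?A = "inverse_clock \<alpha> (\<lambda>s. X s \<omega>) u" and ?h = "real_clock \<alpha> (\<lambda>s. X s \<omega>)"
        have A: "0 \<le> ?A" "?h ?A = u" using inverse_clock_time_change(2,3)[OF good[OF w] \<alpha> u] by auto
        have "a < ?A \<longleftrightarrow> ?h a < ?h ?A"
          using real_clock_strict_mono[OF nv[OF w] \<alpha> a, of ?A] real_clock_strict_mono[OF nv[OF w] \<alpha> A(1), of a]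
          by (cases a ?A rule: linorder_cases) auto
        then show ?thesis using A(2) clock_real[OF nv[OF w] \<alpha> a] by (simp add: ennreal_less_iff)
      qed
      then have "{\<omega> \<in> space M. a < inverse_clock \<alpha> (\<lambda>s. X s \<omega>) u} = {\<omega> \<in> space M. clock \<alpha> (\<lambda>s. X s \<omega>) a < ennreal u}" by blast
      also have "\<dots> \<in> sets M" using clock[of a] by measurable
      finally show ?thesis .
    qed
  qed
  have W: "(\<lambda>\<omega>. winding_angle (\<lambda>s. X s \<omega>) t) \<in> borel_measurable M" if t: "0 \<le> t" for t
    unfolding winding_angle_def
  proof (rule borel_measurable_lim_metric)
    fix n
    have [measurable]: "X (t * real k / real n) \<in> borel_measurable M" for k by (rule X) (use t in auto)
    show "(\<lambda>\<omega>. winding_sum (\<lambda>s. X s \<omega>) t n) \<in> borel_measurable M"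
      unfolding winding_sum_def by measurable
  qed
  have J: "(\<lambda>(\<omega>, s). winding_angle (\<lambda>s. X s \<omega>) (max 0 s)) \<in> borel_measurable (M \<Otimes>\<^sub>M borel)"
    by (rule right_continuous_jointly_measurable[where X = "\<lambda>t \<omega>. winding_angle (\<lambda>s. X s \<omega>) t"])
      (use W cadlag_winding_angle(1)[OF nv] in auto)
  have "(\<lambda>\<omega>. winding_angle (\<lambda>s. X s \<omega>) (max 0 (inverse_clock \<alpha> (\<lambda>s. X s \<omega>) u))) \<in> borel_measurable M"
    using measurable_compose[OF measurable_Pair[OF measurable_ident inv] J] by (simp add: id_def)
  moreover have "winding_angle (\<lambda>s. X s \<omega>) (max 0 (inverse_clock \<alpha> (\<lambda>s. X s \<omega>) u)) = time_changed_winding \<alpha> X u \<omega>"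
    if w: "\<omega> \<in> space M" for \<omega>
    using time_changed_winding_eq[where Z = X and \<omega> = \<omega>, OF good[OF w] \<alpha> u] inverse_clock_time_change(3)[OF good[OF w] \<alpha> u] by simp
  ultimately show ?thesis by (subst measurable_cong[symmetric]) auto
qed

section \<open>Planar stable processes avoid the origin\<close>

context isotropic_stable_process
begin

text \<open>The values at times up to \<open>u i\<close> are functions of the increments along
  \<open>0, u 0, \<dots>, u i\<close>, and the increment up to \<open>v\<close> is the next one in
  the sequence.\<close>

lemma past_future_independent:
  fixes u :: "nat \<Rightarrow> real"
  assumes u: "mono u" "0 \<le> u 0" and v: "u i \<le> v"
  shows "indep_var (PiM {..i} (\<lambda>_. borel)) (\<lambda>\<omega>. \<lambda>j\<in>{..i}. Z (u j) \<omega> - Z 0 \<omega>)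
           (PiM {Suc i} (\<lambda>_. borel)) (\<lambda>\<omega>. \<lambda>j\<in>{Suc i}. Z v \<omega> - Z (u i) \<omega>)"
proof -
  \<comment> \<open>the times \<open>0, u 0, \<dots>, u i, v, v, \<dots>\<close>\<close>
  define \<tau> where "\<tau> j = (case j of 0 \<Rightarrow> 0 | Suc k \<Rightarrow> if k \<le> i then u k else v)" for j
  have "mono \<tau>"
  proof (rule mono_iff_le_Suc[THEN iffD2], rule allI)
    fix j
    have "0 \<le> u i" using monoD[OF u(1), of 0 i] u(2) by simp
    then show "\<tau> j \<le> \<tau> (Suc j)"
      using u(2) v monoD[OF u(1), of "j - 1" j] monoD[OF u(1), of "j - 1" i]
      by (auto simp: \<tau>_def split: nat.split)
  qed
  moreover have "0 \<le> \<tau> 0" by (simp add: \<tau>_def)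
  ultimately have "indep_vars (\<lambda>_. borel) (\<lambda>j \<omega>. Z (\<tau> (Suc j)) \<omega> - Z (\<tau> j) \<omega>) {..<i + 2}"
    by (rule independent_increments)
  then have "indep_var (PiM {..i} (\<lambda>_. borel)) (\<lambda>\<omega>. \<lambda>j\<in>{..i}. Z (\<tau> (Suc j)) \<omega> - Z (\<tau> j) \<omega>)
      (PiM {Suc i} (\<lambda>_. borel)) (\<lambda>\<omega>. \<lambda>j\<in>{Suc i}. Z (\<tau> (Suc j)) \<omega> - Z (\<tau> j) \<omega>)"
    by (rule indep_var_restrict) auto
  then have "indep_var (PiM {..i} (\<lambda>_. borel)) ((\<lambda>x. \<lambda>j\<in>{..i}. \<Sum>k<Suc j. x k) \<circ> (\<lambda>\<omega>. \<lambda>j\<in>{..i}. Z (\<tau> (Suc j)) \<omega> - Z (\<tau> j) \<omega>))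
      (PiM {Suc i} (\<lambda>_. borel)) ((\<lambda>x. \<lambda>j\<in>{Suc i}. x (Suc i)) \<circ> (\<lambda>\<omega>. \<lambda>j\<in>{Suc i}. Z (\<tau> (Suc j)) \<omega> - Z (\<tau> j) \<omega>))"
  proof (rule indep_var_compose)
    show "(\<lambda>x. \<lambda>j\<in>{..i}. \<Sum>k<Suc j. x k) \<in> PiM {..i} (\<lambda>_. borel :: 'a measure) \<rightarrow>\<^sub>M PiM {..i} (\<lambda>_. borel)"
    proof (rule measurable_restrict)
      fix j assume j: "j \<in> {..i}"
      show "(\<lambda>x. \<Sum>k<Suc j. x k) \<in> borel_measurable (PiM {..i} (\<lambda>_. borel :: 'a measure))"
        by (rule borel_measurable_sum[where f = "\<lambda>k x. x k"], rule measurable_component_singleton) (use j in auto)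
    qed
    show "(\<lambda>x. \<lambda>j\<in>{Suc i}. x (Suc i)) \<in> PiM {Suc i} (\<lambda>_. borel :: 'a measure) \<rightarrow>\<^sub>M PiM {Suc i} (\<lambda>_. borel)"
      by (intro measurable_restrict measurable_component_singleton) auto
  qed
  moreover have "(\<lambda>x. \<lambda>j\<in>{..i}. \<Sum>k<Suc j. x k) \<circ> (\<lambda>\<omega>. \<lambda>j\<in>{..i}. Z (\<tau> (Suc j)) \<omega> - Z (\<tau> j) \<omega>)
      = (\<lambda>\<omega>. \<lambda>j\<in>{..i}. Z (u j) \<omega> - Z 0 \<omega>)"
  proof (rule ext, unfold comp_def, rule restrict_ext)
    fix \<omega> j assume j: "j \<in> {..i}"
    have "(\<Sum>k<Suc j. (\<lambda>j\<in>{..i}. Z (\<tau> (Suc j)) \<omega> - Z (\<tau> j) \<omega>) k) = (\<Sum>k<Suc j. Z (\<tau> (Suc k)) \<omega> - Z (\<tau> k) \<omega>)"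
      by (intro sum.cong) (use j in auto)
    also have "\<dots> = Z (\<tau> (Suc j)) \<omega> - Z (\<tau> 0) \<omega>" by (rule sum_lessThan_telescope)
    finally show "(\<Sum>k<Suc j. (\<lambda>j\<in>{..i}. Z (\<tau> (Suc j)) \<omega> - Z (\<tau> j) \<omega>) k) = Z (u j) \<omega> - Z 0 \<omega>"
      using j by (simp add: \<tau>_def)
  qed
  moreover have "(\<lambda>x. \<lambda>j\<in>{Suc i}. x (Suc i)) \<circ> (\<lambda>\<omega>. \<lambda>j\<in>{Suc i}. Z (\<tau> (Suc j)) \<omega> - Z (\<tau> j) \<omega>)
      = (\<lambda>\<omega>. \<lambda>j\<in>{Suc i}. Z v \<omega> - Z (u i) \<omega>)"
    by (auto simp: \<tau>_def)
  ultimately show ?thesis by simp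
qed

lemma increment_characteristic_function:
  assumes "0 \<le> s" "s \<le> t"
  shows "(\<integral>\<omega>. exp (\<i> * complex_of_real (\<xi> \<bullet> (Z t \<omega> - Z s \<omega>))) \<partial>M)
     = complex_of_real (exp (- (c * (t - s) * norm \<xi> powr \<alpha>)))"
proof -
  have [measurable]: "Z s \<in> borel_measurable M" "Z t \<in> borel_measurable M" "Z (t - s) \<in> borel_measurable M" "Z 0 \<in> borel_measurable M"
    using assms by (auto intro: random_variable)
  have "(\<integral>\<omega>. exp (\<i> * complex_of_real (\<xi> \<bullet> (Z t \<omega> - Z s \<omega>))) \<partial>M)
      = (\<integral>x. exp (\<i> * complex_of_real (\<xi> \<bullet> x)) \<partial>distr M borel (\<lambda>\<omega>. Z (s + (t - s)) \<omega> - Z s \<omega>))"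
    by (subst integral_distr) auto
  also have "\<dots> = (\<integral>x. exp (\<i> * complex_of_real (\<xi> \<bullet> x)) \<partial>distr M borel (\<lambda>\<omega>. Z (t - s) \<omega> - Z 0 \<omega>))"
    using stationary_increments[of s "t - s"] assms by simp
  also have "\<dots> = (\<integral>\<omega>. exp (\<i> * complex_of_real (\<xi> \<bullet> (Z (t - s) \<omega> - Z 0 \<omega>))) \<partial>M)"
    by (subst integral_distr) auto
  finally show ?thesis using characteristic_function[of "t - s" \<xi>] assms by simp
qed

end

locale planar_stable_process = isotropic_stable_process M \<alpha> 1 1 Z
  for M :: "'w measure" and \<alpha> :: real and Z :: "real \<Rightarrow> 'w \<Rightarrow> complex" +
  assumes \<alpha>: "0 < \<alpha>" "\<alpha> < 2"
begin

lemma increment_stable_vector: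
  assumes "0 \<le> s" "s \<le> t"
  shows "stable_vector M \<alpha> (t - s) (\<lambda>\<omega>. Z t \<omega> - Z s \<omega>)"
proof
  show "(\<lambda>\<omega>. Z t \<omega> - Z s \<omega>) \<in> borel_measurable M"
    using assms random_variable[of s] random_variable[of t] by auto
  show "(\<integral>\<omega>. iexp (\<xi> \<bullet> (Z t \<omega> - Z s \<omega>)) \<partial>M) = of_real (exp (- ((t - s) * norm \<xi> powr \<alpha>)))" for \<xi>
    using increment_characteristic_function[OF assms, of \<xi>] by simp
qed (use \<alpha> assms in auto)

text \<open>A version of \<open>Z\<close> that starts at 1 everywhere and is a function of
  increments, so that the independence of increments applies to it literally.\<close>

definition centred :: "real \<Rightarrow> 'w \<Rightarrow> complex" where
  "centred s \<omega> = 1 + (Z s \<omega> - Z 0 \<omega>)"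

lemma centred_measurable[measurable]: "0 \<le> s \<Longrightarrow> centred s \<in> borel_measurable M"
  unfolding centred_def using random_variable[of s] random_variable[of 0] by auto

lemma AE_centred: "AE \<omega> in M. \<forall>s. centred s \<omega> = Z s \<omega>"
  using start by eventually_elim (simp add: centred_def)

lemma increment_tail:
  assumes "0 \<le> s" "s \<le> t" "0 < r"
  shows "prob {\<omega> \<in> space M. r \<le> norm (Z t \<omega> - Z s \<omega>)} \<le> 9 * (t - s) / r powr \<alpha>"
proof -
  interpret stable_vector M \<alpha> "t - s" "\<lambda>\<omega>. Z t \<omega> - Z s \<omega>" by (rule increment_stable_vector[OF assms(1,2)])
  show ?thesis by (rule tail_bound[OF assms(3)])
qed

text \<open>Ottaviani's inequality: decompose according to the first \<open>i\<close> at which the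
  process is within \<open>r\<close> of the origin. The remaining increment is independent of this
  event and at most \<open>\<rho>\<close> with probability at least \<open>1/2\<close>, in which
  case the process is still within \<open>r + \<rho>\<close> at the end.\<close>

lemma maximal_inequality:
  fixes u :: "nat \<Rightarrow> real"
  assumes u: "mono u" "0 \<le> u 0" and r: "0 \<le> r"
    and half: "\<And>i. i \<le> n \<Longrightarrow> 1 / 2 \<le> prob {\<omega> \<in> space M. norm (Z (u n) \<omega> - Z (u i) \<omega>) \<le> \<rho>}"
  shows "prob {\<omega> \<in> space M. \<exists>i\<le>n. norm (centred (u i) \<omega>) \<le> r}
     \<le> 2 * prob {\<omega> \<in> space M. norm (centred (u n) \<omega>) \<le> r + \<rho>}"
proof -
  have u0: "0 \<le> u i" for i using order_trans[OF u(2) monoD[OF u(1) le0]] .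
  have [measurable]: "centred (u i) \<in> borel_measurable M" "Z (u i) \<in> borel_measurable M" for i
    using u0 by (auto intro: random_variable)
  \<comment> \<open>the first visit happens at step \<open>i\<close>\<close>
  define E where "E i = {\<omega> \<in> space M. norm (centred (u i) \<omega>) \<le> r \<and> (\<forall>j\<in>{..<i}. r < norm (centred (u j) \<omega>))}" for i
  define D where "D i = {\<omega> \<in> space M. norm (Z (u n) \<omega> - Z (u i) \<omega>) \<le> \<rho>}" for i
  have E[measurable]: "E i \<in> sets M" for i unfolding E_def by measurable
  have D[measurable]: "D i \<in> sets M" for i unfolding D_def by measurable
  have ind: "prob (E i \<inter> D i) = prob (E i) * prob (D i)" if "i \<le> n" for i
  proof -
    let ?P = "PiM {..i} (\<lambda>_. borel) :: (nat \<Rightarrow> complex) measure"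
    let ?X = "\<lambda>\<omega>. \<lambda>j\<in>{..i}. Z (u j) \<omega> - Z 0 \<omega>"
    define B where "B = {x \<in> space ?P. norm (1 + x i) \<le> r \<and> (\<forall>j\<in>{..<i}. r < norm (1 + x j))}"
    have [measurable]: "(\<lambda>x. x i) \<in> borel_measurable ?P"
      by (intro measurable_component_singleton) simp
    have "B = {x \<in> space ?P. norm (1 + x i) \<le> r} \<inter> {x \<in> space ?P. \<forall>j\<in>{..<i}. r < norm (1 + x j)}"
      unfolding B_def by auto
    moreover have "{x \<in> space ?P. \<forall>j\<in>{..<i}. r < norm (1 + x j)} \<in> sets ?P"
    proof (rule sets.sets_Collect_finite_All)
      fix j assume "j \<in> {..<i}"
      then have [measurable]: "(\<lambda>x. x j) \<in> borel_measurable ?P" by (intro measurable_component_singleton) simp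
      show "{x \<in> space ?P. r < norm (1 + x j)} \<in> sets ?P" by measurable
    qed simp
    moreover have "{x \<in> space ?P. norm (1 + x i) \<le> r} \<in> sets ?P" by measurable
    ultimately have B: "B \<in> sets ?P" by (simp only: sets.Int)
    let ?Q = "PiM {Suc i} (\<lambda>_. borel) :: (nat \<Rightarrow> complex) measure"
    let ?Y = "\<lambda>\<omega>. \<lambda>j\<in>{Suc i}. Z (u n) \<omega> - Z (u i) \<omega>"
    define C where "C = {x \<in> space ?Q. norm (x (Suc i)) \<le> \<rho>}"
    have [measurable]: "(\<lambda>x. x (Suc i)) \<in> borel_measurable ?Q"
      by (intro measurable_component_singleton) simp
    have C: "C \<in> sets ?Q" unfolding C_def by measurable
    have "indep_var ?P ?X ?Q ?Y"
      using past_future_independent[OF u] monoD[OF u(1) \<open>i \<le> n\<close>] by blast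
    from indep_varD[OF this B C]
    have "prob ((\<lambda>\<omega>. (?X \<omega>, ?Y \<omega>)) -` (B \<times> C) \<inter> space M)
        = prob (?X -` B \<inter> space M) * prob (?Y -` C \<inter> space M)" .
    moreover have "?X -` B \<inter> space M = E i"
      unfolding E_def B_def centred_def by (auto simp: space_PiM)
    moreover have "?Y -` C \<inter> space M = D i"
      unfolding D_def C_def by (auto simp: space_PiM)
    moreover have "(\<lambda>\<omega>. (?X \<omega>, ?Y \<omega>)) -` (B \<times> C) \<inter> space M = (?X -` B \<inter> space M) \<inter> (?Y -` C \<inter> space M)"
      by auto
    ultimately show ?thesis by simp
  qed
  have disj: "disjoint_family_on E {..n}"
  proof -
    have "E i \<inter> E j = {}" if "i < j" for i j
    proof (rule equals0I)
      fix \<omega> assume "\<omega> \<in> E i \<inter> E j"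
      then have "norm (centred (u i) \<omega>) \<le> r" "r < norm (centred (u i) \<omega>)"
        using that unfolding E_def by blast+
      then show False by simp
    qed
    then show ?thesis unfolding disjoint_family_on_def by (metis inf_commute linorder_neqE_nat)
  qed
  have "{\<omega> \<in> space M. \<exists>i\<le>n. norm (centred (u i) \<omega>) \<le> r} = (\<Union>i\<in>{..n}. E i)"
  proof (intro equalityI subsetI)
    fix \<omega> assume "\<omega> \<in> {\<omega> \<in> space M. \<exists>i\<le>n. norm (centred (u i) \<omega>) \<le> r}"
    then obtain i where i: "i \<le> n" "norm (centred (u i) \<omega>) \<le> r" "\<omega> \<in> space M" by auto
    define k where "k = (LEAST i. norm (centred (u i) \<omega>) \<le> r)"
    have "norm (centred (u k) \<omega>) \<le> r" "k \<le> i" unfolding k_def using i by (auto intro: LeastI Least_le)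
    moreover have "r < norm (centred (u j) \<omega>)" if "j < k" for j
      using not_less_Least[of j "\<lambda>i. norm (centred (u i) \<omega>) \<le> r"] that by (simp add: k_def not_le)
    ultimately show "\<omega> \<in> (\<Union>i\<in>{..n}. E i)" using i by (auto simp: E_def)
  qed (auto simp: E_def)
  also have "prob \<dots> = (\<Sum>i\<le>n. prob (E i))"
    by (rule finite_measure_finite_Union) (use disj in auto)
  also have "\<dots> \<le> (\<Sum>i\<le>n. 2 * prob (E i \<inter> D i))"
  proof (rule sum_mono)
    fix i assume i: "i \<in> {..n}"
    then have "prob (E i) * (1 / 2) \<le> prob (E i) * prob (D i)"
      using half[of i] unfolding D_def by (intro mult_left_mono) auto
    then show "prob (E i) \<le> 2 * prob (E i \<inter> D i)" using ind[of i] i by simp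
  qed
  also have "\<dots> = 2 * prob (\<Union>i\<in>{..n}. E i \<inter> D i)"
    using disj by (subst finite_measure_finite_Union)
      (auto simp: disjoint_family_on_def sum_distrib_left)
  also have "prob (\<Union>i\<in>{..n}. E i \<inter> D i) \<le> prob {\<omega> \<in> space M. norm (centred (u n) \<omega>) \<le> r + \<rho>}"
  proof (rule finite_measure_mono)
    show "(\<Union>i\<in>{..n}. E i \<inter> D i) \<subseteq> {\<omega> \<in> space M. norm (centred (u n) \<omega>) \<le> r + \<rho>}"
    proof
      fix \<omega> assume "\<omega> \<in> (\<Union>i\<in>{..n}. E i \<inter> D i)"
      then obtain i where i: "\<omega> \<in> E i" "\<omega> \<in> D i" by auto
      have "centred (u n) \<omega> = centred (u i) \<omega> + (Z (u n) \<omega> - Z (u i) \<omega>)" by (simp add: centred_def)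
      then have "norm (centred (u n) \<omega>) \<le> norm (centred (u i) \<omega>) + norm (Z (u n) \<omega> - Z (u i) \<omega>)"
        by (simp only: norm_triangle_ineq)
      then show "\<omega> \<in> {\<omega> \<in> space M. norm (centred (u n) \<omega>) \<le> r + \<rho>}" using i by (auto simp: E_def D_def)
    qed
  qed measurable
  finally show ?thesis by simp
qed

text \<open>The bound of \<open>small_ball_rate\<close> for the disc of radius \<open>K r\<close>.
  With this \<open>K\<close>, in a time of length \<open>r powr \<alpha>\<close> the process moves
  further than \<open>(K - 1) r\<close> with probability at most \<open>9 / 18\<close>, as the
  maximal inequality requires.\<close>

definition hitting_bound :: "real \<Rightarrow> real \<Rightarrow> real" where
  "hitting_bound s r = (let K = 1 + 18 powr (1 / \<alpha>) in
     2 * (((K * r) powr ((\<alpha> + 2) / 4))\<^sup>2 + exp (- (s * ((K * r) powr ((\<alpha> + 2) / 4) / (K * r)) powr \<alpha>))))"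

lemma hitting_bound_rate: "0 < s \<Longrightarrow> ((\<lambda>r. r powr - \<alpha> * hitting_bound s r) \<longlongrightarrow> 0) (at_right 0)"
  unfolding hitting_bound_def Let_def
  by (rule small_ball_rate) (use \<alpha> in \<open>auto intro: add_pos_nonneg\<close>)

lemma hitting_bound_nonneg: "0 \<le> hitting_bound s r"
  by (simp add: hitting_bound_def Let_def)

lemma block_hitting:
  assumes s: "0 < s" "s \<le> a" and r: "0 < r"
  shows "prob {\<omega> \<in> space M. \<exists>i\<le>n. norm (centred (a + r powr \<alpha> * (real i / n)) \<omega>) \<le> r} \<le> 2 * hitting_bound s r"
proof -
  define h where "h = r powr \<alpha>"
  define \<rho> where "\<rho> = 18 powr (1 / \<alpha>) * r"
  define u where "u i = a + h * (real (min i n) / n)" for i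
  have h: "0 < h" using r by (simp add: h_def)
  have \<rho>: "0 < \<rho>" "\<rho> powr \<alpha> = 18 * h" using r \<alpha> by (auto simp: \<rho>_def h_def powr_mult powr_powr)
  have u: "mono u" "0 \<le> u 0" using h s by (auto simp: u_def intro!: monoI divide_right_mono)
  have ua: "a \<le> u i" "u i \<le> a + h" for i
  proof -
    have "real (min i n) / n \<le> 1" by (cases "n = 0") auto
    then have "h * (real (min i n) / n) \<le> h * 1" using h by (intro mult_left_mono) auto
    then show "a \<le> u i" "u i \<le> a + h" using h by (auto simp: u_def)
  qed
  have m[measurable]: "Z (u i) \<in> borel_measurable M" "centred (u i) \<in> borel_measurable M" for i
    using ua(1)[of i] s by (auto intro: random_variable)
  have half: "1 / 2 \<le> prob {\<omega> \<in> space M. norm (Z (u n) \<omega> - Z (u i) \<omega>) \<le> \<rho>}" if i: "i \<le> n" for i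
  proof -
    have ui: "0 \<le> u i" "u i \<le> u n" using ua(1)[of i] s monoD[OF u(1) i] by auto
    have "prob {\<omega> \<in> space M. \<rho> \<le> norm (Z (u n) \<omega> - Z (u i) \<omega>)} \<le> 9 * (u n - u i) / \<rho> powr \<alpha>"
      by (rule increment_tail[OF ui \<rho>(1)])
    also have "\<dots> \<le> 9 * h / (18 * h)"
      unfolding \<rho>(2) using ua(1)[of i] ua(2)[of n] h by (intro divide_right_mono) auto
    also have "\<dots> = 1 / 2" using h by simp
    finally have "prob {\<omega> \<in> space M. \<rho> \<le> norm (Z (u n) \<omega> - Z (u i) \<omega>)} \<le> 1 / 2" .
    moreover have "1 \<le> prob {\<omega> \<in> space M. \<rho> \<le> norm (Z (u n) \<omega> - Z (u i) \<omega>)}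
        + prob {\<omega> \<in> space M. norm (Z (u n) \<omega> - Z (u i) \<omega>) \<le> \<rho>}"
    proof -
      have "prob (space M) \<le> prob ({\<omega> \<in> space M. \<rho> \<le> norm (Z (u n) \<omega> - Z (u i) \<omega>)}
         \<union> {\<omega> \<in> space M. norm (Z (u n) \<omega> - Z (u i) \<omega>) \<le> \<rho>})"
        by (intro finite_measure_mono) auto
      also have "\<dots> \<le> prob {\<omega> \<in> space M. \<rho> \<le> norm (Z (u n) \<omega> - Z (u i) \<omega>)}
        + prob {\<omega> \<in> space M. norm (Z (u n) \<omega> - Z (u i) \<omega>) \<le> \<rho>}"
        by (rule measure_Un_le) auto
      finally show ?thesis by (simp add: prob_space)
    qed
    ultimately show ?thesis by simp
  qed
  have "prob {\<omega> \<in> space M. \<exists>i\<le>n. norm (centred (a + r powr \<alpha> * (real i / n)) \<omega>) \<le> r}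
      = prob {\<omega> \<in> space M. \<exists>i\<le>n. norm (centred (u i) \<omega>) \<le> r}"
    by (intro arg_cong[where f = prob] Collect_cong) (auto simp: u_def h_def min_def)
  also have "\<dots> \<le> 2 * prob {\<omega> \<in> space M. norm (centred (u n) \<omega>) \<le> r + \<rho>}"
    by (rule maximal_inequality[OF u _ half]) (use r in auto)
  also have "prob {\<omega> \<in> space M. norm (centred (u n) \<omega>) \<le> r + \<rho>} \<le> hitting_bound s r"
  proof -
    define K where "K = 1 + 18 powr (1 / \<alpha>)"
    have K: "0 < K * r" "r + \<rho> = K * r" using r by (auto simp: K_def \<rho>_def algebra_simps intro!: mult_pos_pos add_pos_nonneg)
    define R where "R = (K * r) powr ((\<alpha> + 2) / 4)"
    have R: "0 < R" using less_imp_neq[OF K(1), symmetric] by (simp add: R_def)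
    have un: "0 \<le> u n" using ua(1)[of n] s by simp
    have sn: "s \<le> u n" using ua(1)[of n] s by simp
    interpret stable_vector M \<alpha> "u n - 0" "\<lambda>\<omega>. Z (u n) \<omega> - Z 0 \<omega>"
      by (rule increment_stable_vector) (use un in auto)
    have "prob {\<omega> \<in> space M. norm (centred (u n) \<omega>) \<le> r + \<rho>}
        = prob {\<omega> \<in> space M. norm ((Z (u n) \<omega> - Z 0 \<omega>) - (- 1)) \<le> K * r}"
      unfolding K(2) centred_def by (simp add: algebra_simps)
    also have "\<dots> \<le> 2 * (R\<^sup>2 + exp (- ((u n - 0) * (R / (K * r)) powr \<alpha>)))"
      by (rule small_ball_bound[OF K(1) R])
    also have "\<dots> \<le> 2 * (R\<^sup>2 + exp (- (s * (R / (K * r)) powr \<alpha>)))"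
      using sn by (simp add: mult_right_mono)
    finally show ?thesis by (simp add: hitting_bound_def Let_def K_def R_def)
  qed
  finally show ?thesis by simp
qed

text \<open>The process comes within \<open>r\<close> of the origin at a dyadic time of one of
  \<open>L\<close> consecutive blocks of length \<open>r powr \<alpha>\<close>, the time scale on
  which it moves a distance of order \<open>r\<close>.\<close>

definition near_zero :: "real \<Rightarrow> nat \<Rightarrow> real \<Rightarrow> nat \<Rightarrow> 'w set" where
  "near_zero s L r n = {\<omega> \<in> space M. \<exists>k<L. \<exists>i\<le>2 ^ n. 
      norm (centred (s + r powr \<alpha> * real k + r powr \<alpha> * (real i / real (2 ^ n))) \<omega>) \<le> r}"

lemma near_zero_measurable[measurable]: "0 \<le> s \<Longrightarrow> near_zero s L r n \<in> sets M"
proof -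
  assume s: "0 \<le> s"
  have [measurable]: "centred (s + r powr \<alpha> * real k + r powr \<alpha> * (real i / real (2 ^ n))) \<in> borel_measurable M" for k i
    by (rule centred_measurable) (use s in simp)
  show ?thesis unfolding near_zero_def by measurable
qed

lemma near_zero_prob:
  assumes s: "0 < s" and r: "0 < r"
  shows "prob (\<Union>n. near_zero s L r n) \<le> real L * (2 * hitting_bound s r)"
proof -
  have "incseq (near_zero s L r)"
  proof (rule incseq_SucI, rule subsetI)
    fix n \<omega> assume "\<omega> \<in> near_zero s L r n"
    then obtain k i where ki: "\<omega> \<in> space M" "k < L" "i \<le> 2 ^ n"
      "norm (centred (s + r powr \<alpha> * real k + r powr \<alpha> * (real i / real (2 ^ n))) \<omega>) \<le> r"
      unfolding near_zero_def by blast
    have "real i / real (2 ^ n) = real (2 * i) / real (2 ^ Suc n)" by simp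
    with ki have "2 * i \<le> 2 ^ Suc n \<and>
        norm (centred (s + r powr \<alpha> * real k + r powr \<alpha> * (real (2 * i) / real (2 ^ Suc n))) \<omega>) \<le> r"
      by (simp only:) simp
    with ki(1,2) show "\<omega> \<in> near_zero s L r (Suc n)"
      unfolding near_zero_def by blast
  qed
  then have "(\<lambda>n. prob (near_zero s L r n)) \<longlonglongrightarrow> prob (\<Union>n. near_zero s L r n)"
    using s by (intro finite_Lim_measure_incseq) auto
  moreover have "prob (near_zero s L r n) \<le> real L * (2 * hitting_bound s r)" for n
  proof -
    let ?B = "\<lambda>k. {\<omega> \<in> space M. \<exists>i\<le>2 ^ n. 
      norm (centred (s + r powr \<alpha> * real k + r powr \<alpha> * (real i / real (2 ^ n))) \<omega>) \<le> r}"
    have [measurable]: "centred (s + r powr \<alpha> * real k + r powr \<alpha> * (real i / real (2 ^ n))) \<in> borel_measurable M" for k i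
      by (rule centred_measurable) (use s in simp)
    have B: "?B k \<in> sets M" for k by measurable
    have U: "near_zero s L r n = (\<Union>k\<in>{..<L}. ?B k)" unfolding near_zero_def by auto
    have "prob (near_zero s L r n) \<le> (\<Sum>k<L. prob (?B k))"
      unfolding U by (intro finite_measure_subadditive_finite image_subsetI B) simp
    also have "\<dots> \<le> (\<Sum>k<L. 2 * hitting_bound s r)"
    proof (rule sum_mono)
      fix k
      have "s \<le> s + r powr \<alpha> * real k" by simp
      from block_hitting[OF s this r, of "2 ^ n"] show "prob (?B k) \<le> 2 * hitting_bound s r" .
    qed
    finally show ?thesis by simp
  qed
  ultimately show ?thesis by (intro LIMSEQ_le_const2) auto
qed

lemma AE_escape:
  fixes A :: "nat \<Rightarrow> 'w set"
  assumes A: "\<And>m. A m \<in> sets M" and bound: "\<And>m. prob (A m) \<le> c m" and c: "c \<longlonglongrightarrow> 0"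
  shows "AE \<omega> in M. \<exists>m. \<omega> \<notin> A m"
proof -
  have I: "(\<Inter>m. A m) \<in> sets M" using A by blast
  have "prob (\<Inter>m. A m) \<le> c m" for m
    using finite_measure_mono[of "\<Inter>m. A m" "A m"] A bound[of m] by force
  then have "prob (\<Inter>m. A m) \<le> 0" using c by (intro LIMSEQ_le_const[of c]) auto
  then have "prob (\<Inter>m. A m) = 0" by (simp add: measure_le_0_iff)
  then have "AE \<omega> in M. \<omega> \<notin> (\<Inter>m. A m)"
    using I by (intro AE_not_in) (auto simp: null_sets_def emeasure_eq_measure)
  then show ?thesis by eventually_elim auto
qed

text \<open>Of order \<open>r powr - \<alpha>\<close> blocks cover \<open>[s, T)\<close>, and each
  is hit with probability \<open>o(r powr \<alpha>)\<close>. A visit to the open disc of radius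
  \<open>r\<close> at any time forces one at a dyadic time shortly afterwards, by right
  continuity. The lower bound on \<open>s\<close> is removed in \<open>AE_nonvanishing\<close> by
  right continuity at 0.\<close>

lemma AE_away_from_zero:
  assumes s: "0 < s"
  shows "AE \<omega> in M. \<exists>r>0. \<forall>t\<in>{s..<T}. r \<le> norm (Z t \<omega>)"
proof -
  define r where "r m = 1 / real (Suc m)" for m
  \<comment> \<open>the number of blocks of length \<open>r powr \<alpha>\<close> that cover \<open>[s, T)\<close>\<close>
  define L where "L m = nat \<lceil>\<bar>T\<bar> / r m powr \<alpha>\<rceil>" for m
  define c where "c m = 2 * (\<bar>T\<bar> + 1) * (r m powr - \<alpha> * hitting_bound s (r m))" for m
  have r: "0 < r m" "r m \<le> 1" for m by (auto simp: r_def)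
  have "r \<longlonglongrightarrow> 0" unfolding r_def using LIMSEQ_Suc[OF lim_1_over_n] by simp
  then have "filterlim r (at_right 0) sequentially" using r(1) less_imp_neq[OF r(1), symmetric] by (simp add: filterlim_at)
  then have "(\<lambda>m. r m powr - \<alpha> * hitting_bound s (r m)) \<longlonglongrightarrow> 0"
    by (rule filterlim_compose[OF hitting_bound_rate[OF s]])
  then have c: "c \<longlonglongrightarrow> 0" unfolding c_def using tendsto_mult_right_zero by blast
  have "AE \<omega> in M. \<exists>m. \<omega> \<notin> (\<Union>n. near_zero s (L m) (r m) n)"
  proof (rule AE_escape[OF _ _ c])
    fix m
    show "(\<Union>n. near_zero s (L m) (r m) n) \<in> sets M" using s by auto
    have rp: "0 < r m powr \<alpha>" "r m powr \<alpha> \<le> 1" using r[of m] \<alpha> by (auto intro: powr_le1)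
    have "real (L m) \<le> \<bar>T\<bar> / r m powr \<alpha> + 1"
    proof -
      have "0 \<le> \<bar>T\<bar> / r m powr \<alpha>" by simp
      then show ?thesis unfolding L_def by linarith
    qed
    also have "\<dots> \<le> \<bar>T\<bar> / r m powr \<alpha> + 1 / r m powr \<alpha>" using rp by simp
    also have "\<dots> = (\<bar>T\<bar> + 1) * r m powr - \<alpha>" by (simp add: powr_minus divide_inverse algebra_simps)
    finally have "real (L m) * (2 * hitting_bound s (r m)) \<le> (\<bar>T\<bar> + 1) * r m powr - \<alpha> * (2 * hitting_bound s (r m))"
      using hitting_bound_nonneg[of s "r m"] by (intro mult_right_mono) auto
    then show "prob (\<Union>n. near_zero s (L m) (r m) n) \<le> c m"
      using near_zero_prob[OF s r(1), of "L m" m] unfolding c_def by (simp add: algebra_simps)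
  qed
  then show ?thesis using cadlag_paths AE_centred AE_space
  proof eventually_elim
    case (elim \<omega>)
    show ?case
    proof -
      have w: "\<omega> \<in> space M" by (rule elim(4))
      obtain m where m: "\<And>n. \<omega> \<notin> near_zero s (L m) (r m) n" using elim by auto
      define h where "h = r m powr \<alpha>"
      have h: "0 < h" using r(1)[of m] by (simp add: h_def)
      have "r m \<le> norm (Z t \<omega>)" if t: "t \<in> {s..<T}" for t
      proof (rule ccontr)
        assume "\<not> r m \<le> norm (Z t \<omega>)"
        then have lt: "norm (Z t \<omega>) < r m" by simp
        have "((\<lambda>u. Z u \<omega>) \<longlongrightarrow> Z t \<omega>) (at_right t)"
          using elim(2) t s by (auto simp: cadlag_def)
        from order_tendstoD(2)[OF tendsto_norm[OF this] lt]
        obtain b where b: "b > t" "\<And>u. t < u \<Longrightarrow> u < b \<Longrightarrow> norm (Z u \<omega>) < r m"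
          unfolding eventually_at_right_field by auto
        define k where "k = nat \<lfloor>(t - s) / h\<rfloor>"
        have "real k = \<lfloor>(t - s) / h\<rfloor>" using t h by (simp add: k_def)
        then have "real k \<le> (t - s) / h" "(t - s) / h < real k + 1" by linarith+
        then have k: "h * k \<le> t - s" "t - s < h * (k + 1)" using h by (auto simp: field_simps)
        have kL: "k < L m"
        proof -
          have "(t - s) / h < \<bar>T\<bar> / h" using t s h by (intro divide_strict_right_mono) auto
          then have "real k < \<bar>T\<bar> / h" using \<open>real k \<le> (t - s) / h\<close> by linarith
          then show ?thesis unfolding L_def h_def[symmetric] by linarith
        qed
        define y where "y = (t - s - h * k) / h"
        have y: "0 \<le> y" "y < 1" "t = s + h * k + h * y" using k h by (auto simp: y_def field_simps)
        have "0 < min (b - t) (h * (1 - y))" using b y h by auto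
        then have pos: "0 < min (b - t) (h * (1 - y)) / h" using h by simp
        obtain n where n: "(1 / 2 :: real) ^ n < min (b - t) (h * (1 - y)) / h"
          using real_arch_pow_inv[OF pos, of "1/2"] by auto
        define i where "i = nat \<lfloor>2 ^ n * y\<rfloor> + 1"
        have "0 \<le> 2 ^ n * y" using y by simp
        then have "real (nat \<lfloor>2 ^ n * y\<rfloor>) = \<lfloor>2 ^ n * y\<rfloor>" by simp
        then have "real (nat \<lfloor>2 ^ n * y\<rfloor>) \<le> 2 ^ n * y" "2 ^ n * y < real (nat \<lfloor>2 ^ n * y\<rfloor>) + 1" by linarith+
        moreover have "real i = real (nat \<lfloor>2 ^ n * y\<rfloor>) + 1" by (simp only: i_def of_nat_add of_nat_1)
        ultimately have "2 ^ n * y < real i" "real i \<le> 2 ^ n * y + 1" by linarith+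
        then have i: "y < real i / 2 ^ n" "real i / 2 ^ n \<le> y + (1 / 2) ^ n"
          by (auto simp: field_simps power_one_over)
        have hn: "h * (1 / 2) ^ n < min (b - t) (h * (1 - y))" using n h by (simp add: field_simps)
        have "h * (1 / 2) ^ n < h * (1 - y)" using hn by simp
        then have "y + (1 / 2) ^ n < 1" using h by simp
        then have "real i / 2 ^ n < 1" using i by linarith
        then have iN: "i \<le> 2 ^ n" by (simp add: field_simps)
        let ?u = "s + h * real k + h * (real i / real (2 ^ n))"
        have "h * y < h * (real i / 2 ^ n)" "h * (real i / 2 ^ n) \<le> h * (y + (1 / 2) ^ n)"
          using i h by (auto intro: mult_left_mono simp del: times_divide_eq_right)
        then have "t < ?u" "?u < b" using y hn by (auto simp: distrib_left)
        then have "norm (Z ?u \<omega>) < r m" by (rule b(2))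
        then have "norm (centred ?u \<omega>) \<le> r m" using elim(3) by simp
        then have "\<omega> \<in> near_zero s (L m) (r m) n"
          unfolding near_zero_def h_def[symmetric] using w kL iN by blast
        then show False using m by blast
      qed
      then show ?thesis using r(1) by blast
    qed
  qed
qed

end

section \<open>No jump segment meets the origin\<close>

context planar_stable_process
begin

lemma increment_rotation:
  assumes st: "0 \<le> s" "s \<le> t" and c: "norm c = 1"
  shows "distr M borel (\<lambda>\<omega>. c * (Z t \<omega> - Z s \<omega>)) = distr M borel (\<lambda>\<omega>. Z t \<omega> - Z s \<omega>)"
proof (rule plane_characteristic_function_unique)
  have [measurable]: "Z s \<in> borel_measurable M" "Z t \<in> borel_measurable M"
    using st by (auto intro: random_variable)
  show "prob_space (distr M borel (\<lambda>\<omega>. c * (Z t \<omega> - Z s \<omega>)))" "prob_space (distr M borel (\<lambda>\<omega>. Z t \<omega> - Z s \<omega>))"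
    by (auto intro: prob_space_distr)
  interpret V: stable_vector M \<alpha> "t - s" "\<lambda>\<omega>. Z t \<omega> - Z s \<omega>" by (rule increment_stable_vector[OF st])
  fix \<xi>
  have ad: "\<xi> \<bullet> (c * w) = (cnj c * \<xi>) \<bullet> w" for w by (simp add: inner_complex_def algebra_simps)
  have "norm (cnj c * \<xi>) = norm \<xi>" using c by (simp add: norm_mult)
  then show "(\<integral>z. iexp (\<xi> \<bullet> z) \<partial>distr M borel (\<lambda>\<omega>. c * (Z t \<omega> - Z s \<omega>)))
      = (\<integral>z. iexp (\<xi> \<bullet> z) \<partial>distr M borel (\<lambda>\<omega>. Z t \<omega> - Z s \<omega>))"
    by (simp add: integral_distr ad V.char)
qed auto

lemma centred_increment_independent:
  assumes st: "0 \<le> s" "s \<le> t"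
  shows "indep_var borel (centred s) borel (\<lambda>\<omega>. Z t \<omega> - Z s \<omega>)"
proof -
  have "indep_var (PiM {..0::nat} (\<lambda>_. borel)) (\<lambda>\<omega>. \<lambda>j\<in>{..0}. Z s \<omega> - Z 0 \<omega>)
           (PiM {Suc 0} (\<lambda>_. borel)) (\<lambda>\<omega>. \<lambda>j\<in>{Suc 0}. Z t \<omega> - Z s \<omega>)"
    using past_future_independent[of "\<lambda>_. s" 0 t] st by (simp add: mono_def)
  then have "indep_var borel ((\<lambda>x. 1 + x 0) \<circ> (\<lambda>\<omega>. \<lambda>j\<in>{..0::nat}. Z s \<omega> - Z 0 \<omega>))
           borel ((\<lambda>x. x (Suc 0)) \<circ> (\<lambda>\<omega>. \<lambda>j\<in>{Suc 0}. Z t \<omega> - Z s \<omega>))"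
  proof (rule indep_var_compose)
    have "(\<lambda>x. x 0) \<in> borel_measurable (PiM {..0::nat} (\<lambda>_. borel :: complex measure))"
      by (rule measurable_component_singleton) simp
    then show "(\<lambda>x. 1 + x 0) \<in> borel_measurable (PiM {..0::nat} (\<lambda>_. borel :: complex measure))" by measurable
    show "(\<lambda>x. x (Suc 0)) \<in> borel_measurable (PiM {Suc 0} (\<lambda>_. borel :: complex measure))"
      by (rule measurable_component_singleton) simp
  qed
  moreover have "(\<lambda>x. 1 + x 0) \<circ> (\<lambda>\<omega>. \<lambda>j\<in>{..0::nat}. Z s \<omega> - Z 0 \<omega>) = centred s"
    by (auto simp: centred_def)
  moreover have "(\<lambda>x. x (Suc 0)) \<circ> (\<lambda>\<omega>. \<lambda>j\<in>{Suc 0}. Z t \<omega> - Z s \<omega>) = (\<lambda>\<omega>. Z t \<omega> - Z s \<omega>)" by auto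
  ultimately show ?thesis by simp
qed

end

definition sector :: "nat \<Rightarrow> complex set" where
  "sector m = {v. v \<noteq> 0 \<and> \<bar>Arg v\<bar> < pi / m}"

lemma sector_measurable[measurable]: "sector m \<in> sets borel"
  unfolding sector_def by measurable

text \<open>Two of the rotation angles \<open>2 \<pi> j / m\<close> differ by at least \<open>2
  \<pi> / m\<close> modulo \<open>2 \<pi>\<close>, the opening angle of the sector.\<close>

lemma rotated_sectors_disjoint:
  fixes j k m :: nat
  assumes "j < m" "k < m" and j: "cis (2 * pi * j / m) * v \<in> sector m" and k: "cis (2 * pi * k / m) * v \<in> sector m"
  shows "j = k"
proof -
  have m: "0 < m" using assms by simp
  have v: "v \<noteq> 0" using j by (auto simp: sector_def)
  let ?a = "Arg (cis (2 * pi * j / m) * v)" and ?b = "Arg (cis (2 * pi * k / m) * v)"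
  have ab: "\<bar>?a\<bar> < pi / m" "\<bar>?b\<bar> < pi / m" using j k by (auto simp: sector_def)
  have "cis ?a = cis (2 * pi * j / m) * sgn v" "cis ?b = cis (2 * pi * k / m) * sgn v"
    using v by (auto simp: cis_Arg sgn_mult)
  then have "cis ?a * cis (2 * pi * k / m) = cis ?b * cis (2 * pi * j / m)" by simp
  then have "cis (?a + 2 * pi * k / m) = cis (?b + 2 * pi * j / m)" by (simp add: cis_mult)
  then have "sin (?a + 2 * pi * k / m) = sin (?b + 2 * pi * j / m) \<and> cos (?a + 2 * pi * k / m) = cos (?b + 2 * pi * j / m)"
    by (metis cis.simps)
  then obtain p :: int where p: "?a + 2 * pi * k / m = ?b + 2 * pi * j / m + 2 * pi * of_int p"
    unfolding sin_cos_eq_iff by auto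
  have "2 * pi / m * (real k - real j - m * of_int p) = ?b - ?a" using p m by (simp add: field_simps)
  moreover have "\<bar>?b - ?a\<bar> < 2 * pi / m" using ab by (simp add: abs_less_iff)
  ultimately have "\<bar>2 * pi / m * (real k - real j - m * of_int p)\<bar> < 2 * pi / m * 1" by simp
  then have "2 * pi / m * \<bar>real k - real j - m * of_int p\<bar> < 2 * pi / m * 1" by (simp add: abs_mult)
  then have "\<bar>real k - real j - m * of_int p\<bar> < 1"
    using m by (subst (asm) mult_less_cancel_left_pos) auto
  then have "\<bar>of_int (int k - int j - int m * p) :: real\<bar> < 1" by simp
  then have "int k - int j - int m * p = 0" by linarith
  then have e: "int k - int j = int m * p" by simp
  have "p = 0"
  proof (rule ccontr)
    assume "p \<noteq> 0"
    then have "int m * 1 \<le> int m * \<bar>p\<bar>" by (intro mult_left_mono) auto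
    then have "int m \<le> \<bar>int k - int j\<bar>" unfolding e by (simp add: abs_mult)
    then show False using assms(1,2) by linarith
  qed
  then show ?thesis using e by simp
qed

context planar_stable_process
begin

text \<open>The event that the increment points from \<open>centred s\<close> almost straight
  towards the origin. The increment is independent of \<open>centred s\<close> and its law is
  invariant under rotations, so the \<open>m\<close> events obtained by rotating it by multiples
  of \<open>2 \<pi> / m\<close> are equally likely; they are disjoint and all of them require a
  long increment. This gains the factor \<open>1 / m\<close>.\<close>

lemma increment_sector_bound:
  assumes st: "0 \<le> s" "s \<le> t" and m: "0 < m" and a: "0 < a"
  shows "prob {\<omega> \<in> space M. a \<le> norm (Z t \<omega> - Z s \<omega>) \<and> (Z t \<omega> - Z s \<omega>) / (- centred s \<omega>) \<in> sector m}
     \<le> 9 * (t - s) / a powr \<alpha> / m"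
proof -
  let ?w = "\<lambda>\<omega>. Z t \<omega> - Z s \<omega>"
  have [measurable]: "Z s \<in> borel_measurable M" "Z t \<in> borel_measurable M" "centred s \<in> borel_measurable M"
    using st by (auto intro: random_variable)
  define S where "S = {p :: complex \<times> complex. a \<le> norm (snd p) \<and> snd p / (- fst p) \<in> sector m}"
  have S: "S \<in> sets (borel \<Otimes>\<^sub>M borel)"
  proof -
    have "S = {p \<in> space (borel \<Otimes>\<^sub>M borel). a \<le> norm (snd p) \<and> snd p / (- fst p) \<in> sector m}"
      by (simp add: S_def space_pair_measure)
    also have "\<dots> \<in> sets (borel \<Otimes>\<^sub>M borel)" by measurable
    finally show ?thesis .
  qed
  define r where "r j = cis (2 * pi * real j / real m)" for j
  let ?A = "\<lambda>j. {\<omega> \<in> space M. a \<le> norm (?w \<omega>) \<and> r j * (?w \<omega> / (- centred s \<omega>)) \<in> sector m}"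
  have A[measurable]: "?A j \<in> sets M" for j by measurable
  have eq: "prob (?A j) = prob {\<omega> \<in> space M. a \<le> norm (?w \<omega>) \<and> ?w \<omega> / (- centred s \<omega>) \<in> sector m}" for j
  proof -
    have n: "norm (r j) = 1" by (simp add: r_def)
    have i: "indep_var borel (centred s) borel ?w" by (rule centred_increment_independent[OF st])
    have i2: "indep_var borel (centred s) borel (\<lambda>\<omega>. r j * ?w \<omega>)"
      using indep_var_compose[OF i, of "\<lambda>x. x" borel "\<lambda>x. r j * x" borel] by (simp add: comp_def)
    have "distr M (borel \<Otimes>\<^sub>M borel) (\<lambda>\<omega>. (centred s \<omega>, r j * ?w \<omega>))
        = distr M (borel \<Otimes>\<^sub>M borel) (\<lambda>\<omega>. (centred s \<omega>, ?w \<omega>))"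
      using i i2 increment_rotation[OF st n] unfolding indep_var_distribution_eq by metis
    then have "measure (distr M (borel \<Otimes>\<^sub>M borel) (\<lambda>\<omega>. (centred s \<omega>, r j * ?w \<omega>))) S
        = measure (distr M (borel \<Otimes>\<^sub>M borel) (\<lambda>\<omega>. (centred s \<omega>, ?w \<omega>))) S" by simp
    then have "prob ((\<lambda>\<omega>. (centred s \<omega>, r j * ?w \<omega>)) -` S \<inter> space M) = prob ((\<lambda>\<omega>. (centred s \<omega>, ?w \<omega>)) -` S \<inter> space M)"
      by (subst (asm) (1 2) measure_distr) (auto intro: S)
    moreover have "(\<lambda>\<omega>. (centred s \<omega>, r j * ?w \<omega>)) -` S \<inter> space M = ?A j"
      using n by (auto simp: S_def norm_mult)
    moreover have "(\<lambda>\<omega>. (centred s \<omega>, ?w \<omega>)) -` S \<inter> space M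
        = {\<omega> \<in> space M. a \<le> norm (?w \<omega>) \<and> ?w \<omega> / (- centred s \<omega>) \<in> sector m}"
      by (auto simp: S_def)
    ultimately show ?thesis by simp
  qed
  have "real m * prob {\<omega> \<in> space M. a \<le> norm (?w \<omega>) \<and> ?w \<omega> / (- centred s \<omega>) \<in> sector m} = (\<Sum>j<m. prob (?A j))"
    unfolding eq by simp
  also have "\<dots> = prob (\<Union>j\<in>{..<m}. ?A j)"
  proof (rule finite_measure_finite_Union[symmetric])
    show "disjoint_family_on ?A {..<m}"
      unfolding disjoint_family_on_def r_def using rotated_sectors_disjoint by blast
  qed (use A in auto)
  also have "\<dots> \<le> prob {\<omega> \<in> space M. a \<le> norm (?w \<omega>)}"
    by (rule finite_measure_mono) auto
  also have "\<dots> \<le> 9 * (t - s) / a powr \<alpha>" by (rule increment_tail[OF st a])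
  finally have "prob {\<omega> \<in> space M. a \<le> norm (?w \<omega>) \<and> ?w \<omega> / (- centred s \<omega>) \<in> sector m} * real m
      \<le> 9 * (t - s) / a powr \<alpha>" by (simp only: mult.commute)
  then show ?thesis using m by (simp only: pos_le_divide_eq of_nat_0_less_iff)
qed

text \<open>One of the \<open>n\<close> increments along the uniform grid of \<open>[0, T]\<close>
  is long and points almost straight towards the origin.\<close>

definition straight_cell :: "real \<Rightarrow> real \<Rightarrow> nat \<Rightarrow> nat \<Rightarrow> 'w set" where
  "straight_cell T a m n = {\<omega> \<in> space M. \<exists>k<n. 
     a \<le> norm (Z (T * real (Suc k) / n) \<omega> - Z (T * real k / n) \<omega>) \<and>
     (Z (T * real (Suc k) / n) \<omega> - Z (T * real k / n) \<omega>) / (- centred (T * real k / n) \<omega>) \<in> sector m}"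

text \<open>The bound does not depend on \<open>n\<close>, as the \<open>n\<close> cells have
  total length \<open>T\<close>.\<close>

lemma straight_cell_prob:
  assumes T: "0 \<le> T" and a: "0 < a" and m: "0 < m"
  shows "straight_cell T a m n \<in> sets M" "prob (straight_cell T a m n) \<le> 9 * T / a powr \<alpha> / m"
proof -
  let ?t = "\<lambda>k. T * real k / n"
  have t: "0 \<le> ?t k" for k using T by simp
  have [measurable]: "Z (?t k) \<in> borel_measurable M" "centred (?t k) \<in> borel_measurable M" for k
    using t by (auto intro: random_variable)
  let ?B = "\<lambda>k. {\<omega> \<in> space M. a \<le> norm (Z (?t (Suc k)) \<omega> - Z (?t k) \<omega>) \<and>
     (Z (?t (Suc k)) \<omega> - Z (?t k) \<omega>) / (- centred (?t k) \<omega>) \<in> sector m}"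
  have B: "?B k \<in> sets M" for k by measurable
  have U: "straight_cell T a m n = (\<Union>k\<in>{..<n}. ?B k)" unfolding straight_cell_def by blast
  show "straight_cell T a m n \<in> sets M" unfolding U using B by blast
  have "prob (straight_cell T a m n) \<le> (\<Sum>k<n. prob (?B k))"
    unfolding U by (intro finite_measure_subadditive_finite image_subsetI B) simp
  also have "\<dots> \<le> (\<Sum>k<n. 9 * (T / n) / a powr \<alpha> / m)"
  proof (rule sum_mono)
    fix k
    have "?t k \<le> ?t (Suc k)" using T by (intro divide_right_mono mult_left_mono) auto
    from increment_sector_bound[OF t this m a]
    show "prob (?B k) \<le> 9 * (T / n) / a powr \<alpha> / m"
      by (simp add: diff_divide_distrib[symmetric] algebra_simps)
  qed
  also have "\<dots> \<le> 9 * T / a powr \<alpha> / m" using T m by (cases "n = 0") auto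
  finally show "prob (straight_cell T a m n) \<le> 9 * T / a powr \<alpha> / m" .
qed

lemma AE_not_eventually_straight:
  assumes T: "0 \<le> T" and a: "0 < a"
  shows "AE \<omega> in M. \<exists>m. \<not> (\<forall>\<^sub>F n in sequentially. \<omega> \<in> straight_cell T a (Suc m) n)"
proof -
  define E where "E m = (\<Union>N. \<Inter>n\<in>{N..}. straight_cell T a (Suc m) n)" for m
  have sets: "straight_cell T a (Suc m) n \<in> sets M" for m n by (rule straight_cell_prob(1)[OF T a]) simp
  have I: "(\<Inter>n\<in>{N..}. straight_cell T a (Suc m) n) \<in> sets M" for m N
    using sets by (intro sets.countable_INT') auto
  have "AE \<omega> in M. \<exists>m. \<omega> \<notin> E m"
  proof (rule AE_escape)
    show "E m \<in> sets M" for m unfolding E_def using I by blast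
    show "prob (E m) \<le> 9 * T / a powr \<alpha> * (1 / real (Suc m))" for m
    proof -
      have "incseq (\<lambda>N. \<Inter>n\<in>{N..}. straight_cell T a (Suc m) n)"
        by (rule incseq_SucI) auto
      then have "(\<lambda>N. prob (\<Inter>n\<in>{N..}. straight_cell T a (Suc m) n)) \<longlonglongrightarrow> prob (E m)"
        unfolding E_def using I by (intro finite_Lim_measure_incseq) auto
      moreover have "prob (\<Inter>n\<in>{N..}. straight_cell T a (Suc m) n) \<le> 9 * T / a powr \<alpha> / real (Suc m)" for N
      proof -
        have "prob (\<Inter>n\<in>{N..}. straight_cell T a (Suc m) n) \<le> prob (straight_cell T a (Suc m) N)"
          by (intro finite_measure_mono sets) auto
        also have "\<dots> \<le> 9 * T / a powr \<alpha> / real (Suc m)" by (rule straight_cell_prob(2)[OF T a]) simp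
        finally show ?thesis .
      qed
      ultimately have "prob (E m) \<le> 9 * T / a powr \<alpha> / real (Suc m)" by (intro LIMSEQ_le_const2) auto
      then show ?thesis by simp
    qed
    show "(\<lambda>m. 9 * T / a powr \<alpha> * (1 / real (Suc m))) \<longlonglongrightarrow> 0"
      using tendsto_mult_left[OF LIMSEQ_Suc[OF lim_1_over_n], of "9 * T / a powr \<alpha>"] by simp
  qed
  moreover have "\<omega> \<in> E m \<longleftrightarrow> (\<forall>\<^sub>F n in sequentially. \<omega> \<in> straight_cell T a (Suc m) n)" for m \<omega>
    by (auto simp: E_def eventually_sequentially)
  ultimately show ?thesis by simp
qed

text \<open>Over the grid cell that contains \<open>t\<close> the increment tends to the jump,
  whose quotient by minus the left limit is a positive number \<open>1 + \<kappa>\<close>.\<close>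

lemma straight_jump_detected:
  assumes c: "cadlag (\<lambda>t. Z t \<omega>)" and w: "\<omega> \<in> space M" and cent: "\<forall>s. centred s \<omega> = Z s \<omega>"
    and t: "0 < t" "t \<le> T" and l: "((\<lambda>s. Z s \<omega>) \<longlongrightarrow> l) (at_left t)" "l \<noteq> 0"
    and r: "Z t \<omega> \<noteq> 0" "Z t \<omega> / l \<in> \<real>\<^sub>\<le>\<^sub>0" and a: "0 < a" "a < norm l" and m: "0 < m"
  shows "\<forall>\<^sub>F n in sequentially. \<omega> \<in> straight_cell T a m n"
proof -
  let ?z = "\<lambda>s. Z s \<omega>"
  have T: "0 < T" using t by simp
  define k where "k n = nat (\<lceil>t * real n / T\<rceil> - 1)" for n
  define p where "p n = T * real (k n) / n" for n
  define q where "q n = T * real (Suc (k n)) / n" for n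
  have kn: "k n < n" "p n < t" "t \<le> q n" "q n = p n + T / n" if n: "0 < n" for n
  proof -
    have x: "0 < t * real n / T" using t T n by simp
    then have "1 \<le> \<lceil>t * real n / T\<rceil>" by linarith
    then have rk: "real (k n) = \<lceil>t * real n / T\<rceil> - 1" by (simp add: k_def)
    have b: "real (k n) < t * real n / T" "t * real n / T \<le> real (k n) + 1" unfolding rk by linarith+
    then show "p n < t" "t \<le> q n" using T n by (auto simp: p_def q_def field_simps)
    have "t * real n / T \<le> n" using t T n by (simp add: field_simps)
    then have "real (k n) < real n" using b by linarith
    then show "k n < n" by simp
    show "q n = p n + T / n" by (simp add: p_def q_def distrib_left add_divide_distrib)
  qed
  have Tn: "(\<lambda>n. T / real n) \<longlonglongrightarrow> 0"
    using tendsto_mult_left[OF lim_1_over_n, of T] by simp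
  have ev: "\<forall>\<^sub>F n in sequentially. p n < t \<and> t - T / n \<le> p n \<and> t \<le> q n \<and> q n \<le> t + T / n"
    using eventually_gt_at_top[of 0]
  proof eventually_elim
    case (elim n)
    then show ?case using kn(2-4)[of n] by auto
  qed
  have pt: "p \<longlonglongrightarrow> t"
    by (rule tendsto_sandwich[of "\<lambda>n. t - T / real n" _ _ "\<lambda>_. t"])
      (use ev tendsto_diff[OF tendsto_const Tn, of t] in \<open>auto elim: eventually_mono\<close>)
  have qt: "q \<longlonglongrightarrow> t"
    by (rule tendsto_sandwich[of "\<lambda>_. t" _ _ "\<lambda>n. t + T / real n"])
      (use ev tendsto_add[OF tendsto_const Tn, of t] in \<open>auto elim: eventually_mono\<close>)
  have "filterlim p (at_left t) sequentially"
    unfolding filterlim_at using pt ev by (auto elim: eventually_mono)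
  then have zp: "(\<lambda>n. ?z (p n)) \<longlonglongrightarrow> l" by (rule filterlim_compose[OF l(1)])
  have zq: "(\<lambda>n. ?z (q n)) \<longlonglongrightarrow> ?z t"
  proof (rule topological_tendstoI)
    fix S assume S: "open S" "?z t \<in> S"
    have "(?z \<longlongrightarrow> ?z t) (at_right t)" using c t by (auto simp: cadlag_def)
    from topological_tendstoD[OF this S] obtain b where b: "b > t" "\<And>s. t < s \<Longrightarrow> s < b \<Longrightarrow> ?z s \<in> S"
      unfolding eventually_at_right_field by auto
    have "\<forall>\<^sub>F n in sequentially. q n < b" using order_tendstoD(2)[OF qt b(1)] .
    with ev show "\<forall>\<^sub>F n in sequentially. ?z (q n) \<in> S"
    proof eventually_elim
      case (elim n) then show ?case using b(2)[of "q n"] S by (cases "q n = t") auto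
    qed
  qed
  define \<kappa> where "\<kappa> = - Re (Z t \<omega> / l)"
  have zt: "Z t \<omega> = - of_real \<kappa> * l" and \<kappa>: "0 < \<kappa>"
  proof -
    have 1: "Re (Z t \<omega> / l) \<le> 0" "Im (Z t \<omega> / l) = 0" using r(2) by (auto simp: complex_nonpos_Reals_iff)
    then have 2: "Z t \<omega> / l = - of_real \<kappa>" by (simp add: \<kappa>_def complex_eq_iff)
    then show "Z t \<omega> = - of_real \<kappa> * l" using l(2) by (simp add: field_simps)
    then have "\<kappa> \<noteq> 0" using r(1) by auto
    then show "0 < \<kappa>" using 1 by (simp add: \<kappa>_def)
  qed
  have lim: "(\<lambda>n. ?z (q n) - ?z (p n)) \<longlonglongrightarrow> - of_real (1 + \<kappa>) * l"
  proof -
    have "?z t - l = - of_real (1 + \<kappa>) * l" unfolding zt by (simp add: algebra_simps)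
    then show ?thesis using tendsto_diff[OF zq zp] by (simp only:)
  qed
  have nl: "norm (- of_real (1 + \<kappa>) * l) = (1 + \<kappa>) * norm l" using \<kappa> by (simp add: norm_mult del: of_real_add)
  have "norm l \<le> (1 + \<kappa>) * norm l" using \<kappa> by (simp add: distrib_right)
  then have "a < (1 + \<kappa>) * norm l" using a by linarith
  then have E1: "\<forall>\<^sub>F n in sequentially. a < norm (?z (q n) - ?z (p n))"
    using order_tendstoD(1)[OF tendsto_norm[OF lim]] unfolding nl by simp
  have rat: "(\<lambda>n. (?z (q n) - ?z (p n)) / (- ?z (p n))) \<longlonglongrightarrow> of_real (1 + \<kappa>)"
  proof -
    have "- of_real (1 + \<kappa>) * l / (- l) = of_real (1 + \<kappa>)" using l(2) by simp
    moreover have "- l \<noteq> 0" using l(2) by simp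
    ultimately show ?thesis using tendsto_divide[OF lim tendsto_minus[OF zp]] by (simp only:) simp
  qed
  have "of_real (1 + \<kappa>) \<notin> (\<real>\<^sub>\<le>\<^sub>0 :: complex set)" using \<kappa> by (simp add: complex_nonpos_Reals_iff)
  then have "(\<lambda>n. Arg ((?z (q n) - ?z (p n)) / (- ?z (p n)))) \<longlonglongrightarrow> Arg (of_real (1 + \<kappa>))"
    by (intro tendsto_Arg rat)
  then have "(\<lambda>n. \<bar>Arg ((?z (q n) - ?z (p n)) / (- ?z (p n)))\<bar>) \<longlonglongrightarrow> 0"
    using \<kappa> by (intro tendsto_rabs_zero) (simp only: Arg_of_real, simp)
  then have E2: "\<forall>\<^sub>F n in sequentially. \<bar>Arg ((?z (q n) - ?z (p n)) / (- ?z (p n)))\<bar> < pi / m"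
    by (rule order_tendstoD(2)) (use m in simp)
  have E3: "\<forall>\<^sub>F n in sequentially. (?z (q n) - ?z (p n)) / (- ?z (p n)) \<noteq> 0"
    by (rule tendsto_imp_eventually_ne[OF rat]) (use \<kappa> in \<open>simp add: complex_eq_iff\<close>)
  show ?thesis using E1 E2 E3 eventually_gt_at_top[of 0]
  proof eventually_elim
    case (elim n)
    then show ?case
      unfolding straight_cell_def using kn(1)[of n] w cent
      by (auto simp: sector_def p_def[symmetric] q_def[symmetric] simp del: of_nat_Suc intro!: exI[of _ "k n"])
  qed
qed

text \<open>A jump segment through the origin would make all the events \<open>straight_cell T a
  (Suc m) n\<close> with large \<open>n\<close> occur, for every \<open>m\<close>; this has
  probability 0.\<close>

lemma AE_nonvanishing: "AE \<omega> in M. nonvanishing_path (\<lambda>t. Z t \<omega>)"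
proof -
  have "AE \<omega> in M. \<forall>j::nat. \<exists>r>0. \<forall>t\<in>{1 / real (Suc j)..<real (Suc j)}. r \<le> norm (Z t \<omega>)"
    unfolding AE_all_countable by (intro allI AE_away_from_zero) simp
  moreover have "AE \<omega> in M. \<forall>i j::nat. \<exists>m. \<not> (\<forall>\<^sub>F n in sequentially. \<omega> \<in> straight_cell (real i) (1 / real (Suc j)) (Suc m) n)"
    unfolding AE_all_countable by (intro allI AE_not_eventually_straight) auto
  ultimately show ?thesis using cadlag_paths AE_centred start AE_space
  proof eventually_elim
    case (elim \<omega>)
    let ?z = "\<lambda>t. Z t \<omega>"
    have c: "cadlag ?z" and z0: "?z 0 = 1" using elim by auto
    have away: "\<exists>d>0. \<forall>s\<in>{0..T}. d \<le> norm (?z s)" for T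
    proof -
      have "(?z \<longlongrightarrow> ?z 0) (at_right 0)" using c by (auto simp: cadlag_def)
      then have "((\<lambda>s. norm (?z s)) \<longlongrightarrow> 1) (at_right 0)" using tendsto_norm z0 by fastforce
      from order_tendstoD(1)[OF this, of "1/2"] obtain b where b: "b > 0" "\<And>s. 0 < s \<Longrightarrow> s < b \<Longrightarrow> 1 / 2 < norm (?z s)"
        unfolding eventually_at_right_field by auto
      obtain j0 where j0: "1 / real (Suc j0) < b" using nat_approx_posE[OF b(1)] by blast
      obtain j1 where j1: "T < real j1" using reals_Archimedean2 by blast
      define j where "j = max j0 j1"
      have j: "1 / real (Suc j) < b" "T < real (Suc j)"
      proof -
        have "1 / real (Suc j) \<le> 1 / real (Suc j0)" by (intro divide_left_mono) (auto simp: j_def)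
        then show "1 / real (Suc j) < b" using j0 by linarith
        show "T < real (Suc j)" using j1 by (simp add: j_def)
      qed
      obtain r where r: "r > 0" "\<And>t. t \<in> {1 / real (Suc j)..<real (Suc j)} \<Longrightarrow> r \<le> norm (Z t \<omega>)"
        using elim(1) by blast
      have "min r (1 / 2) \<le> norm (?z s)" if s: "s \<in> {0..T}" for s
      proof -
        consider "s = 0" | "0 < s" "s < b" | "1 / real (Suc j) \<le> s" using j s by fastforce
        then show ?thesis
        proof cases
          case 1 then show ?thesis using z0 by simp
        next
          case 2 then show ?thesis using b(2)[of s] by simp
        next
          case 3 then show ?thesis using r(2)[of s] j s by (simp add: min_le_iff_disj)
        qed
      qed
      then show ?thesis using r(1) by (intro exI[of _ "min r (1 / 2)"]) auto
    qed
    have nz: "?z s \<noteq> 0" if "0 \<le> s" for s using away[of s] that by force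
    have "?z t / l \<notin> \<real>\<^sub>\<le>\<^sub>0" if t: "0 < t" and l: "(?z \<longlongrightarrow> l) (at_left t)" for t l
    proof
      assume np: "?z t / l \<in> \<real>\<^sub>\<le>\<^sub>0"
      obtain d where d: "d > 0" "\<And>s. s \<in> {0..t} \<Longrightarrow> d \<le> norm (?z s)" using away by blast
      have "\<forall>\<^sub>F s in at_left t. d \<le> norm (?z s)"
        using eventually_at_left_real[OF t] by eventually_elim (use d in auto)
      then have dl: "d \<le> norm l"
        using tendsto_lowerbound[OF tendsto_norm[OF l]] by (simp add: trivial_limit_at_left_real)
      then have l0: "l \<noteq> 0" using d by auto
      obtain j where j: "1 / real (Suc j) < norm l" using nat_approx_posE[of "norm l"] l0 by auto
      obtain i where i: "t \<le> real i" using real_arch_simple by blast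
      have "\<forall>\<^sub>F n in sequentially. \<omega> \<in> straight_cell (real i) (1 / real (Suc j)) (Suc m) n" for m
        by (rule straight_jump_detected[OF c _ elim(4) t i l l0 nz np _ j]) (use elim t in auto)
      then show False using elim(2) by blast
    qed
    with c z0 away show ?case unfolding nonvanishing_path_def by blast
  qed
qed

end

section \<open>Divergence of the clock\<close>

lemma nonvanishing_path_one: "nonvanishing_path (\<lambda>_. 1)"
proof -
  have "(1 :: complex) / l \<notin> \<real>\<^sub>\<le>\<^sub>0" if "0 < t" "((\<lambda>_. 1 :: complex) \<longlongrightarrow> l) (at_left t)" for t :: real and l
    using tendsto_unique[OF _ that(2) tendsto_const] by (simp add: trivial_limit_at_left_real complex_nonpos_Reals_iff)
  then show ?thesis unfolding nonvanishing_path_def cadlag_def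
    by (auto intro!: exI[of _ 1] tendsto_const)
qed

context planar_stable_process
begin

text \<open>The time scale \<open>s\<close> corresponds to the length scale \<open>s powr (1 /
  \<alpha>)\<close>, so this probability is bounded uniformly in \<open>s\<close>.\<close>

lemma growth_tail:
  assumes s: "1 \<le> s" and K: "4 \<le> K"
  shows "prob {\<omega> \<in> space M. K * s < norm (centred s \<omega>) powr \<alpha>} \<le> 36 / K"
proof -
  define r where "r = (K * s) powr (1 / \<alpha>)"
  have Ks: "4 \<le> K * s" using mult_mono[of 4 K 1 s] s K by simp
  have "2 powr \<alpha> \<le> 2 powr 2" using \<alpha> by (intro powr_mono) auto
  then have two: "2 powr \<alpha> \<le> 4" by simp
  have r\<alpha>: "r powr \<alpha> = K * s" using Ks \<alpha> by (simp add: r_def powr_powr)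
  have "2 = (2 powr \<alpha>) powr (1 / \<alpha>)" using \<alpha> by (simp add: powr_powr)
  also have "\<dots> \<le> r" unfolding r_def using two Ks \<alpha> by (intro powr_mono2) auto
  finally have r: "2 \<le> r" .
  have s0: "0 \<le> s" using s by simp
  have [measurable]: "Z s \<in> borel_measurable M" "Z 0 \<in> borel_measurable M" "centred s \<in> borel_measurable M"
    using s0 by (auto intro: random_variable)
  have "prob {\<omega> \<in> space M. K * s < norm (centred s \<omega>) powr \<alpha>} \<le> prob {\<omega> \<in> space M. r / 2 \<le> norm (Z s \<omega> - Z 0 \<omega>)}"
  proof (rule finite_measure_mono)
    show "{\<omega> \<in> space M. K * s < norm (centred s \<omega>) powr \<alpha>} \<subseteq> {\<omega> \<in> space M. r / 2 \<le> norm (Z s \<omega> - Z 0 \<omega>)}"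
    proof (intro subsetI CollectI conjI)
      fix \<omega> assume w: "\<omega> \<in> {\<omega> \<in> space M. K * s < norm (centred s \<omega>) powr \<alpha>}"
      then show "\<omega> \<in> space M" by simp
      have "r \<le> norm (centred s \<omega>)"
      proof (rule ccontr)
        assume "\<not> r \<le> norm (centred s \<omega>)"
        then have "norm (centred s \<omega>) powr \<alpha> \<le> r powr \<alpha>" using \<alpha> by (intro powr_mono2) auto
        then show False using w r\<alpha> by simp
      qed
      moreover have "norm (centred s \<omega>) \<le> 1 + norm (Z s \<omega> - Z 0 \<omega>)"
        using norm_triangle_ineq[of 1 "Z s \<omega> - Z 0 \<omega>"] by (simp add: centred_def)
      ultimately show "r / 2 \<le> norm (Z s \<omega> - Z 0 \<omega>)" using r by linarith
    qed
  qed measurable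
  also have "\<dots> \<le> 9 * (s - 0) / (r / 2) powr \<alpha>" by (rule increment_tail) (use s r in auto)
  also have "\<dots> = 9 * 2 powr \<alpha> / K" using s r by (simp add: powr_divide r\<alpha>)
  also have "\<dots> \<le> 9 * 4 / K" using two K by (intro divide_right_mono mult_left_mono) auto
  finally show ?thesis by simp
qed

text \<open>If \<open>norm (X s) powr \<alpha> \<le> K s\<close>, the integrand of the clock is at
  least \<open>1 / (K s)\<close>. On \<open>[1, T]\<close> the measure \<open>ds / s\<close> has
  mass \<open>ln T\<close>; the times that violate the inequality have expected mass at most
  \<open>(36 / K) ln T\<close>, and the others at most \<open>K u\<close> if the clock stays below
  \<open>u\<close>. The process \<open>X\<close> is a version of \<open>Z\<close> all of whose
  paths are regular, as needed for measurability.\<close>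

lemma bounded_clock_prob:
  assumes X[measurable]: "\<And>s. 0 \<le> s \<Longrightarrow> X s \<in> borel_measurable M"
    and nv: "\<And>\<omega>. \<omega> \<in> space M \<Longrightarrow> nonvanishing_path (\<lambda>s. X s \<omega>)"
    and XZ: "AE \<omega> in M. \<forall>s\<ge>0. X s \<omega> = centred s \<omega>"
    and u: "0 \<le> u" and K: "4 \<le> K"
  shows "prob {\<omega> \<in> space M. \<forall>n::nat. clock \<alpha> (\<lambda>s. X s \<omega>) (real n) \<le> ennreal u} \<le> 37 / K"
proof -
  let ?B = "{\<omega> \<in> space M. \<forall>n::nat. clock \<alpha> (\<lambda>s. X s \<omega>) (real n) \<le> ennreal u}"
  have cad: "cadlag (\<lambda>s. X s \<omega>)" if "\<omega> \<in> space M" for \<omega> using nv[OF that] by (simp add: nonvanishing_path_def)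
  have [measurable]: "(\<lambda>\<omega>. clock \<alpha> (\<lambda>s. X s \<omega>) t) \<in> borel_measurable M" for t
    by (rule clock_measurable) (use X cad in \<open>auto simp: cadlag_def\<close>)
  have J: "(\<lambda>(\<omega>, s). X (max 0 s) \<omega>) \<in> borel_measurable (M \<Otimes>\<^sub>M borel)"
    by (rule right_continuous_jointly_measurable) (use X cad in \<open>auto simp: cadlag_def\<close>)
  have [measurable]: "(\<lambda>p. X (max 0 (snd p)) (fst p)) \<in> borel_measurable (M \<Otimes>\<^sub>M borel)"
    using J by (simp add: case_prod_beta')
  have B[measurable]: "?B \<in> sets M" by measurable
  \<comment> \<open>the value of \<open>ln T\<close> that makes \<open>K u\<close> at most \<open>ln T / K\<close>\<close>
  define L where "L = K\<^sup>2 * (u + 1)"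
  define T where "T = exp L"
  have L: "0 < L" using K u by (auto simp: L_def)
  have T: "1 \<le> T" using L by (simp add: T_def)
  obtain N :: nat where N: "T \<le> real N" using real_arch_simple by blast
  \<comment> \<open>the density \<open>1 / s\<close> on the times in \<open>[1, T]\<close> at which the process is too far away\<close>
  define bad where "bad p = ennreal (1 / snd p) * indicator {p. K * snd p < norm (X (max 0 (snd p)) (fst p)) powr \<alpha>} p
      * indicator {1..T} (snd p)" for p
  have bad[measurable]: "bad \<in> borel_measurable (M \<Otimes>\<^sub>M borel)" unfolding bad_def by measurable
  have FTC: "(\<integral>\<^sup>+s. ennreal (1 / s) * indicator {1..T} s \<partial>lborel) = ennreal L"
  proof -
    have "(\<integral>\<^sup>+s. ennreal (1 / s) * indicator {1..T} s \<partial>lborel) = ennreal (ln T - ln 1)"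
      by (rule nn_integral_FTC_Icc) (use T in \<open>auto intro!: derivative_eq_intros simp: field_simps\<close>)
    then show ?thesis by (simp add: T_def)
  qed
  have path: "ennreal L * indicator ?B \<omega> \<le> ennreal (K * u) + (\<integral>\<^sup>+s. bad (\<omega>, s) \<partial>lborel)" if w: "\<omega> \<in> space M" for \<omega>
  proof (cases "\<omega> \<in> ?B")
    case False then show ?thesis by simp
  next
    case True
    have [measurable]: "(\<lambda>s. X (max 0 s) \<omega>) \<in> borel_measurable borel" by (rule cadlag_measurable[OF cad[OF w]])
    have mb: "(\<lambda>s. bad (\<omega>, s)) \<in> borel_measurable lborel"
      using measurable_compose[OF measurable_Pair1'[OF w] bad] by simp
    have pt: "ennreal (1 / s) * indicator {1..T} s
       \<le> ennreal K * (ennreal (norm (X (max 0 s) \<omega>) powr - \<alpha>) * indicator {0..real N} s) + bad (\<omega>, s)" for s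
    proof (cases "s \<in> {1..T}")
      case False then show ?thesis by simp
    next
      case s: True
      then have m: "max 0 s = s" by auto
      show ?thesis
      proof (cases "K * s < norm (X s \<omega>) powr \<alpha>")
        case True
        then show ?thesis using s m by (simp add: bad_def)
      next
        case False
        have pos: "0 < norm (X s \<omega>) powr \<alpha>" using nonvanishing_path_nonzero[OF nv[OF w], of s] s by auto
        have "1 / s \<le> K * norm (X s \<omega>) powr - \<alpha>"
          using False pos s by (simp add: powr_minus field_simps)
        then have "ennreal (1 / s) \<le> ennreal K * ennreal (norm (X s \<omega>) powr - \<alpha>)"
          using K by (simp add: ennreal_mult[symmetric] ennreal_leI)
        then show ?thesis using s m N by (simp add: bad_def add_increasing2)
      qed
    qed
    have "ennreal L \<le> (\<integral>\<^sup>+s. ennreal K * (ennreal (norm (X (max 0 s) \<omega>) powr - \<alpha>) * indicator {0..real N} s) + bad (\<omega>, s) \<partial>lborel)"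
      unfolding FTC[symmetric] by (rule nn_integral_mono) (rule pt)
    also have "\<dots> = ennreal K * (\<integral>\<^sup>+s. ennreal (norm (X (max 0 s) \<omega>) powr - \<alpha>) * indicator {0..real N} s \<partial>lborel) + (\<integral>\<^sup>+s. bad (\<omega>, s) \<partial>lborel)"
      using mb by (subst nn_integral_add) (auto simp: nn_integral_cmult)
    also have "(\<integral>\<^sup>+s. ennreal (norm (X (max 0 s) \<omega>) powr - \<alpha>) * indicator {0..real N} s \<partial>lborel) = clock \<alpha> (\<lambda>s. X s \<omega>) (real N)"
      unfolding clock_def by (intro nn_integral_cong) (auto split: split_indicator)
    also have "ennreal K * clock \<alpha> (\<lambda>s. X s \<omega>) (real N) + (\<integral>\<^sup>+s. bad (\<omega>, s) \<partial>lborel)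
        \<le> ennreal K * ennreal u + (\<integral>\<^sup>+s. bad (\<omega>, s) \<partial>lborel)"
      using True by (intro add_right_mono mult_left_mono) auto
    also have "ennreal K * ennreal u = ennreal (K * u)" using K u by (simp add: ennreal_mult)
    finally show ?thesis using True by simp
  qed
  interpret FB: pair_sigma_finite M lborel ..
  have inner: "(\<integral>\<^sup>+\<omega>. bad (\<omega>, s) \<partial>M) \<le> ennreal (36 / K) * (ennreal (1 / s) * indicator {1..T} s)" for s
  proof (cases "s \<in> {1..T}")
    case False then show ?thesis by (simp add: bad_def)
  next
    case s: True
    then have m: "max 0 s = s" and s1: "1 \<le> s" by auto
    have [measurable]: "X s \<in> borel_measurable M" "centred s \<in> borel_measurable M" using s1 by auto
    have "(\<integral>\<^sup>+\<omega>. bad (\<omega>, s) \<partial>M) = (\<integral>\<^sup>+\<omega>. ennreal (1 / s) * indicator {\<omega> \<in> space M. K * s < norm (centred s \<omega>) powr \<alpha>} \<omega> \<partial>M)"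
    proof (rule nn_integral_cong_AE)
      show "AE \<omega> in M. bad (\<omega>, s) = ennreal (1 / s) * indicator {\<omega> \<in> space M. K * s < norm (centred s \<omega>) powr \<alpha>} \<omega>"
        using XZ AE_space by eventually_elim (use s m in \<open>auto simp: bad_def indicator_def\<close>)
    qed
    also have "\<dots> = ennreal (1 / s) * ennreal (prob {\<omega> \<in> space M. K * s < norm (centred s \<omega>) powr \<alpha>})"
      by (subst nn_integral_cmult_indicator) (auto simp: emeasure_eq_measure)
    also have "\<dots> \<le> ennreal (1 / s) * ennreal (36 / K)"
      by (intro mult_left_mono ennreal_leI growth_tail[OF s1 K]) auto
    finally show ?thesis using s by (simp add: mult.commute)
  qed
  have "ennreal L * emeasure M ?B = (\<integral>\<^sup>+\<omega>. ennreal L * indicator ?B \<omega> \<partial>M)"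
    by (subst nn_integral_cmult_indicator) auto
  also have "\<dots> \<le> (\<integral>\<^sup>+\<omega>. ennreal (K * u) + (\<integral>\<^sup>+s. bad (\<omega>, s) \<partial>lborel) \<partial>M)"
    by (rule nn_integral_mono) (rule path)
  also have "\<dots> = ennreal (K * u) + (\<integral>\<^sup>+\<omega>. (\<integral>\<^sup>+s. bad (\<omega>, s) \<partial>lborel) \<partial>M)"
    by (subst nn_integral_add) (auto simp: emeasure_space_1)
  also have "(\<integral>\<^sup>+\<omega>. (\<integral>\<^sup>+s. bad (\<omega>, s) \<partial>lborel) \<partial>M) = (\<integral>\<^sup>+s. (\<integral>\<^sup>+\<omega>. bad (\<omega>, s) \<partial>M) \<partial>lborel)"
    by (rule FB.Fubini'[symmetric]) (use bad in simp)
  also have "ennreal (K * u) + \<dots> \<le> ennreal (K * u) + (\<integral>\<^sup>+s. ennreal (36 / K) * (ennreal (1 / s) * indicator {1..T} s) \<partial>lborel)"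
    by (intro add_left_mono nn_integral_mono inner)
  also have "\<dots> = ennreal (K * u) + ennreal (36 / K) * ennreal L"
    by (subst nn_integral_cmult) (auto simp: FTC)
  also have "\<dots> = ennreal (K * u + 36 / K * L)"
  proof -
    have "ennreal (36 / K * L) = ennreal (36 / K) * ennreal L" using K L by (intro ennreal_mult) auto
    moreover have "ennreal (K * u + 36 / K * L) = ennreal (K * u) + ennreal (36 / K * L)"
      using K u L by (intro ennreal_plus) auto
    ultimately show ?thesis by simp
  qed
  finally have "ennreal (L * prob ?B) \<le> ennreal (K * u + 36 / K * L)"
    using L by (simp only: emeasure_eq_measure ennreal_mult[OF less_imp_le measure_nonneg])
  moreover have "0 \<le> K * u + 36 / K * L" using K u L by simp
  ultimately have "L * prob ?B \<le> K * u + 36 / K * L" by (simp only: ennreal_le_iff)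
  moreover have "K * u \<le> L / K"
  proof -
    have "K * u * K \<le> L" using K u by (simp add: L_def power2_eq_square algebra_simps)
    then show ?thesis using K by (simp add: pos_le_divide_eq)
  qed
  moreover have "L * (37 / K) = L / K + 36 / K * L" by (simp add: add_divide_distrib[symmetric])
  ultimately have "L * prob ?B \<le> L * (37 / K)" by linarith
  then show ?thesis by (simp only: mult_le_cancel_left_pos[OF L])
qed

proposition AE_good_path: "AE \<omega> in M. good_path \<alpha> (\<lambda>t. Z t \<omega>)"
proof -
  obtain N where N: "N \<in> null_sets M" "{\<omega> \<in> space M. \<not> nonvanishing_path (\<lambda>t. Z t \<omega>)} \<subseteq> N"
    using AE_nonvanishing unfolding eventually_ae_filter by blast
  define X where "X s \<omega> = (if \<omega> \<in> N then 1 else Z s \<omega>)" for s \<omega>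
  have [measurable]: "N \<in> sets M" using N by auto
  have X[measurable]: "X s \<in> borel_measurable M" if "0 \<le> s" for s
    using random_variable[OF that] unfolding X_def by measurable
  have nv: "nonvanishing_path (\<lambda>s. X s \<omega>)" if "\<omega> \<in> space M" for \<omega>
    using N(2) that nonvanishing_path_one unfolding X_def by (cases "\<omega> \<in> N") auto
  have nN: "AE \<omega> in M. \<omega> \<notin> N" by (rule AE_not_in[OF N(1)])
  have XZ: "AE \<omega> in M. \<forall>s\<ge>0. X s \<omega> = centred s \<omega>"
    using nN AE_centred by eventually_elim (simp add: X_def)
  let ?B = "\<lambda>u. {\<omega> \<in> space M. \<forall>n::nat. clock \<alpha> (\<lambda>s. X s \<omega>) (real n) \<le> ennreal u}"
  have cad: "cadlag (\<lambda>s. X s \<omega>)" if "\<omega> \<in> space M" for \<omega> using nv[OF that] by (simp add: nonvanishing_path_def)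
  have [measurable]: "(\<lambda>\<omega>. clock \<alpha> (\<lambda>s. X s \<omega>) t) \<in> borel_measurable M" for t
    by (rule clock_measurable) (use X cad in \<open>auto simp: cadlag_def\<close>)
  have "AE \<omega> in M. \<forall>u::nat. \<exists>m::nat. \<omega> \<notin> ?B (real u)"
    unfolding AE_all_countable
  proof
    fix u :: nat
    show "AE \<omega> in M. \<exists>m::nat. \<omega> \<notin> ?B (real u)"
    proof (rule AE_escape)
      show "?B (real u) \<in> sets M" by measurable
      show "prob (?B (real u)) \<le> 37 / real (m + 4)" for m
        by (rule bounded_clock_prob[OF X nv XZ]) auto
      show "(\<lambda>m. 37 / real (m + 4)) \<longlonglongrightarrow> 0" by real_asymp
    qed
  qed
  then show ?thesis using nN AE_space
  proof eventually_elim
    case (elim \<omega>)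
    have eq: "(\<lambda>s. X s \<omega>) = (\<lambda>s. Z s \<omega>)" using elim by (simp add: X_def)
    have "\<exists>t\<ge>0. ennreal u < clock \<alpha> (\<lambda>s. Z s \<omega>) t" for u
    proof -
      obtain v :: nat where v: "u \<le> real v" using real_arch_simple by blast
      have "\<omega> \<notin> ?B (real v)" using elim(1) by blast
      then obtain n :: nat where "ennreal (real v) < clock \<alpha> (\<lambda>s. X s \<omega>) (real n)"
        using elim(3) by (auto simp: not_le)
      moreover have "ennreal u \<le> ennreal (real v)" using v by (rule ennreal_leI)
      ultimately have "ennreal u < clock \<alpha> (\<lambda>s. Z s \<omega>) (real n)" unfolding eq by (rule le_less_trans[rotated])
      then show ?thesis by (intro exI[of _ "real n"]) auto
    qed
    then show ?case using nv[OF elim(3)] unfolding good_path_def eq by blast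
  qed
qed

end

section \<open>The law of a planar stable path\<close>

lemma (in prob_space) indep_vars_joint_distribution:
  assumes ind: "indep_vars (\<lambda>_. borel) X {..<n::nat}" and n: "0 < n"
  shows "distr M (PiM {..<n} (\<lambda>_. borel)) (\<lambda>\<omega>. \<lambda>i\<in>{..<n}. X i \<omega>) = PiM {..<n} (\<lambda>i. distr M borel (X i))"
proof -
  have "random_variable borel (X i)" if "i \<in> {..<n}" for i using ind that by (auto simp: indep_vars_def)
  moreover have "{..<n} \<noteq> {}" using n by auto
  ultimately show ?thesis using ind indep_vars_iff_distr_eq_PiM'[where I = "{..<n}" and M' = "\<lambda>_. borel" and X = X] by blast
qed

lemma increments_same_distribution:
  assumes Z: "planar_stable_process M \<alpha> Z" and Z': "planar_stable_process M' \<alpha> Z'"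
    and u: "mono u" "0 \<le> u (0::nat)" and n: "0 < n"
  shows "distr M (PiM {..<n} (\<lambda>_. borel)) (\<lambda>\<omega>. \<lambda>i\<in>{..<n}. Z (u (Suc i)) \<omega> - Z (u i) \<omega>)
       = distr M' (PiM {..<n} (\<lambda>_. borel)) (\<lambda>\<omega>. \<lambda>i\<in>{..<n}. Z' (u (Suc i)) \<omega> - Z' (u i) \<omega>)"
proof -
  interpret A: planar_stable_process M \<alpha> Z by fact
  interpret B: planar_stable_process M' \<alpha> Z' by fact
  have u0: "0 \<le> u i" for i using order_trans[OF u(2) monoD[OF u(1) le0]] .
  have one: "distr M borel (\<lambda>\<omega>. Z (u (Suc i)) \<omega> - Z (u i) \<omega>) = distr M' borel (\<lambda>\<omega>. Z' (u (Suc i)) \<omega> - Z' (u i) \<omega>)" for i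
  proof (rule plane_characteristic_function_unique)
    have le: "u i \<le> u (Suc i)" using u(1) by (simp add: mono_iff_le_Suc)
    have [measurable]: "(\<lambda>\<omega>. Z (u (Suc i)) \<omega> - Z (u i) \<omega>) \<in> borel_measurable M"
        "(\<lambda>\<omega>. Z' (u (Suc i)) \<omega> - Z' (u i) \<omega>) \<in> borel_measurable M'"
      using u0 by (auto intro!: borel_measurable_diff A.random_variable B.random_variable)
    show "prob_space (distr M borel (\<lambda>\<omega>. Z (u (Suc i)) \<omega> - Z (u i) \<omega>))" by (rule A.prob_space_distr) simp
    show "prob_space (distr M' borel (\<lambda>\<omega>. Z' (u (Suc i)) \<omega> - Z' (u i) \<omega>))" by (rule B.prob_space_distr) simp
    show "(\<integral>z. iexp (\<xi> \<bullet> z) \<partial>distr M borel (\<lambda>\<omega>. Z (u (Suc i)) \<omega> - Z (u i) \<omega>))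
        = (\<integral>z. iexp (\<xi> \<bullet> z) \<partial>distr M' borel (\<lambda>\<omega>. Z' (u (Suc i)) \<omega> - Z' (u i) \<omega>))" for \<xi>
      using A.increment_characteristic_function[OF u0 le, of \<xi>] B.increment_characteristic_function[OF u0 le, of \<xi>]
      by (simp add: integral_distr)
  qed auto
  show ?thesis
    using A.indep_vars_joint_distribution[OF A.independent_increments[OF u] n]
      B.indep_vars_joint_distribution[OF B.independent_increments[OF u] n]
    by (simp add: one)
qed

text \<open>The marginals at the sorted times in \<open>J\<close> are functions of the increments
  between them, whose joint law is determined by independence and the characteristic function.\<close>

lemma finite_dimensional_distributions_same:
  assumes Z: "planar_stable_process M \<alpha> Z" and Z': "planar_stable_process M' \<alpha> Z'"
    and J: "finite J" "J \<subseteq> {0..}" and A: "\<And>j. j \<in> J \<Longrightarrow> A j \<in> sets borel"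
  shows "measure M {\<omega> \<in> space M. \<forall>j\<in>J. 1 + (Z j \<omega> - Z 0 \<omega>) \<in> A j}
     = measure M' {\<omega> \<in> space M'. \<forall>j\<in>J. 1 + (Z' j \<omega> - Z' 0 \<omega>) \<in> A j}"
proof (cases "J = {}")
  case True
  interpret A: planar_stable_process M \<alpha> Z by fact
  interpret B: planar_stable_process M' \<alpha> Z' by fact
  show ?thesis using True A.prob_space B.prob_space by simp
next
  case False
  interpret A: planar_stable_process M \<alpha> Z by fact
  interpret B: planar_stable_process M' \<alpha> Z' by fact
  define xs where "xs = sorted_list_of_set J"
  define n where "n = length xs"
  have xs: "sorted xs" "set xs = J" using J by (auto simp: xs_def)
  have n: "0 < n" using False xs(2) by (auto simp: n_def)
  \<comment> \<open>the times 0 and \<open>xs\<close>, continued by the last entry of \<open>xs\<close>\<close>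
  define u where "u i = (case i of 0 \<Rightarrow> 0 | Suc k \<Rightarrow> xs ! min k (n - 1))" for i
  have nth: "xs ! min k (n - 1) \<in> J" for k
    using n xs(2) by (metis Suc_pred' le_imp_less_Suc min.cobounded2 n_def nth_mem)
  have mono: "mono u"
  proof (rule mono_iff_le_Suc[THEN iffD2], rule allI)
    fix i show "u i \<le> u (Suc i)"
    proof (cases i)
      case 0 then show ?thesis using nth[of 0] J by (auto simp: u_def)
    next
      case (Suc k)
      have "xs ! min k (n - 1) \<le> xs ! min (Suc k) (n - 1)"
      proof (rule sorted_nth_mono[OF xs(1)])
        show "min (Suc k) (n - 1) < length xs" using n by (simp add: n_def[symmetric] min_less_iff_disj)
      qed simp
      then show ?thesis using Suc by (simp add: u_def)
    qed
  qed
  have u0: "0 \<le> u 0" by (simp add: u_def)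
  let ?P = "PiM {..<n} (\<lambda>_. borel) :: (nat \<Rightarrow> complex) measure"
  define S where "S = {x \<in> space ?P. \<forall>i\<in>{..<n}. 1 + (\<Sum>k<Suc i. x k) \<in> A (xs ! i)}"
  have S: "S \<in> sets ?P" unfolding S_def
  proof (rule sets.sets_Collect_finite_All)
    fix i assume i: "i \<in> {..<n}"
    then have [measurable]: "A (xs ! i) \<in> sets borel" using A xs(2) n_def by auto
    have "(\<lambda>x. \<Sum>k<Suc i. x k) \<in> borel_measurable ?P"
      by (rule borel_measurable_sum[where f = "\<lambda>k x. x k"], rule measurable_component_singleton) (use i in auto)
    then have [measurable]: "(\<lambda>x. 1 + (\<Sum>k<Suc i. x k)) \<in> borel_measurable ?P" by (rule borel_measurable_add[OF borel_measurable_const])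
    show "{x \<in> space ?P. 1 + (\<Sum>k<Suc i. x k) \<in> A (xs ! i)} \<in> sets ?P" by measurable
  qed simp
  have key: "{\<omega> \<in> space K. \<forall>j\<in>J. 1 + (Y j \<omega> - Y 0 \<omega>) \<in> A j} = (\<lambda>\<omega>. \<lambda>i\<in>{..<n}. Y (u (Suc i)) \<omega> - Y (u i) \<omega>) -` S \<inter> space K"
    for K :: "'x measure" and Y :: "real \<Rightarrow> 'x \<Rightarrow> complex"
  proof -
    have "(\<Sum>k<Suc i. (\<lambda>i\<in>{..<n}. Y (u (Suc i)) \<omega> - Y (u i) \<omega>) k) = Y (xs ! i) \<omega> - Y 0 \<omega>" if i: "i < n" for i \<omega>
    proof -
      have "(\<Sum>k<Suc i. (\<lambda>i\<in>{..<n}. Y (u (Suc i)) \<omega> - Y (u i) \<omega>) k) = (\<Sum>k<Suc i. Y (u (Suc k)) \<omega> - Y (u k) \<omega>)"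
        by (intro sum.cong) (use i in auto)
      also have "\<dots> = Y (u (Suc i)) \<omega> - Y (u 0) \<omega>" by (rule sum_lessThan_telescope)
      also have "\<dots> = Y (xs ! i) \<omega> - Y 0 \<omega>" using i by (simp add: u_def min_absorb1)
      finally show ?thesis .
    qed
    then have "(\<lambda>\<omega>. \<lambda>i\<in>{..<n}. Y (u (Suc i)) \<omega> - Y (u i) \<omega>) -` S \<inter> space K
       = {\<omega> \<in> space K. \<forall>i\<in>{..<n}. 1 + (Y (xs ! i) \<omega> - Y 0 \<omega>) \<in> A (xs ! i)}"
      by (auto simp: S_def space_PiM simp del: sum.lessThan_Suc)
    also have "\<dots> = {\<omega> \<in> space K. \<forall>j\<in>J. 1 + (Y j \<omega> - Y 0 \<omega>) \<in> A j}"
      unfolding xs(2)[symmetric] by (auto simp: all_set_conv_all_nth n_def)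
    finally show ?thesis by simp
  qed
  have ui: "0 \<le> u i" for i using order_trans[OF u0 monoD[OF mono le0]] .
  have mA: "(\<lambda>\<omega>. \<lambda>i\<in>{..<n}. Z (u (Suc i)) \<omega> - Z (u i) \<omega>) \<in> measurable M ?P"
    by (intro measurable_restrict borel_measurable_diff A.random_variable ui)
  have mB: "(\<lambda>\<omega>. \<lambda>i\<in>{..<n}. Z' (u (Suc i)) \<omega> - Z' (u i) \<omega>) \<in> measurable M' ?P"
    by (intro measurable_restrict borel_measurable_diff B.random_variable ui)
  show ?thesis unfolding key
    using measure_distr[OF mA S] measure_distr[OF mB S] increments_same_distribution[OF Z Z' mono u0 n] by simp
qed

lemma nonvanishing_path_cong:
  assumes eq: "\<And>t. 0 \<le> t \<Longrightarrow> z t = z' t" and z: "nonvanishing_path z"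
  shows "nonvanishing_path z'"
  unfolding nonvanishing_path_def
proof (intro conjI allI impI)
  show "cadlag z'" by (rule cadlag_cong[OF eq]) (use z in \<open>auto simp: nonvanishing_path_def\<close>)
  show "z' 0 = 1" using eq[of 0] z by (simp add: nonvanishing_path_def)
  show "\<exists>d>0. \<forall>s\<in>{0..T}. d \<le> norm (z' s)" for T
  proof -
    obtain d where "d > 0" "\<forall>s\<in>{0..T}. d \<le> norm (z s)" using z unfolding nonvanishing_path_def by blast
    then show ?thesis using eq by (intro exI[of _ d]) auto
  qed
  fix t :: real and l assume t: "0 < t" and l: "(z' \<longlongrightarrow> l) (at_left t)"
  have "\<forall>\<^sub>F s in at_left t. z' s = z s"
    using eventually_at_left_real[OF t] by eventually_elim (use eq in auto)
  then have "(z \<longlongrightarrow> l) (at_left t)" using Lim_transform_eventually[OF l] by blast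
  then show "z' t / l \<notin> \<real>\<^sub>\<le>\<^sub>0" using z t eq[of t] by (auto simp: nonvanishing_path_def)
qed

lemma clock_cong: "(\<And>t. 0 \<le> t \<Longrightarrow> z t = z' t) \<Longrightarrow> clock \<alpha> z = clock \<alpha> z'"
  unfolding clock_def by (intro ext nn_integral_cong) (auto split: split_indicator)

lemma good_path_cong:
  assumes "\<And>t. 0 \<le> t \<Longrightarrow> z t = z' t"
  shows "good_path \<alpha> z \<longleftrightarrow> good_path \<alpha> z'"
  using nonvanishing_path_cong[of z z'] nonvanishing_path_cong[of z' z] assms clock_cong[of z z' \<alpha>]
  by (auto simp: good_path_def)

lemma time_changed_winding_cong:
  assumes eq: "\<And>t. 0 \<le> t \<Longrightarrow> X t \<omega> = Y t \<omega>'" and good: "good_path \<alpha> (\<lambda>t. X t \<omega>)" and \<alpha>: "0 < \<alpha>" and u: "0 \<le> u"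
  shows "time_changed_winding \<alpha> X u \<omega> = time_changed_winding \<alpha> Y u \<omega>'"
proof -
  let ?x = "\<lambda>t. X t \<omega>" and ?y = "\<lambda>t. Y t \<omega>'"
  have good': "good_path \<alpha> ?y" using good good_path_cong[of ?x ?y \<alpha>] eq by simp
  have "inverse_clock \<alpha> ?x u = inverse_clock \<alpha> ?y u"
    unfolding inverse_clock_def using clock_cong[of ?x ?y \<alpha>] eq by simp
  moreover have "winding_angle ?x t = winding_angle ?y t" if "0 \<le> t" for t
    unfolding winding_angle_def winding_sum_def using eq that by simp
  ultimately show ?thesis
    using time_changed_winding_eq[where Z = X and \<omega> = \<omega>, OF good \<alpha> u]
      time_changed_winding_eq[where Z = Y and \<omega> = \<omega>', OF good' \<alpha> u] inverse_clock_time_change(3)[OF good' \<alpha> u] by simp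
qed

lemma good_path_one: "good_path \<alpha> (\<lambda>_. 1)"
proof -
  have "clock \<alpha> (\<lambda>_. 1) t = ennreal t" if "0 \<le> t" for t
    unfolding clock_def using that by simp
  then have "\<exists>t\<ge>0. ennreal u < clock \<alpha> (\<lambda>_. 1) t" for u
    by (intro exI[of _ "\<bar>u\<bar> + 1"]) (auto simp: ennreal_less_iff intro: le_less_trans[OF ennreal_leI[of u "\<bar>u\<bar>"]])
  then show ?thesis unfolding good_path_def
    using nonvanishing_path_one by blast
qed

text \<open>The set of good paths need not be measurable in the product space; the trace
  \<open>\<sigma>\<close>-algebra makes every functional that is a pointwise limit of evaluations
  measurable.\<close>

definition good_paths :: "real \<Rightarrow> (real \<Rightarrow> complex) measure" where
  "good_paths \<alpha> = restrict_space (PiM {0..} (\<lambda>_. borel)) {z. good_path \<alpha> z}"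

lemma space_good_paths: "space (good_paths \<alpha>) = {z \<in> extensional {0..}. good_path \<alpha> z}"
  by (auto simp: good_paths_def space_restrict_space space_PiM PiE_def)

lemma good_paths_component: "0 \<le> s \<Longrightarrow> (\<lambda>z. z s) \<in> borel_measurable (good_paths \<alpha>)"
  unfolding good_paths_def by (intro measurable_restrict_space1 measurable_component_singleton) simp

text \<open>Bad paths, which form a null set, are redefined; all paths of \<open>p\<close> are
  then points of \<open>good_paths \<alpha>\<close>.\<close>

definition good_path_version :: "'w measure \<Rightarrow> real \<Rightarrow> (real \<Rightarrow> 'w \<Rightarrow> complex) \<Rightarrow> ('w \<Rightarrow> real \<Rightarrow> complex) \<Rightarrow> bool" where
  "good_path_version M \<alpha> Z p \<longleftrightarrow> p \<in> M \<rightarrow>\<^sub>M good_paths \<alpha> \<and> (AE \<omega> in M. \<forall>s\<ge>0. p \<omega> s = Z s \<omega>)"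

lemma (in planar_stable_process) good_path_version_exists: "\<exists>p. good_path_version M \<alpha> Z p"
proof -
  obtain N where N: "N \<in> null_sets M" "{\<omega> \<in> space M. \<not> good_path \<alpha> (\<lambda>t. Z t \<omega>)} \<subseteq> N"
    using AE_good_path unfolding eventually_ae_filter by blast
  have [measurable]: "N \<in> sets M" using N by auto
  define p where "p \<omega> = (\<lambda>s\<in>{0..}. if \<omega> \<in> N then 1 else Z s \<omega>)" for \<omega>
  have "good_path \<alpha> (p \<omega>)" if w: "\<omega> \<in> space M" for \<omega>
  proof (cases "\<omega> \<in> N")
    case True
    then show ?thesis using good_path_one good_path_cong[of "p \<omega>" "\<lambda>_. 1" \<alpha>] by (simp add: p_def)
  next
    case False
    then have "good_path \<alpha> (\<lambda>t. Z t \<omega>)" using N(2) w by blast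
    then show ?thesis using False good_path_cong[of "p \<omega>" "\<lambda>t. Z t \<omega>" \<alpha>] by (simp add: p_def)
  qed
  moreover have "p \<in> M \<rightarrow>\<^sub>M PiM {0..} (\<lambda>_. borel)" unfolding p_def
  proof (rule measurable_restrict)
    fix s :: real assume "s \<in> {0..}"
    then have [measurable]: "Z s \<in> borel_measurable M" by (intro random_variable) simp
    show "(\<lambda>\<omega>. if \<omega> \<in> N then 1 else Z s \<omega>) \<in> borel_measurable M" by measurable
  qed
  ultimately have "p \<in> M \<rightarrow>\<^sub>M good_paths \<alpha>"
    unfolding good_paths_def by (intro measurable_restrict_space2) auto
  moreover have "AE \<omega> in M. \<forall>s\<ge>0. p \<omega> s = Z s \<omega>"
    using AE_not_in[OF N(1)] by eventually_elim (simp add: p_def)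
  ultimately show ?thesis unfolding good_path_version_def by blast
qed

text \<open>The trace \<open>\<sigma>\<close>-algebra is generated by evaluations as well, so the
  finite-dimensional distributions determine the law.\<close>

proposition good_path_law_unique:
  assumes Z: "planar_stable_process M \<alpha> Z" and Z': "planar_stable_process M' \<alpha> Z'"
    and p: "good_path_version M \<alpha> Z p" and p': "good_path_version M' \<alpha> Z' p'"
  shows "distr M (good_paths \<alpha>) p = distr M' (good_paths \<alpha>) p'"
proof -
  interpret A: planar_stable_process M \<alpha> Z by fact
  interpret B: planar_stable_process M' \<alpha> Z' by fact
  let ?P = "PiM {0..} (\<lambda>_. borel) :: (real \<Rightarrow> complex) measure"
  have P: "p \<in> M \<rightarrow>\<^sub>M ?P" "p' \<in> M' \<rightarrow>\<^sub>M ?P"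
    and G: "p \<in> M \<rightarrow>\<^sub>M good_paths \<alpha>" "p' \<in> M' \<rightarrow>\<^sub>M good_paths \<alpha>"
    using p p' unfolding good_path_version_def good_paths_def measurable_restrict_space2_iff by auto
  have fdd: "measure K {\<omega> \<in> space K. \<forall>j\<in>J. q \<omega> j \<in> A j} = measure K {\<omega> \<in> space K. \<forall>j\<in>J. 1 + (Y j \<omega> - Y 0 \<omega>) \<in> A j}"
    if K: "planar_stable_process K \<alpha> Y" and q: "good_path_version K \<alpha> Y q"
      and J: "finite J" "J \<subseteq> {0..}" and A: "\<And>j. j \<in> J \<Longrightarrow> A j \<in> sets borel"
    for K :: "'x measure" and Y q J A
  proof -
    interpret K: planar_stable_process K \<alpha> Y by fact
    have qm: "q \<in> K \<rightarrow>\<^sub>M good_paths \<alpha>" and ae: "AE \<omega> in K. \<forall>s\<ge>0. q \<omega> s = Y s \<omega>"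
      using q by (auto simp: good_path_version_def)
    have m1: "{\<omega> \<in> space K. \<forall>j\<in>J. q \<omega> j \<in> A j} \<in> sets K"
    proof (rule sets.sets_Collect_finite_All[OF _ J(1)])
      fix j assume j: "j \<in> J"
      have [measurable]: "(\<lambda>\<omega>. q \<omega> j) \<in> borel_measurable K" "A j \<in> sets borel"
        using measurable_compose[OF qm good_paths_component[of j \<alpha>]] j J A by auto
      show "{\<omega> \<in> space K. q \<omega> j \<in> A j} \<in> sets K" by measurable
    qed
    have m2: "{\<omega> \<in> space K. \<forall>j\<in>J. 1 + (Y j \<omega> - Y 0 \<omega>) \<in> A j} \<in> sets K"
    proof (rule sets.sets_Collect_finite_All[OF _ J(1)])
      fix j assume j: "j \<in> J"
      have [measurable]: "Y j \<in> borel_measurable K" "Y 0 \<in> borel_measurable K" "A j \<in> sets borel"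
        using j J A by (auto intro: K.random_variable)
      show "{\<omega> \<in> space K. 1 + (Y j \<omega> - Y 0 \<omega>) \<in> A j} \<in> sets K" by measurable
    qed
    have "AE \<omega> in K. \<omega> \<in> {\<omega> \<in> space K. \<forall>j\<in>J. q \<omega> j \<in> A j} \<longleftrightarrow> \<omega> \<in> {\<omega> \<in> space K. \<forall>j\<in>J. 1 + (Y j \<omega> - Y 0 \<omega>) \<in> A j}"
      using ae K.start
    proof eventually_elim
      case (elim \<omega>)
      then have "q \<omega> j = 1 + (Y j \<omega> - Y 0 \<omega>)" if "j \<in> J" for j using J that by auto
      then show ?case by auto
    qed
    then show ?thesis by (intro measure_eq_AE m1 m2)
  qed
  have D: "distr M ?P p = distr M' ?P p'"
  proof (rule measure_eqI_PiM_infinite)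
    show "finite_measure (distr M ?P p)"
      using A.prob_space_distr[OF P(1)] by (simp add: prob_space_def)
    fix A J assume J: "finite J" "J \<subseteq> {0::real..}" and A: "\<And>i. i \<in> J \<Longrightarrow> A i \<in> sets (borel :: complex measure)"
    have e: "prob_emb J A" if "prob_emb = (\<lambda>J A. prod_emb {0..} (\<lambda>_. borel) J (Pi\<^sub>E J A) \<in> sets ?P)" for prob_emb
      unfolding that by (intro sets_PiM_I) (use J A in auto)
    then have E: "prod_emb {0..} (\<lambda>_. borel) J (Pi\<^sub>E J A) \<in> sets ?P" by simp
    have v: "q -` prod_emb {0..} (\<lambda>_. borel) J (Pi\<^sub>E J A) \<inter> space K = {\<omega> \<in> space K. \<forall>j\<in>J. q \<omega> j \<in> A j}"
      if "q \<in> K \<rightarrow>\<^sub>M ?P" for q and K :: "'x measure"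
      using measurable_space[OF that] by (auto simp: prod_emb_def space_PiM PiE_def restrict_def extensional_def Pi_def)
    show "emeasure (distr M ?P p) (prod_emb {0..} (\<lambda>_. borel) J (Pi\<^sub>E J A))
        = emeasure (distr M' ?P p') (prod_emb {0..} (\<lambda>_. borel) J (Pi\<^sub>E J A))"
      using fdd[OF Z p J A] fdd[OF Z' p' J A] finite_dimensional_distributions_same[OF Z Z' J A]
      by (simp add: emeasure_distr P E v A.emeasure_eq_measure B.emeasure_eq_measure)
  qed simp_all
  show ?thesis
  proof (rule measure_eqI)
    fix S assume "S \<in> sets (distr M (good_paths \<alpha>) p)"
    then have S: "S \<in> sets (good_paths \<alpha>)" by simp
    then obtain S' where S': "S' \<in> sets ?P" "S = S' \<inter> {z. good_path \<alpha> z}"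
      unfolding good_paths_def sets_restrict_space by (auto simp: Int_commute)
    have v: "q -` S \<inter> space K = q -` S' \<inter> space K" if "q \<in> K \<rightarrow>\<^sub>M good_paths \<alpha>" for q and K :: "'x measure"
      using measurable_space[OF that] by (auto simp: S'(2) space_good_paths)
    have "emeasure (distr M ?P p) S' = emeasure (distr M' ?P p') S'" by (simp only: D)
    then show "emeasure (distr M (good_paths \<alpha>) p) S = emeasure (distr M' (good_paths \<alpha>) p') S"
      by (simp add: emeasure_distr G P S S'(1) v)
  qed simp
qed

text \<open>Self-similarity: multiplying the space variable by \<open>t powr (1 /
  \<alpha>)\<close> compensates for the time change \<open>s / t\<close> in the characteristic
  exponent.\<close>

lemma (in planar_stable_process) scaled_process:
  assumes t: "0 < t"
  shows "planar_stable_process M \<alpha> (\<lambda>s \<omega>. 1 + (t powr (1 / \<alpha>)) *\<^sub>R (Z (s / t) \<omega> - 1))"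
proof -
  define c where "c = t powr (1 / \<alpha>)"
  have c: "0 < c" "c powr \<alpha> = t" using t \<alpha> by (auto simp: c_def powr_powr)
  define Y where "Y s \<omega> = 1 + c *\<^sub>R (Z (s / t) \<omega> - 1)" for s \<omega>
  have d: "Y s \<omega> - Y r \<omega> = c *\<^sub>R (Z (s / t) \<omega> - Z (r / t) \<omega>)" for s r \<omega>
    by (simp add: Y_def scaleR_diff_right)
  have "isotropic_stable_process M \<alpha> 1 1 Y"
  proof
    show "Y s \<in> borel_measurable M" if "0 \<le> s" for s
    proof -
      have [measurable]: "Z (s / t) \<in> borel_measurable M" using that t by (intro random_variable) simp
      show ?thesis unfolding Y_def by measurable
    qed
    show "AE \<omega> in M. Y 0 \<omega> = 1" using start by eventually_elim (simp add: Y_def)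
    show "AE \<omega> in M. cadlag (\<lambda>s. Y s \<omega>)" using cadlag_paths
    proof eventually_elim
      case (elim \<omega>)
      have "cadlag (\<lambda>s. Z (inverse t * s) \<omega>)"
        by (rule cadlag_time_change[OF elim scale_time_change]) (use t in simp)
      then have "cadlag (\<lambda>s. Z (s / t) \<omega>)" by (simp add: divide_inverse mult.commute)
      from cadlag_continuous_image[OF this, of "\<lambda>w. 1 + c *\<^sub>R (w - 1)"] show ?case
        unfolding Y_def by (simp add: continuous_intros)
    qed
    show "indep_vars (\<lambda>_. borel) (\<lambda>i \<omega>. Y (u (Suc i)) \<omega> - Y (u i) \<omega>) {..<n}"
      if u: "mono u" "0 \<le> u 0" for u :: "nat \<Rightarrow> real" and n
    proof -
      have "mono (\<lambda>i. u i / t)" using u(1) t by (auto simp: mono_def divide_right_mono)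
      then have "indep_vars (\<lambda>_. borel) (\<lambda>i \<omega>. Z (u (Suc i) / t) \<omega> - Z (u i / t) \<omega>) {..<n}"
        using independent_increments[of "\<lambda>i. u i / t" n] u(2) t by simp
      from indep_vars_compose2[OF this, where Y = "\<lambda>_ x. c *\<^sub>R x" and N = "\<lambda>_. borel"] show ?thesis
        by (simp add: d)
    qed
    show "distr M borel (\<lambda>\<omega>. Y (s + r) \<omega> - Y s \<omega>) = distr M borel (\<lambda>\<omega>. Y r \<omega> - Y 0 \<omega>)"
      if sr: "0 \<le> s" "0 \<le> r" for s r
    proof -
      have [measurable]: "Z (s / t) \<in> borel_measurable M" "Z (s / t + r / t) \<in> borel_measurable M"
          "Z (r / t) \<in> borel_measurable M" "Z 0 \<in> borel_measurable M"
        using sr t by (auto intro!: random_variable)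
      have "distr (distr M borel (\<lambda>\<omega>. Z (s / t + r / t) \<omega> - Z (s / t) \<omega>)) borel (\<lambda>x. c *\<^sub>R x)
          = distr (distr M borel (\<lambda>\<omega>. Z (r / t) \<omega> - Z 0 \<omega>)) borel (\<lambda>x. c *\<^sub>R x)"
        using stationary_increments[of "s / t" "r / t"] sr t by simp
      then show ?thesis by (simp add: distr_distr comp_def d add_divide_distrib)
    qed
    show "(\<integral>\<omega>. iexp (\<xi> \<bullet> (Y s \<omega> - Y 0 \<omega>)) \<partial>M) = of_real (exp (- (1 * s * norm \<xi> powr \<alpha>)))"
      if s: "0 \<le> s" for s \<xi>
    proof -
      have "(\<integral>\<omega>. iexp (\<xi> \<bullet> (Y s \<omega> - Y 0 \<omega>)) \<partial>M) = (\<integral>\<omega>. iexp ((c *\<^sub>R \<xi>) \<bullet> (Z (s / t) \<omega> - Z 0 \<omega>)) \<partial>M)"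
        by (simp add: d)
      also have "\<dots> = of_real (exp (- (1 * (s / t) * norm (c *\<^sub>R \<xi>) powr \<alpha>)))"
        by (rule characteristic_function) (use s t in simp)
      also have "norm (c *\<^sub>R \<xi>) powr \<alpha> = t * norm \<xi> powr \<alpha>" using c by (simp add: powr_mult)
      finally show ?thesis using t by simp
    qed
  qed
  then show ?thesis using \<alpha> unfolding Y_def c_def planar_stable_process_def planar_stable_process_axioms_def by simp
qed

lemma (in planar_stable_process) imaginary_part_stable:
  "isotropic_stable_process M \<alpha> 1 0 (\<lambda>s \<omega>. Im (Z s \<omega>))"
proof
  have [measurable]: "Z s \<in> borel_measurable M" if "0 \<le> s" for s using that by (rule random_variable)
  show "(\<lambda>\<omega>. Im (Z s \<omega>)) \<in> borel_measurable M" if "0 \<le> s" for s using that by measurable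
  show "AE \<omega> in M. Im (Z 0 \<omega>) = 0" using start by eventually_elim simp
  show "AE \<omega> in M. cadlag (\<lambda>s. Im (Z s \<omega>))"
    using cadlag_paths by eventually_elim (rule cadlag_continuous_image, auto intro: continuous_intros)
  show "indep_vars (\<lambda>_. borel) (\<lambda>i \<omega>. Im (Z (u (Suc i)) \<omega>) - Im (Z (u i) \<omega>)) {..<n}"
    if u: "mono u" "0 \<le> u 0" for u :: "nat \<Rightarrow> real" and n
    using indep_vars_compose2[OF independent_increments[OF u], where Y = "\<lambda>_. Im" and N = "\<lambda>_. borel"] by simp
  show "distr M borel (\<lambda>\<omega>. Im (Z (s + r) \<omega>) - Im (Z s \<omega>)) = distr M borel (\<lambda>\<omega>. Im (Z r \<omega>) - Im (Z 0 \<omega>))"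
    if sr: "0 \<le> s" "0 \<le> r" for s r
  proof -
    have "distr (distr M borel (\<lambda>\<omega>. Z (s + r) \<omega> - Z s \<omega>)) borel Im = distr (distr M borel (\<lambda>\<omega>. Z r \<omega> - Z 0 \<omega>)) borel Im"
      using stationary_increments[OF sr] by simp
    moreover have "(\<lambda>\<omega>. Z (s + r) \<omega> - Z s \<omega>) \<in> borel_measurable M" "(\<lambda>\<omega>. Z r \<omega> - Z 0 \<omega>) \<in> borel_measurable M"
      using sr by (auto intro!: borel_measurable_diff random_variable)
    ultimately show ?thesis by (simp add: distr_distr comp_def)
  qed
  show "(\<integral>\<omega>. iexp (\<xi> \<bullet> (Im (Z s \<omega>) - Im (Z 0 \<omega>))) \<partial>M) = of_real (exp (- (1 * s * norm \<xi> powr \<alpha>)))"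
    if "0 \<le> s" for s \<xi>
    using characteristic_function[OF that, of "Complex 0 \<xi>"] by (simp add: inner_complex_def cmod_def)
qed

text \<open>Being a stable process only depends on the joint law. It is used to realise the limit
  on the space of paths.\<close>

lemma isotropic_stable_process_transport:
  fixes X :: "real \<Rightarrow> 'w \<Rightarrow> 'a::euclidean_space" and Y :: "real \<Rightarrow> 'v \<Rightarrow> 'a"
  assumes X: "isotropic_stable_process M \<alpha> c x X" and f: "f \<in> M \<rightarrow>\<^sub>M N"
    and Y: "\<And>s. 0 \<le> s \<Longrightarrow> Y s \<in> borel_measurable N" and cad: "\<And>p. p \<in> space N \<Longrightarrow> cadlag (\<lambda>s. Y s p)"
    and eq: "AE \<omega> in M. \<forall>s\<ge>0. Y s (f \<omega>) = X s \<omega>"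
  shows "isotropic_stable_process (distr M N f) \<alpha> c x Y"
proof -
  interpret X: isotropic_stable_process M \<alpha> c x X by fact
  interpret N: prob_space "distr M N f" by (rule X.prob_space_distr[OF f])
  have [measurable]: "Y s \<in> borel_measurable N" "(\<lambda>\<omega>. Y s (f \<omega>)) \<in> borel_measurable M" "X s \<in> borel_measurable M" if "0 \<le> s" for s
    using Y[OF that] measurable_compose[OF f Y[OF that]] X.random_variable[OF that] by auto
  have D: "distr (distr M N f) borel (\<lambda>p. Y s p - Y r p) = distr M borel (\<lambda>\<omega>. X s \<omega> - X r \<omega>)" if sr: "0 \<le> s" "0 \<le> r" for s r
  proof -
    have m: "(\<lambda>p. Y s p - Y r p) \<in> borel_measurable N" using sr by measurable
    have "distr (distr M N f) borel (\<lambda>p. Y s p - Y r p) = distr M borel (\<lambda>\<omega>. Y s (f \<omega>) - Y r (f \<omega>))"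
      using distr_distr[OF m f] by (simp add: comp_def)
    also have "\<dots> = distr M borel (\<lambda>\<omega>. X s \<omega> - X r \<omega>)"
    proof (rule distr_cong_AE[OF refl refl])
      show "AE \<omega> in M. Y s (f \<omega>) - Y r (f \<omega>) = X s \<omega> - X r \<omega>" using eq by eventually_elim (use sr in simp)
    qed (use sr in \<open>auto intro!: borel_measurable_diff\<close>)
    finally show ?thesis .
  qed
  show ?thesis
  proof
    show "Y s \<in> borel_measurable (distr M N f)" if "0 \<le> s" for s using Y[OF that] by simp
    have "{p \<in> space N. Y 0 p = x} \<in> sets N" using Y[of 0] by measurable
    then have "(AE p in distr M N f. Y 0 p = x) \<longleftrightarrow> (AE \<omega> in M. Y 0 (f \<omega>) = x)" by (rule AE_distr_iff[OF f])
    moreover have "AE \<omega> in M. Y 0 (f \<omega>) = x" using eq X.start by eventually_elim simp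
    ultimately show "AE p in distr M N f. Y 0 p = x" by simp
    show "AE p in distr M N f. cadlag (\<lambda>s. Y s p)" by (rule AE_I2) (use cad in simp)
    show "distr (distr M N f) borel (\<lambda>p. Y (s + t) p - Y s p) = distr (distr M N f) borel (\<lambda>p. Y t p - Y 0 p)"
      if "0 \<le> s" "0 \<le> t" for s t
      using D[of "s + t" s] D[of t 0] X.stationary_increments[OF that] that by simp
    show "(\<integral>p. iexp (\<xi> \<bullet> (Y t p - Y 0 p)) \<partial>distr M N f) = of_real (exp (- (c * t * norm \<xi> powr \<alpha>)))"
      if t: "0 \<le> t" for t \<xi>
    proof -
      have m: "(\<lambda>p. Y t p - Y 0 p) \<in> borel_measurable (distr M N f)" "(\<lambda>\<omega>. X t \<omega> - X 0 \<omega>) \<in> borel_measurable M"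
        using t by (auto intro!: borel_measurable_diff)
      have "(\<integral>p. iexp (\<xi> \<bullet> (Y t p - Y 0 p)) \<partial>distr M N f) = (\<integral>y. iexp (\<xi> \<bullet> y) \<partial>distr (distr M N f) borel (\<lambda>p. Y t p - Y 0 p))"
        by (rule integral_distr[symmetric, OF m(1)]) simp
      also have "\<dots> = (\<integral>y. iexp (\<xi> \<bullet> y) \<partial>distr M borel (\<lambda>\<omega>. X t \<omega> - X 0 \<omega>))" using D[of t 0] t by simp
      also have "\<dots> = (\<integral>\<omega>. iexp (\<xi> \<bullet> (X t \<omega> - X 0 \<omega>)) \<partial>M)" by (rule integral_distr[OF m(2)]) simp
      finally show ?thesis using X.characteristic_function[OF t] by simp
    qed
    show "N.indep_vars (\<lambda>_. borel) (\<lambda>i p. Y (u (Suc i)) p - Y (u i) p) {..<n}"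
      if u: "mono u" "0 \<le> u 0" for u :: "nat \<Rightarrow> real" and n
    proof (cases "n = 0")
      case True
      then show ?thesis by (simp add: N.indep_vars_def N.indep_sets_def)
    next
      case False
      let ?P = "PiM {..<n} (\<lambda>_. borel) :: (nat \<Rightarrow> 'a) measure"
      have ui: "0 \<le> u i" for i using order_trans[OF u(2) monoD[OF u(1) le0]] .
      have mY: "(\<lambda>p. Y (u (Suc i)) p - Y (u i) p) \<in> borel_measurable N" for i using Y[OF ui] by measurable
      have m: "(\<lambda>p. \<lambda>i\<in>{..<n}. Y (u (Suc i)) p - Y (u i) p) \<in> N \<rightarrow>\<^sub>M ?P" by (intro measurable_restrict mY)
      have "distr (distr M N f) ?P (\<lambda>p. \<lambda>i\<in>{..<n}. Y (u (Suc i)) p - Y (u i) p)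
          = distr M ?P (\<lambda>\<omega>. \<lambda>i\<in>{..<n}. Y (u (Suc i)) (f \<omega>) - Y (u i) (f \<omega>))"
        using distr_distr[OF m f] by (simp add: comp_def)
      also have "\<dots> = distr M ?P (\<lambda>\<omega>. \<lambda>i\<in>{..<n}. X (u (Suc i)) \<omega> - X (u i) \<omega>)"
      proof (rule distr_cong_AE[OF refl refl])
        show "AE \<omega> in M. (\<lambda>i\<in>{..<n}. Y (u (Suc i)) (f \<omega>) - Y (u i) (f \<omega>)) = (\<lambda>i\<in>{..<n}. X (u (Suc i)) \<omega> - X (u i) \<omega>)"
          using eq by eventually_elim (use ui in \<open>auto intro!: restrict_ext\<close>)
        show "(\<lambda>\<omega>. \<lambda>i\<in>{..<n}. Y (u (Suc i)) (f \<omega>) - Y (u i) (f \<omega>)) \<in> M \<rightarrow>\<^sub>M ?P"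
          "(\<lambda>\<omega>. \<lambda>i\<in>{..<n}. X (u (Suc i)) \<omega> - X (u i) \<omega>) \<in> M \<rightarrow>\<^sub>M ?P"
          using ui by (auto intro!: measurable_restrict borel_measurable_diff)
      qed
      also have "\<dots> = PiM {..<n} (\<lambda>i. distr M borel (\<lambda>\<omega>. X (u (Suc i)) \<omega> - X (u i) \<omega>))"
        by (rule X.indep_vars_joint_distribution[OF X.independent_increments[OF u]]) (use False in simp)
      also have "\<dots> = PiM {..<n} (\<lambda>i. distr (distr M N f) borel (\<lambda>p. Y (u (Suc i)) p - Y (u i) p))"
        using D[OF ui ui] by simp
      finally show ?thesis
        using N.indep_vars_iff_distr_eq_PiM'[where I = "{..<n}" and M' = "\<lambda>_. borel"
            and X = "\<lambda>i p. Y (u (Suc i)) p - Y (u i) p"] mY False by auto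
    qed
  qed
qed

section \<open>Winding of paths that stay close to 1\<close>

lemma Arg_near_1:
  assumes w: "norm w \<le> 1 / 2"
  shows "\<bar>Arg (1 + w) - Im w\<bar> \<le> 2 * (norm w)\<^sup>2" and "\<bar>Arg (1 + w)\<bar> < pi / 2" and "1 + w \<noteq> 0"
proof -
  have "\<bar>Re w\<bar> \<le> 1 / 2" using abs_Re_le_cmod[of w] w by linarith
  then have re: "0 < Re (1 + w)" by simp
  then show nz: "1 + w \<noteq> 0" by (metis less_irrefl zero_complex.sel(1))
  show "\<bar>Arg (1 + w)\<bar> < pi / 2" using re Arg_Re_pos by blast
  have "\<bar>Arg (1 + w) - Im w\<bar> = \<bar>Im (ln (1 + w) - w)\<bar>" using nz by (simp add: Arg_eq_Im_Ln)
  also have "\<dots> \<le> norm (ln (1 + w) - w)" by (rule abs_Im_le_cmod)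
  also have "\<dots> \<le> (norm w)\<^sup>2 / (1 - norm w)" using w by (intro Ln_approx_linear) simp
  also have "\<dots> \<le> (norm w)\<^sup>2 / (1 / 2)" using w by (intro divide_left_mono) auto
  finally show "\<bar>Arg (1 + w) - Im w\<bar> \<le> 2 * (norm w)\<^sup>2" by simp
qed

lemma Arg_quotient_right_half_plane:
  assumes "\<bar>Arg x\<bar> < pi / 2" "\<bar>Arg y\<bar> < pi / 2" "x \<noteq> 0" "y \<noteq> 0"
  shows "Arg (y / x) = Arg y - Arg x"
proof (rule Arg_unique)
  have "exp (\<i> * complex_of_real (Arg y - Arg x)) = exp (\<i> * complex_of_real (Arg y)) / exp (\<i> * complex_of_real (Arg x))"
    by (simp add: exp_diff[symmetric] algebra_simps)
  then have "exp (\<i> * complex_of_real (Arg y - Arg x)) = sgn (y / x)"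
    by (simp only: exp_Arg_eq_sgn[OF assms(3)] exp_Arg_eq_sgn[OF assms(4)] sgn_divide_complex)
  then show "complex_of_real (norm (y / x)) * exp (\<i> * complex_of_real (Arg y - Arg x)) = y / x"
    using assms by (simp add: sgn_eq)
  show "0 < norm (y / x)" using assms by simp
qed (use assms in \<open>auto simp: abs_less_iff\<close>)

lemma winding_angle_small:
  assumes y: "\<And>s. s \<in> {0..T} \<Longrightarrow> norm (y s - 1) \<le> 1 / 2" and y0: "y 0 = 1" and s: "s \<in> {0..T}"
  shows "winding_angle y s = Arg (y s)"
proof -
  have A: "\<bar>Arg (y s)\<bar> < pi / 2" "y s \<noteq> 0" if "s \<in> {0..T}" for s
    using Arg_near_1(2,3)[of "y s - 1"] y[OF that] by auto
  have "angle_lift y T (\<lambda>s. Arg (y s))"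
    unfolding angle_lift_def
  proof (intro conjI exI[of _ 1] allI impI)
    show "Arg (y 0) = 0" by (simp add: y0)
    fix a b assume "0 \<le> a \<and> a \<le> b \<and> b \<le> T \<and> b - a < 1"
    then show "Arg (y b) - Arg (y a) = Arg (y b / y a)"
      using Arg_quotient_right_half_plane[of "y a" "y b"] A[of a] A[of b] by simp
  qed simp
  from angle_lift_unique[OF this, of s] s show ?thesis by simp
qed

text \<open>Up to the horizon \<open>T\<close> the time change is the rescaled clock. Beyond
  \<open>T\<close> it is continued with slope 1, which keeps it within \<open>e\<close> of the
  identity.\<close>

lemma time_change_from_clock:
  assumes Y: "nonvanishing_path Y" and \<alpha>: "0 < \<alpha>" and t: "0 < t" and T: "0 \<le> T"
    and near: "\<And>s. s \<in> {0..T} \<Longrightarrow> \<bar>real_clock \<alpha> Y (t * s) / t - s\<bar> \<le> e"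
  shows "\<exists>l\<in>time_changes. (\<forall>s\<ge>0. \<bar>l s - s\<bar> \<le> e) \<and> (\<forall>s\<in>{0..T}. l s = real_clock \<alpha> Y (t * s) / t)"
proof -
  define h where "h s = real_clock \<alpha> Y (t * s) / t" for s
  have mono: "strict_mono_on {0..T} h"
    by (rule strict_mono_onI) (use real_clock_strict_mono[OF Y \<alpha>] t in \<open>auto simp: h_def divide_strict_right_mono\<close>)
  have h0: "h 0 = 0" by (simp add: h_def real_clock_0)
  have tT: "0 \<le> t * T" using t T by simp
  have "continuous_on {0..T} h"
    unfolding h_def
    by (intro continuous_intros continuous_on_compose2[OF real_clock_continuous[OF Y \<alpha> tT]])
      (use t in \<open>auto intro!: mult_left_mono\<close>)
  then have img: "h ` {0..T} = {0..h T}"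
  proof -
    assume c: "continuous_on {0..T} h"
    show ?thesis
    proof (intro equalityI subsetI)
      fix y assume "y \<in> h ` {0..T}"
      then obtain s where s: "y = h s" "s \<in> {0..T}" by auto
      have "h 0 \<le> h s" "h s \<le> h T"
        using strict_mono_onD[OF mono, of 0 s] strict_mono_onD[OF mono, of s T] s T
        by (cases "s = 0"; cases "s = T"; auto simp: less_imp_le)+
      then show "y \<in> {0..h T}" using s h0 by simp
    next
      fix y assume "y \<in> {0..h T}"
      then show "y \<in> h ` {0..T}" using IVT'[of h 0 y T] c h0 T by auto
    qed
  qed
  let ?l = "\<lambda>s. if s \<le> T then h s else s + (h T - T)"
  have "?l \<in> time_changes" by (rule time_change_extend(1)[OF T mono img])
  moreover have "\<bar>?l s - s\<bar> \<le> e" if "0 \<le> s" for s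
    using near[of s] near[of T] that T by (auto simp: h_def)
  ultimately show ?thesis by (intro bexI[of _ ?l]) (auto simp: h_def)
qed

text \<open>The integrand of the clock lies between \<open>(1 + d) powr - \<alpha>\<close> and
  \<open>(1 - d) powr - \<alpha>\<close>.\<close>

lemma clock_near_identity:
  assumes Y: "nonvanishing_path Y" and \<alpha>: "0 < \<alpha>" and t: "0 < t" and s: "0 \<le> s"
    and d: "0 \<le> d" "d < 1" and near: "\<And>r. r \<in> {0..t * s} \<Longrightarrow> norm (Y r - 1) \<le> d"
  shows "\<bar>real_clock \<alpha> Y (t * s) / t - s\<bar> \<le> s * ((1 - d) powr - \<alpha> - (1 + d) powr - \<alpha>)"
proof -
  have c: "cadlag Y" using Y by (simp add: nonvanishing_path_def)
  have ts: "0 \<le> t * s" using t s by simp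
  have b: "(1 + d) powr - \<alpha> \<le> norm (Y r) powr - \<alpha> \<and> norm (Y r) powr - \<alpha> \<le> (1 - d) powr - \<alpha>" if "0 < r" "r \<le> t * s" for r
  proof -
    have n: "norm (Y r - 1) \<le> d" using near[of r] that by simp
    have "norm (Y r) \<le> 1 + norm (Y r - 1)" using norm_triangle_ineq[of 1 "Y r - 1"] by simp
    moreover have "1 \<le> norm (Y r) + norm (Y r - 1)" using norm_triangle_ineq4[of "Y r" "Y r - 1"] by simp
    ultimately show ?thesis using n d \<alpha> by (auto intro!: powr_mono2')
  qed
  have lo: "ennreal ((1 + d) powr - \<alpha> * (t * s)) \<le> clock \<alpha> Y (t * s)"
    using clock_increment(1)[OF c order_refl ts, of "(1 + d) powr - \<alpha>" \<alpha> "(1 - d) powr - \<alpha>"] b by (simp add: clock_0)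
  have hi: "clock \<alpha> Y (t * s) \<le> ennreal ((1 - d) powr - \<alpha> * (t * s))"
    using clock_increment(2)[OF c order_refl ts, of "(1 + d) powr - \<alpha>" \<alpha> "(1 - d) powr - \<alpha>"] b by (simp add: clock_0)
  have "(1 + d) powr - \<alpha> * (t * s) \<le> real_clock \<alpha> Y (t * s)" "real_clock \<alpha> Y (t * s) \<le> (1 - d) powr - \<alpha> * (t * s)"
    using lo hi clock_real[OF Y \<alpha> ts] ts by auto
  then have 1: "(1 + d) powr - \<alpha> * s \<le> real_clock \<alpha> Y (t * s) / t" "real_clock \<alpha> Y (t * s) / t \<le> (1 - d) powr - \<alpha> * s"
    using t by (auto simp: field_simps)
  have "(1 + d) powr - \<alpha> \<le> 1 powr - \<alpha>" by (rule powr_mono2') (use d \<alpha> in auto)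
  moreover have "1 powr - \<alpha> \<le> (1 - d) powr - \<alpha>" by (rule powr_mono2') (use d \<alpha> in auto)
  ultimately have "s * (1 + d) powr - \<alpha> \<le> s * 1" "s * 1 \<le> s * (1 - d) powr - \<alpha>" using s by (intro mult_left_mono; simp)+
  then show ?thesis using 1 by (simp add: right_diff_distrib mult.commute abs_le_iff)
qed

text \<open>The pathwise heart of the proof. The time change \<open>l s = real_clock \<alpha> (Y
  n) (t n * s) / t n\<close> undoes the inverse clock: the rescaled time-changed winding at
  \<open>l s\<close> is the winding of \<open>Y n\<close> at \<open>t n * s\<close>, divided by
  \<open>\<epsilon> n\<close>. For large \<open>n\<close>, \<open>Y n\<close> is within
  \<open>1/2\<close> of 1 up to that time, so this is \<open>Arg (1 + \<epsilon> n (z s - 1)) /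
  \<epsilon> n\<close>, which differs from \<open>Im (z s)\<close> by at most \<open>2 \<epsilon>
  n B\<^sup>2\<close>.\<close>

proposition scaled_winding_converges:
  fixes z :: "real \<Rightarrow> complex" and Y :: "nat \<Rightarrow> real \<Rightarrow> complex"
  assumes \<alpha>: "0 < \<alpha>" and z: "cadlag z" "z 0 = 1"
    and t: "\<And>n. 0 < t n" "t \<longlonglongrightarrow> 0"
    and good: "\<And>n. good_path \<alpha> (Y n)"
    and Y: "\<And>n s. 0 \<le> s \<Longrightarrow> Y n s = 1 + (t n powr (1 / \<alpha>)) *\<^sub>R (z (s / t n) - 1)"
  shows "skorokhod_converges
     (\<lambda>n. \<lambda>s\<in>{0..}. t n powr (- 1 / \<alpha>) * time_changed_winding \<alpha> (\<lambda>s y. y s) (t n * s) (Y n)) (\<lambda>s\<in>{0..}. Im (z s))"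
proof (rule skorokhod_convergesI)
  fix k :: nat
  \<comment> \<open>the spatial scale that belongs to the time scale \<open>t n\<close>\<close>
  define \<epsilon> where "\<epsilon> n = t n powr (1 / \<alpha>)" for n
  have \<epsilon>: "0 < \<epsilon> n" for n using t(1)[of n] by (simp add: \<epsilon>_def)
  have "(\<lambda>n. t n powr (1 / \<alpha>)) \<longlonglongrightarrow> 0 powr (1 / \<alpha>)"
    by (rule tendsto_powr2[OF t(2) tendsto_const]) (use t(1) \<alpha> in \<open>auto intro: always_eventually less_imp_le\<close>)
  then have \<epsilon>0: "\<epsilon> \<longlonglongrightarrow> 0" by (simp add: \<epsilon>_def[abs_def])
  have "cadlag (\<lambda>s. z s - 1)" by (rule cadlag_continuous_image[OF z(1)]) (intro continuous_intros)
  from cadlag_bounded[OF this, of "real k"] obtain B where B: "0 < B" "\<And>s. s \<in> {0..real k} \<Longrightarrow> norm (z s - 1) \<le> B" by auto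
  have dB: "(\<lambda>n. \<epsilon> n * B) \<longlonglongrightarrow> 0" using tendsto_mult_left_zero[OF \<epsilon>0] .
  have e1: "\<forall>\<^sub>F n in sequentially. \<epsilon> n * B < 1 / 2" by (rule order_tendstoD(2)[OF dB]) simp
  have "(\<lambda>n. real k * ((1 - \<epsilon> n * B) powr - \<alpha> - (1 + \<epsilon> n * B) powr - \<alpha>)) \<longlonglongrightarrow> real k * ((1 - 0) powr - \<alpha> - (1 + 0) powr - \<alpha>)"
    by (intro tendsto_intros dB) auto
  then have "(\<lambda>n. real k * ((1 - \<epsilon> n * B) powr - \<alpha> - (1 + \<epsilon> n * B) powr - \<alpha>)) \<longlonglongrightarrow> 0" by simp
  then have e2: "\<forall>\<^sub>F n in sequentially. real k * ((1 - \<epsilon> n * B) powr - \<alpha> - (1 + \<epsilon> n * B) powr - \<alpha>) < 1 / Suc k"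
    by (rule order_tendstoD(2)) simp
  have "(\<lambda>n. \<epsilon> n * (2 * B\<^sup>2)) \<longlonglongrightarrow> 0" using tendsto_mult_left_zero[OF \<epsilon>0] .
  then have e3: "\<forall>\<^sub>F n in sequentially. \<epsilon> n * (2 * B\<^sup>2) < 1 / Suc k" by (rule order_tendstoD(2)) simp
  let ?R = "\<lambda>n. \<lambda>s\<in>{0..}. t n powr (- 1 / \<alpha>) * time_changed_winding \<alpha> (\<lambda>s y. y s) (t n * s) (Y n)"
  show "\<forall>\<^sub>F n in sequentially. ?R n \<in> skorokhod_ball (real k) (1 / real (Suc k)) (\<lambda>s\<in>{0..}. Im (z s))"
    using e1 e2 e3
  proof eventually_elim
    case (elim n)
    define d where "d = \<epsilon> n * B"
    have d: "0 \<le> d" "d \<le> 1 / 2" using elim(1) \<epsilon>[of n] B(1) by (auto simp: d_def)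
    have nv: "nonvanishing_path (Y n)" using good by (simp add: good_path_def)
    have tn: "0 < t n" by (rule t(1))
    have Yd: "norm (Y n (t n * s) - 1) \<le> d" "Y n (t n * s) - 1 = \<epsilon> n *\<^sub>R (z s - 1)" if "s \<in> {0..real k}" for s
    proof -
      show 1: "Y n (t n * s) - 1 = \<epsilon> n *\<^sub>R (z s - 1)" using Y[of "t n * s" n] that tn by (simp add: \<epsilon>_def)
      show "norm (Y n (t n * s) - 1) \<le> d"
        unfolding 1 d_def using B(2)[OF that] \<epsilon>[of n] by (simp add: mult_left_mono)
    qed
    have Yd': "norm (Y n r - 1) \<le> d" if "r \<in> {0..t n * real k}" for r
      using Yd(1)[of "r / t n"] that tn by (simp add: pos_divide_le_eq mult.commute)
    have near: "\<bar>real_clock \<alpha> (Y n) (t n * s) / t n - s\<bar> \<le> 1 / Suc k" if s: "s \<in> {0..real k}" for s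
    proof -
      have "t n * s \<le> t n * real k" using s tn by simp
      then have "\<bar>real_clock \<alpha> (Y n) (t n * s) / t n - s\<bar> \<le> s * ((1 - d) powr - \<alpha> - (1 + d) powr - \<alpha>)"
        using s d by (intro clock_near_identity[OF nv \<alpha> tn] Yd') auto
      also have "\<dots> \<le> real k * ((1 - d) powr - \<alpha> - (1 + d) powr - \<alpha>)"
        using s d \<alpha> by (intro mult_right_mono) (auto intro!: powr_mono2')
      also have "\<dots> \<le> 1 / Suc k" using elim(2) by (simp add: d_def)
      finally show ?thesis .
    qed
    have "\<exists>l\<in>time_changes. (\<forall>s\<ge>0. \<bar>l s - s\<bar> \<le> 1 / Suc k)
        \<and> (\<forall>s\<in>{0..real k}. l s = real_clock \<alpha> (Y n) (t n * s) / t n)"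
      by (rule time_change_from_clock[OF nv \<alpha> tn of_nat_0_le_iff near])
    then obtain l where l: "l \<in> time_changes"
      "\<And>s. 0 \<le> s \<Longrightarrow> \<bar>l s - s\<bar> \<le> 1 / Suc k" "\<And>s. s \<in> {0..real k} \<Longrightarrow> l s = real_clock \<alpha> (Y n) (t n * s) / t n" by blast
    have "\<bar>?R n (l s) - (\<lambda>s\<in>{0..}. Im (z s)) s\<bar> \<le> 1 / Suc k" if s: "s \<in> {0..real k}" for s
    proof -
      have s0: "0 \<le> s" "0 \<le> t n * s" using s tn by auto
      have ls: "0 \<le> l s" using time_changesD(2)[OF l(1) s0(1)] .
      have "t n * l s = real_clock \<alpha> (Y n) (t n * s)" using l(3)[OF s] tn by simp
      moreover have "0 \<le> t n * l s" using ls tn by simp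
      ultimately have "time_changed_winding \<alpha> (\<lambda>s y. y s) (t n * l s) (Y n) = winding_angle (Y n) (t n * s)"
        using time_changed_winding_eq[where Z = "\<lambda>s y. y s" and \<omega> = "Y n" and u = "t n * l s", OF good \<alpha>]
          inverse_clock_real_clock[OF nv \<alpha> s0(2)] by simp
      also have "\<dots> = Arg (Y n (t n * s))"
      proof (rule winding_angle_small[where T = "t n * real k"])
        show "norm (Y n r - 1) \<le> 1 / 2" if "r \<in> {0..t n * real k}" for r using Yd'[OF that] d by linarith
        show "Y n 0 = 1" using nv by (simp add: nonvanishing_path_def)
      qed (use s tn in auto)
      finally have R: "?R n (l s) = Arg (Y n (t n * s)) / \<epsilon> n"
        using ls tn by (simp add: \<epsilon>_def powr_minus divide_inverse mult.commute)
      define w where "w = \<epsilon> n *\<^sub>R (z s - 1)"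
      have w: "Y n (t n * s) = 1 + w" using Yd(2)[OF s] by (simp add: w_def algebra_simps)
      have nw: "norm w \<le> \<epsilon> n * B" using B(2)[OF s] \<epsilon>[of n] by (simp add: w_def mult_left_mono)
      have "\<bar>Arg (1 + w) - Im w\<bar> \<le> 2 * (norm w)\<^sup>2" by (rule Arg_near_1(1)) (use nw elim(1) in linarith)
      also have "\<dots> \<le> 2 * (\<epsilon> n * B)\<^sup>2" using nw by (intro mult_left_mono power_mono) auto
      finally have "\<bar>Arg (1 + w) - Im w\<bar> \<le> \<epsilon> n * (\<epsilon> n * (2 * B\<^sup>2))" by (simp add: power2_eq_square algebra_simps)
      also have "\<dots> \<le> \<epsilon> n * (1 / Suc k)" using elim(3) \<epsilon>[of n] by (intro mult_left_mono) auto
      finally have "\<bar>Arg (1 + w) - Im w\<bar> / \<epsilon> n \<le> 1 / Suc k"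
        using \<epsilon>[of n] by (simp add: pos_divide_le_eq mult.commute)
      moreover have "\<bar>Arg (1 + w) - Im w\<bar> / \<epsilon> n = \<bar>Arg (1 + w) / \<epsilon> n - Im (z s)\<bar>"
      proof -
        have "Im w = \<epsilon> n * Im (z s)" by (simp add: w_def)
        then have "(Arg (1 + w) - Im w) / \<epsilon> n = Arg (1 + w) / \<epsilon> n - Im (z s)" using \<epsilon>[of n] by (simp add: diff_divide_distrib)
        moreover have "\<bar>(Arg (1 + w) - Im w) / \<epsilon> n\<bar> = \<bar>Arg (1 + w) - Im w\<bar> / \<epsilon> n" using \<epsilon>[of n] by simp
        ultimately show ?thesis by simp
      qed
      ultimately show ?thesis using R w s0 by simp
    qed
    then show ?case unfolding skorokhod_ball_def mem_Collect_eq
      by (intro bexI[OF _ l(1)] conjI allI ballI impI l(2)) auto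
  qed
qed

section \<open>Convergence in distribution\<close>

lemma continuous_map_measurable:
  assumes "continuous_map skorokhod_topology euclideanreal \<Phi>"
  shows "\<Phi> \<in> borel_measurable skorokhod_borel"
proof (rule borel_measurableI)
  fix S :: "real set" assume "open S"
  then have "openin skorokhod_topology {x \<in> topspace skorokhod_topology. \<Phi> x \<in> S}"
    using assms by (auto simp: continuous_map_def)
  then have "skorokhod_open {x \<in> skorokhod_space. \<Phi> x \<in> S}"
    by (simp add: openin_skorokhod_topology topspace_skorokhod_topology)
  moreover have "\<Phi> -` S \<inter> space skorokhod_borel = {x \<in> skorokhod_space. \<Phi> x \<in> S}"
    by (auto simp: space_skorokhod_borel)
  ultimately show "\<Phi> -` S \<inter> space skorokhod_borel \<in> sets skorokhod_borel"
    by (simp add: sets_skorokhod_borel)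
qed

lemma continuous_map_skorokhod_converges:
  assumes \<Phi>: "continuous_map skorokhod_topology euclideanreal \<Phi>"
    and xs: "\<And>n. xs n \<in> skorokhod_space" and x: "x \<in> skorokhod_space" and conv: "skorokhod_converges xs x"
  shows "(\<lambda>n. \<Phi> (xs n)) \<longlonglongrightarrow> \<Phi> x"
proof (rule topological_tendstoI)
  fix S assume S: "open S" "\<Phi> x \<in> S"
  then have "openin skorokhod_topology {x \<in> topspace skorokhod_topology. \<Phi> x \<in> S}"
    using \<Phi> by (auto simp: continuous_map_def)
  then have "skorokhod_open {x \<in> skorokhod_space. \<Phi> x \<in> S}"
    by (simp add: openin_skorokhod_topology topspace_skorokhod_topology)
  then have "\<forall>\<^sub>F n in sequentially. xs n \<in> {x \<in> skorokhod_space. \<Phi> x \<in> S}"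
    unfolding skorokhod_open_def using S(2) x xs conv by blast
  then show "\<forall>\<^sub>F n in sequentially. \<Phi> (xs n) \<in> S" by eventually_elim simp
qed

lemma sample_path_in_skorokhod_space: "sample_path X \<omega> \<in> skorokhod_space"
proof -
  have "cadlag (\<lambda>s\<in>{0..}. X s \<omega>)" if "cadlag (\<lambda>s. X s \<omega>)" by (rule cadlag_cong[OF _ that]) simp
  moreover have "cadlag (\<lambda>s\<in>{0..}. 0 :: real)" by (rule cadlag_cong[of "\<lambda>_. 0"]) (auto simp: cadlag_def)
  ultimately show ?thesis by (auto simp: sample_path_def skorokhod_space_def)
qed

text \<open>Changing a random path on a null set does not affect its measurability with respect to
  the completion, nor its law.\<close>

lemma sample_path_version:
  fixes \<Phi> :: "(real \<Rightarrow> real) \<Rightarrow> real"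
  assumes g: "g \<in> M \<rightarrow>\<^sub>M skorokhod_borel"
    and eq: "AE \<omega> in M. cadlag (\<lambda>s. X s \<omega>) \<and> (\<lambda>s\<in>{0..}. X s \<omega>) = g \<omega>"
  shows "skorokhod_random_element M X"
    and "\<Phi> \<in> borel_measurable skorokhod_borel \<Longrightarrow> (\<integral>x. \<Phi> x \<partial>skorokhod_law M X) = (\<integral>\<omega>. \<Phi> (g \<omega>) \<partial>M)"
proof -
  have ae: "AE \<omega> in M. sample_path X \<omega> = g \<omega>" using eq by eventually_elim (simp add: sample_path_def)
  then have ae': "AE \<omega> in completion M. sample_path X \<omega> = g \<omega>" by (rule AE_completion)
  have g': "g \<in> completion M \<rightarrow>\<^sub>M skorokhod_borel" by (rule measurable_completion[OF g])
  have m: "sample_path X \<in> completion M \<rightarrow>\<^sub>M skorokhod_borel"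
  proof (rule measurableI)
    show "sample_path X \<omega> \<in> space skorokhod_borel" for \<omega>
      by (simp add: space_skorokhod_borel sample_path_in_skorokhod_space)
    fix A assume A: "A \<in> sets skorokhod_borel"
    show "sample_path X -` A \<inter> space (completion M) \<in> sets (completion M)"
    proof (rule completion.in_sets_AE)
      show "AE \<omega> in completion M. \<omega> \<in> g -` A \<inter> space (completion M) \<longleftrightarrow> \<omega> \<in> sample_path X -` A \<inter> space (completion M)"
        using ae' by eventually_elim auto
      show "g -` A \<inter> space (completion M) \<in> sets (completion M)" by (rule measurable_sets[OF g' A])
    qed auto
  qed
  have "AE \<omega> in M. cadlag (\<lambda>s. X s \<omega>)" using eq by eventually_elim simp
  with m show "skorokhod_random_element M X" by (simp add: skorokhod_random_element_def)
  assume \<Phi>: "\<Phi> \<in> borel_measurable skorokhod_borel"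
  have "(\<integral>x. \<Phi> x \<partial>skorokhod_law M X) = (\<integral>\<omega>. \<Phi> (sample_path X \<omega>) \<partial>completion M)"
    unfolding skorokhod_law_def by (rule integral_distr[OF m \<Phi>])
  also have "\<dots> = (\<integral>\<omega>. \<Phi> (g \<omega>) \<partial>completion M)"
    by (rule integral_cong_AE) (use ae' measurable_compose[OF m \<Phi>] measurable_compose[OF g' \<Phi>] in auto)
  also have "\<dots> = (\<integral>\<omega>. \<Phi> (g \<omega>) \<partial>M)"
    by (rule integral_completion) (rule measurable_compose[OF g \<Phi>])
  finally show "(\<integral>x. \<Phi> x \<partial>skorokhod_law M X) = (\<integral>\<omega>. \<Phi> (g \<omega>) \<partial>M)" .
qed

definition scaled_winding :: "real \<Rightarrow> real \<Rightarrow> (real \<Rightarrow> complex) \<Rightarrow> real \<Rightarrow> real" where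
  "scaled_winding \<alpha> t y = (\<lambda>s\<in>{0..}. t powr (- 1 / \<alpha>) * time_changed_winding \<alpha> (\<lambda>s y. y s) (t * s) y)"

lemma scaled_winding_measurable:
  assumes \<alpha>: "0 < \<alpha>" and t: "0 < t"
  shows "scaled_winding \<alpha> t \<in> good_paths \<alpha> \<rightarrow>\<^sub>M skorokhod_borel"
  unfolding scaled_winding_def[abs_def]
proof (rule measurable_skorokhod_borel[where X = "\<lambda>s y. t powr (- 1 / \<alpha>) * time_changed_winding \<alpha> (\<lambda>s y. y s) (t * s) y"])
  have good: "good_path \<alpha> (\<lambda>s. y s)" if "y \<in> space (good_paths \<alpha>)" for y using that by (simp add: space_good_paths)
  show "(\<lambda>y. t powr (- 1 / \<alpha>) * time_changed_winding \<alpha> (\<lambda>s y. y s) (t * s) y) \<in> borel_measurable (good_paths \<alpha>)"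
    if "0 \<le> s" for s
  proof -
    have "time_changed_winding \<alpha> (\<lambda>s y. y s) (t * s) \<in> borel_measurable (good_paths \<alpha>)"
      by (rule time_changed_winding_measurable[OF good_paths_component good \<alpha>]) (use that t in auto)
    then show ?thesis by measurable
  qed
  show "cadlag (\<lambda>s. t powr (- 1 / \<alpha>) * time_changed_winding \<alpha> (\<lambda>s y. y s) (t * s) y)"
    if "y \<in> space (good_paths \<alpha>)" for y
    by (rule cadlag_scaled_time_changed_winding[where Z = "\<lambda>s y. y s" and \<omega> = y, OF good[OF that] \<alpha> t])
qed

context planar_stable_process
begin

text \<open>The time-changed winding only depends on the values of the path at nonnegative times,
  so it may be computed from the good version of the path.\<close>

lemma scaled_winding_version:
  assumes p: "good_path_version M \<alpha> Z p" and t: "0 < t"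
  shows "(\<lambda>\<omega>. scaled_winding \<alpha> t (p \<omega>)) \<in> M \<rightarrow>\<^sub>M skorokhod_borel"
    and "AE \<omega> in M. cadlag (\<lambda>s. t powr (- 1 / \<alpha>) * time_changed_winding \<alpha> Z (t * s) \<omega>)
        \<and> (\<lambda>s\<in>{0..}. t powr (- 1 / \<alpha>) * time_changed_winding \<alpha> Z (t * s) \<omega>) = scaled_winding \<alpha> t (p \<omega>)"
proof -
  have pm: "p \<in> M \<rightarrow>\<^sub>M good_paths \<alpha>" and ae: "AE \<omega> in M. \<forall>s\<ge>0. p \<omega> s = Z s \<omega>"
    using p by (auto simp: good_path_version_def)
  show "(\<lambda>\<omega>. scaled_winding \<alpha> t (p \<omega>)) \<in> M \<rightarrow>\<^sub>M skorokhod_borel"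
    by (rule measurable_compose[OF pm scaled_winding_measurable[OF \<alpha>(1) t]])
  show "AE \<omega> in M. cadlag (\<lambda>s. t powr (- 1 / \<alpha>) * time_changed_winding \<alpha> Z (t * s) \<omega>)
        \<and> (\<lambda>s\<in>{0..}. t powr (- 1 / \<alpha>) * time_changed_winding \<alpha> Z (t * s) \<omega>) = scaled_winding \<alpha> t (p \<omega>)"
    using ae AE_good_path
  proof eventually_elim
    case (elim \<omega>)
    have "time_changed_winding \<alpha> Z (t * s) \<omega> = time_changed_winding \<alpha> (\<lambda>s y. y s) (t * s) (p \<omega>)" if "0 \<le> s" for s
      by (rule time_changed_winding_cong[where X = Z and Y = "\<lambda>s y. y s"]) (use elim \<alpha> t that in auto)
    then show ?case
      using cadlag_scaled_time_changed_winding[where Z = Z and \<omega> = \<omega>, OF elim(2) \<alpha>(1) t]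
      by (auto simp: scaled_winding_def intro!: restrict_ext)
  qed
qed

end

theorem theorem4p1:
  fixes \<alpha> :: real and M :: "'w measure" and Z :: "real \<Rightarrow> 'w \<Rightarrow> complex"
  assumes "0 < \<alpha>" and "\<alpha> < 2"
    and "isotropic_stable_process M \<alpha> 1 1 Z"
  shows "\<exists>c>0. \<exists>(N :: (real \<Rightarrow> real) measure) (\<zeta> :: real \<Rightarrow> (real \<Rightarrow> real) \<Rightarrow> real).
    isotropic_stable_process N \<alpha> c 0 \<zeta> \<and>
    converges_in_distribution M
      (\<lambda>t s \<omega>. t powr (- 1 / \<alpha>) * time_changed_winding \<alpha> Z (t * s) \<omega>) (at_right 0) N \<zeta>"
proof -
  have pl: "planar_stable_process M \<alpha> Z"
    using assms by (simp add: planar_stable_process_def planar_stable_process_axioms_def)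
  interpret planar_stable_process M \<alpha> Z by (rule pl)
  obtain p where p: "good_path_version M \<alpha> Z p" using good_path_version_exists by blast
  have pm: "p \<in> M \<rightarrow>\<^sub>M good_paths \<alpha>" and pZ: "AE \<omega> in M. \<forall>s\<ge>0. p \<omega> s = Z s \<omega>"
    using p by (auto simp: good_path_version_def)
  \<comment> \<open>the path space with the trace of the product \<open>\<sigma>\<close>-algebra, on which the limit lives\<close>
  define D :: "(real \<Rightarrow> real) measure" where "D = restrict_space (PiM {0..} (\<lambda>_. borel)) skorokhod_space"
  define q where "q \<omega> = (\<lambda>s\<in>{0..}. Im (p \<omega> s))" for \<omega>
  define \<zeta> :: "real \<Rightarrow> (real \<Rightarrow> real) \<Rightarrow> real" where "\<zeta> s f = f s" for s f
  define N where "N = distr M D q"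
  have spD: "f \<in> skorokhod_space" if "f \<in> space D" for f
    using that by (simp add: D_def space_restrict_space)
  have cadD: "cadlag (\<lambda>s. \<zeta> s f)" if "f \<in> space D" for f
    using spD[OF that] by (simp add: \<zeta>_def skorokhod_space_def)
  have \<zeta>m: "\<zeta> s \<in> borel_measurable D" if "0 \<le> s" for s
    unfolding \<zeta>_def[abs_def] D_def using that
    by (intro measurable_restrict_space1 measurable_component_singleton) simp
  have qD: "q \<omega> \<in> skorokhod_space" if "\<omega> \<in> space M" for \<omega>
  proof -
    have "cadlag (p \<omega>)" using measurable_space[OF pm that]
      by (simp add: space_good_paths good_path_def nonvanishing_path_def)
    then have "cadlag (\<lambda>s. Im (p \<omega> s))" by (rule cadlag_continuous_image) (intro continuous_intros)
    then have "cadlag (q \<omega>)" by (rule cadlag_cong[rotated]) (simp add: q_def)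
    then show ?thesis by (simp add: skorokhod_space_def q_def)
  qed
  have qm: "q \<in> M \<rightarrow>\<^sub>M D" unfolding D_def
  proof (rule measurable_restrict_space2)
    show "q \<in> M \<rightarrow>\<^sub>M PiM {0..} (\<lambda>_. borel)" unfolding q_def[abs_def]
    proof (rule measurable_restrict)
      fix s :: real assume "s \<in> {0..}"
      then have "(\<lambda>\<omega>. p \<omega> s) \<in> borel_measurable M" by (intro measurable_compose[OF pm good_paths_component]) simp
      then show "(\<lambda>\<omega>. Im (p \<omega> s)) \<in> borel_measurable M" by measurable
    qed
  qed (use qD in auto)
  have stable: "isotropic_stable_process N \<alpha> 1 0 \<zeta>"
    unfolding N_def
  proof (rule isotropic_stable_process_transport[OF imaginary_part_stable qm \<zeta>m cadD])
    show "AE \<omega> in M. \<forall>s\<ge>0. \<zeta> s (q \<omega>) = Im (Z s \<omega>)"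
      using pZ by eventually_elim (simp add: \<zeta>_def q_def)
  qed
  define r :: "(real \<Rightarrow> real) \<Rightarrow> real \<Rightarrow> real" where "r f = (\<lambda>s\<in>{0..}. \<zeta> s f)" for f
  have rm: "r \<in> D \<rightarrow>\<^sub>M skorokhod_borel"
    unfolding r_def[abs_def] by (rule measurable_skorokhod_borel[OF \<zeta>m cadD])
  have rq: "r (q \<omega>) = q \<omega>" for \<omega> by (auto simp: r_def \<zeta>_def q_def)
  have rN: "r \<in> N \<rightarrow>\<^sub>M skorokhod_borel" using rm by (simp add: N_def)
  have "AE f in N. cadlag (\<lambda>s. \<zeta> s f) \<and> (\<lambda>s\<in>{0..}. \<zeta> s f) = r f"
    by (rule AE_I2) (use cadD in \<open>auto simp: N_def r_def\<close>)
  note limit = sample_path_version[OF rN this]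
  have scaled: "skorokhod_random_element M (\<lambda>s \<omega>. t powr (- 1 / \<alpha>) * time_changed_winding \<alpha> Z (t * s) \<omega>)"
    "\<Phi> \<in> borel_measurable skorokhod_borel \<Longrightarrow>
      (\<integral>x. \<Phi> x \<partial>skorokhod_law M (\<lambda>s \<omega>. t powr (- 1 / \<alpha>) * time_changed_winding \<alpha> Z (t * s) \<omega>))
        = (\<integral>\<omega>. \<Phi> (scaled_winding \<alpha> t (p \<omega>)) \<partial>M)"
    if "0 < t" for t and \<Phi> :: "(real \<Rightarrow> real) \<Rightarrow> real"
    using sample_path_version[OF scaled_winding_version[OF p that]] by blast+
  have "converges_in_distribution M
      (\<lambda>t s \<omega>. t powr (- 1 / \<alpha>) * time_changed_winding \<alpha> Z (t * s) \<omega>) (at_right 0) N \<zeta>"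
    unfolding converges_in_distribution_def
  proof (intro conjI allI impI)
    show "\<forall>\<^sub>F t in at_right 0. skorokhod_random_element M (\<lambda>s \<omega>. t powr (- 1 / \<alpha>) * time_changed_winding \<alpha> Z (t * s) \<omega>)"
      using eventually_at_right_less[of 0] by eventually_elim (rule scaled(1))
    show "skorokhod_random_element N \<zeta>" by (rule limit(1))
    fix \<Phi> assume "continuous_map skorokhod_topology euclideanreal \<Phi> \<and> bounded (\<Phi> ` skorokhod_space)"
    then have \<Phi>: "continuous_map skorokhod_topology euclideanreal \<Phi>" and bd: "bounded (\<Phi> ` skorokhod_space)" by auto
    obtain B where B: "\<And>x. x \<in> skorokhod_space \<Longrightarrow> \<bar>\<Phi> x\<bar> \<le> B"
      using bd unfolding bounded_iff by auto
    note \<Phi>m = continuous_map_measurable[OF \<Phi>]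
    have L: "(\<integral>x. \<Phi> x \<partial>skorokhod_law N \<zeta>) = (\<integral>\<omega>. \<Phi> (q \<omega>) \<partial>M)"
    proof -
      have "(\<integral>x. \<Phi> x \<partial>skorokhod_law N \<zeta>) = (\<integral>f. \<Phi> (r f) \<partial>distr M D q)"
        using limit(2)[OF \<Phi>m] by (simp add: N_def)
      also have "\<dots> = (\<integral>\<omega>. \<Phi> (r (q \<omega>)) \<partial>M)"
        by (rule integral_distr[OF qm]) (rule measurable_compose[OF rm \<Phi>m])
      finally show ?thesis by (simp add: rq)
    qed
    show "((\<lambda>t. \<integral>x. \<Phi> x \<partial>skorokhod_law M (\<lambda>s \<omega>. t powr (- 1 / \<alpha>) * time_changed_winding \<alpha> Z (t * s) \<omega>))
        \<longlongrightarrow> (\<integral>x. \<Phi> x \<partial>skorokhod_law N \<zeta>)) (at_right 0)"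
    proof (rule tendsto_at_right_sequentially[of 0 1])
      fix S :: "nat \<Rightarrow> real" assume S0: "\<And>n. 0 < S n" and S: "S \<longlonglongrightarrow> 0"
      \<comment> \<open>the coupling: \<open>Y n\<close> has the law of \<open>Z\<close> but stays close to 1 up to times of order \<open>S n\<close>\<close>
      define Y where "Y n s \<omega> = 1 + (S n powr (1 / \<alpha>)) *\<^sub>R (Z (s / S n) \<omega> - 1)" for n s \<omega>
      have Y: "planar_stable_process M \<alpha> (Y n)" for n
        using scaled_process[OF S0] unfolding Y_def[abs_def] .
      have "\<exists>p. good_path_version M \<alpha> (Y n) p" for n
        by (rule planar_stable_process.good_path_version_exists[OF Y])
      then obtain pn where pn: "\<And>n. good_path_version M \<alpha> (Y n) (pn n)" by metis
      have pnm: "pn n \<in> M \<rightarrow>\<^sub>M good_paths \<alpha>" for n using pn by (simp add: good_path_version_def)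
      have pnY: "AE \<omega> in M. \<forall>n. \<forall>s\<ge>0. pn n \<omega> s = Y n s \<omega>"
        unfolding AE_all_countable using pn by (simp add: good_path_version_def)
      have sw: "(\<lambda>y. \<Phi> (scaled_winding \<alpha> (S n) y)) \<in> borel_measurable (good_paths \<alpha>)" for n
        by (rule measurable_compose[OF scaled_winding_measurable[OF \<alpha>(1) S0] \<Phi>m])
      have law: "(\<integral>\<omega>. \<Phi> (scaled_winding \<alpha> (S n) (p \<omega>)) \<partial>M) = (\<integral>\<omega>. \<Phi> (scaled_winding \<alpha> (S n) (pn n \<omega>)) \<partial>M)" for n
        using integral_distr[OF pm sw[of n]] integral_distr[OF pnm sw[of n], of n]
          good_path_law_unique[OF pl Y p pn, of n] by simp
      have in_D: "scaled_winding \<alpha> (S n) (pn n \<omega>) \<in> skorokhod_space" if "\<omega> \<in> space M" for n \<omega>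
        using measurable_space[OF measurable_compose[OF pnm scaled_winding_measurable[OF \<alpha>(1) S0]] that]
        by (simp add: space_skorokhod_borel)
      have "(\<lambda>n. \<integral>\<omega>. \<Phi> (scaled_winding \<alpha> (S n) (pn n \<omega>)) \<partial>M) \<longlonglongrightarrow> (\<integral>\<omega>. \<Phi> (q \<omega>) \<partial>M)"
      proof (rule integral_dominated_convergence[where w = "\<lambda>_. B"])
        show "(\<lambda>\<omega>. \<Phi> (q \<omega>)) \<in> borel_measurable M"
          using measurable_compose[OF qm measurable_compose[OF rm \<Phi>m]] by (simp add: rq)
        show "(\<lambda>\<omega>. \<Phi> (scaled_winding \<alpha> (S n) (pn n \<omega>))) \<in> borel_measurable M" for n
          by (rule measurable_compose[OF pnm sw])
        show "AE \<omega> in M. norm (\<Phi> (scaled_winding \<alpha> (S n) (pn n \<omega>))) \<le> B" for n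
          by (rule AE_I2) (use B in_D in simp)
        show "AE \<omega> in M. (\<lambda>n. \<Phi> (scaled_winding \<alpha> (S n) (pn n \<omega>))) \<longlonglongrightarrow> \<Phi> (q \<omega>)"
          using pnY pZ start cadlag_paths AE_space
        proof eventually_elim
          case (elim \<omega>)
          have "skorokhod_converges (\<lambda>n. scaled_winding \<alpha> (S n) (pn n \<omega>)) (\<lambda>s\<in>{0..}. Im (Z s \<omega>))"
            unfolding scaled_winding_def
          proof (rule scaled_winding_converges[OF \<alpha>(1) elim(4) elim(3) S0 S])
            show "good_path \<alpha> (pn n \<omega>)" for n
              using measurable_space[OF pnm elim(5)] by (simp add: space_good_paths)
            show "pn n \<omega> s = 1 + (S n powr (1 / \<alpha>)) *\<^sub>R (Z (s / S n) \<omega> - 1)" if "0 \<le> s" for n s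
              using elim(1) that by (simp add: Y_def)
          qed
          moreover have "(\<lambda>s\<in>{0..}. Im (Z s \<omega>)) = q \<omega>"
            using elim(2) by (auto simp: q_def intro!: restrict_ext)
          ultimately show ?case
            using continuous_map_skorokhod_converges[OF \<Phi> in_D[OF elim(5)] qD[OF elim(5)]] by simp
        qed
      qed simp
      then show "(\<lambda>n. \<integral>x. \<Phi> x \<partial>skorokhod_law M (\<lambda>s \<omega>. S n powr (- 1 / \<alpha>) * time_changed_winding \<alpha> Z (S n * s) \<omega>))
          \<longlonglongrightarrow> (\<integral>x. \<Phi> x \<partial>skorokhod_law N \<zeta>)"
        using scaled(2)[OF S0 \<Phi>m] by (simp add: L law)
    qed simp
  qed
  with stable show ?thesis by (intro exI[of _ 1] conjI exI[of _ N] exI[of _ \<zeta>]) simp_all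
qed

end
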